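(* In the setting described in the context, let $\mathcal A:=\mathcal O[t_{j+1},\dots,t_n]=\bigoplus_{i=0}^{m-1}R\,w_i$. Then: (i) $\mathcal A$ is the integral closure of $R$ in $L$, and is a Krull domain; (ii) every $g\in L$ has a representation $g=\sum_{i=0}^{m-1}(a_i/d)\,w_i$ with $a_i,d\in R$, $d\neq 0$, $\gcd(d,a_0,\dots,a_{m-1})=1$, unique up to units of $F$ (i.e. up to multiplying $d$ and all $a_i$ by a common element of $F^*$); (iii) $\operatorname{Cl}(\mathcal A)\cong\operatorname{Cl}(\mathcal O)$, the isomorphism being induced by extension of divisors, and $\mathcal A^*=\mathcal O^*$.
   Context: All fields have characteristic $0$; $\overline F$ is an algebraic closure of $F$. $(L,D)$ is a differential field built as follows. (T1) $K_0=F(t_1,\dots,t_j)$ with $DF\subseteq F$, each $t_i$ transcendental over $F(t_1,\dots,t_{i-1})$ and $Dt_i\in F(t_1,\dots,t_i)$; $R_0=F[t_1,\dots,t_j]$. (T2) $y^m=q\in R_0$, where $q$ is $m$-th-power-free, $Y^m-q$ is irreducible over $\overline F(t_1,\dots,t_j)$, and $q=\prod_l Q_l^{\,l}$ is its squarefree decomposition ($Q_l$ squarefree and pairwise coprime). (T3) $t_{j+1},\dots,t_n$ are successively transcendental over the field below, with $Dt_i\in K_0(y)(t_{j+1},\dots,t_i)$. (T4) $L=K_0(y)(t_{j+1},\dots,t_n)$ has field of constants $F$. Put $R=F[t_1,\dots,t_n]$ (a UFD) and let $\mathcal O$ be the integral closure of $R_0$ in $K_0(y)$. It is known that $\mathcal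 O$ is a free $R_0$-module with basis $w_i=y^i/E_i$, $0\le i\le m-1$, where $E_i=\prod_l Q_l^{\lfloor il/m\rfloor}$. $\operatorname{Cl}$ denotes the divisor class group of a Krull domain. *)

theory Defs
  imports
    "HOL-Algebra.Divisibility"
    "HOL-Algebra.Coset"
    "HOL-Algebra.Generated_Fields"
    "HOL-Algebra.Algebraic_Closure_Type"
    "HOL-Computational_Algebra.Polynomial"
begin

text \<open>
  Every ring below is a subset of one ambient field, given as a type; \<^const>\<open>ring_of_type_algebra\<close>
  is that field as a HOL-Algebra structure.
\<close>

abbreviation induced_ring :: "'a::field set \<Rightarrow> 'a ring" where
  "induced_ring A \<equiv> ring_of_type_algebra\<lparr>carrier := A\<rparr>"

abbreviation ring_adjoin :: "'a::field set \<Rightarrow> 'a set \<Rightarrow> 'a set" where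
  "ring_adjoin A S \<equiv> generate_ring ring_of_type_algebra (A \<union> S)"

abbreviation field_adjoin :: "'a::field set \<Rightarrow> 'a set \<Rightarrow> 'a set" where
  "field_adjoin K S \<equiv> generate_field ring_of_type_algebra (K \<union> S)"


section \<open>Polynomials with coefficients in a subset\<close>

definition polys_over :: "'a::field set \<Rightarrow> 'a poly set" where
  "polys_over A = {p. \<forall>i. Polynomial.coeff p i \<in> A}"

definition transcendental_over :: "'a::field set \<Rightarrow> 'a \<Rightarrow> bool" where
  "transcendental_over K x \<longleftrightarrow> (\<forall>p \<in> polys_over K. poly p x = 0 \<longrightarrow> p = 0)"

definition irreducible_over :: "'a::field set \<Rightarrow> 'a poly \<Rightarrow> bool" where
  "irreducible_over K p \<longleftrightarrow> p \<in> polys_over K \<and> Polynomial.degree p > 0 \<and>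
     (\<forall>g \<in> polys_over K. \<forall>h \<in> polys_over K.
        p = g * h \<longrightarrow> Polynomial.degree g = 0 \<or> Polynomial.degree h = 0)"

definition integral_closure :: "'a::field set \<Rightarrow> 'a set \<Rightarrow> 'a set" where
  "integral_closure A K =
     {x \<in> K. \<exists>p \<in> polys_over A. Polynomial.lead_coeff p = 1 \<and> poly p x = 0}"

text \<open>
  For a subfield \<open>F\<close>, the elements of the algebraic closure of the ambient field that are algebraic
  over \<open>F\<close> form an algebraic closure of \<open>F\<close>.
\<close>

definition alg_closure_of :: "'a::field set \<Rightarrow> 'a alg_closure set" where
  "alg_closure_of F = {x. \<not> transcendental_over (to_ac ` F) x}"


section \<open>Divisibility in a subring\<close>

text \<open>
  \<open>1\<close> is a greatest common divisor of \<open>S\<close> in \<open>A\<close>: since \<open>1\<close> always divides everything, this says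
  that every common divisor is a unit.
\<close>

definition gcd_one :: "'a::field set \<Rightarrow> 'a set \<Rightarrow> bool" where
  "gcd_one A S \<longleftrightarrow>
     (\<forall>c \<in> A. (\<forall>s \<in> S. c divides\<^bsub>induced_ring A\<^esub> s) \<longrightarrow> c \<in> Units (induced_ring A))"

definition power_free :: "nat \<Rightarrow> 'a::field set \<Rightarrow> 'a \<Rightarrow> bool" where
  "power_free k A x \<longleftrightarrow>
     (\<forall>c \<in> A. (c ^ k) divides\<^bsub>induced_ring A\<^esub> x \<longrightarrow> c \<in> Units (induced_ring A))"


section \<open>Derivations\<close>

definition derivation :: "('a::field \<Rightarrow> 'a) \<Rightarrow> bool" where
  "derivation D \<longleftrightarrow> (\<forall>x y. D (x + y) = D x + D y) \<and> (\<forall>x y. D (x * y) = D x * y + x * D y)"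


section \<open>Krull domains\<close>

definition fractions :: "'a::field set \<Rightarrow> 'a set" where
  "fractions A = {a / b | a b. a \<in> A \<and> b \<in> A \<and> b \<noteq> 0}"

text \<open>Normalised discrete valuations on a subfield \<open>K\<close>; the value at \<open>0\<close> is irrelevant.\<close>

definition discrete_valuation :: "'a::field set \<Rightarrow> ('a \<Rightarrow> int) \<Rightarrow> bool" where
  "discrete_valuation K v \<longleftrightarrow>
     v ` (K - {0}) = UNIV \<and>
     (\<forall>x \<in> K - {0}. \<forall>y \<in> K - {0}. v (x * y) = v x + v y) \<and>
     (\<forall>x \<in> K - {0}. \<forall>y \<in> K - {0}. x + y \<noteq> 0 \<longrightarrow> v (x + y) \<ge> min (v x) (v y))"

definition krull_domain :: "'a::field set \<Rightarrow> bool" where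
  "krull_domain A \<longleftrightarrow> subring A ring_of_type_algebra \<and>
     (\<exists>V. (\<forall>v \<in> V. discrete_valuation (fractions A) v) \<and>
          (\<forall>x \<in> fractions A - {0}. x \<in> A \<longleftrightarrow> (\<forall>v \<in> V. v x \<ge> 0)) \<and>
          (\<forall>x \<in> fractions A - {0}. finite {v \<in> V. v x \<noteq> 0}))"


section \<open>The divisor class group\<close>

text \<open>
  Divisors are represented by divisorial fractional ideals, as in Bourbaki and Fossum. The product
  of two divisors is the divisorial hull \<open>A : (A : I J)\<close> of the product of ideals.
\<close>

definition is_submodule :: "'a::field set \<Rightarrow> 'a set \<Rightarrow> bool" where
  "is_submodule A M \<longleftrightarrow>
     0 \<in> M \<and> (\<forall>x \<in> M. \<forall>y \<in> M. x + y \<in> M) \<and> (\<forall>a \<in> A. \<forall>x \<in> M. a * x \<in> M)"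

definition fractional_ideal :: "'a::field set \<Rightarrow> 'a set \<Rightarrow> bool" where
  "fractional_ideal A I \<longleftrightarrow> I \<subseteq> fractions A \<and> is_submodule A I \<and> I \<noteq> {0} \<and>
     (\<exists>d \<in> A - {0}. \<forall>x \<in> I. d * x \<in> A)"

definition colon :: "'a::field set \<Rightarrow> 'a set \<Rightarrow> 'a set" where
  "colon A I = {x \<in> fractions A. \<forall>y \<in> I. x * y \<in> A}"

definition divisorial_hull :: "'a::field set \<Rightarrow> 'a set \<Rightarrow> 'a set" where
  "divisorial_hull A I = colon A (colon A I)"

definition divisorial :: "'a::field set \<Rightarrow> 'a set \<Rightarrow> bool" where
  "divisorial A I \<longleftrightarrow> fractional_ideal A I \<and> divisorial_hull A I = I"

definition ideal_product :: "'a::field set \<Rightarrow> 'a set \<Rightarrow> 'a set \<Rightarrow> 'a set" where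
  "ideal_product A I J = is_submodule A hull {x * y | x y. x \<in> I \<and> y \<in> J}"

definition divisor_group :: "'a::field set \<Rightarrow> 'a set monoid" where
  "divisor_group A =
     \<lparr>carrier = {I. divisorial A I},
      monoid.mult = (\<lambda>I J. divisorial_hull A (ideal_product A I J)),
      one = A\<rparr>"

definition principal_divisors :: "'a::field set \<Rightarrow> 'a set set" where
  "principal_divisors A = {(\<lambda>a. x * a) ` A | x. x \<in> fractions A - {0}}"

definition class_group :: "'a::field set \<Rightarrow> 'a set set monoid" where
  "class_group A = divisor_group A Mod principal_divisors A"

definition divisor_class :: "'a::field set \<Rightarrow> 'a set \<Rightarrow> 'a set set" where
  "divisor_class A I = principal_divisors A #>\<^bsub>divisor_group A\<^esub> I"

text \<open>For \<open>A \<subseteq> B\<close>, the divisor of \<open>B\<close> given by the extended ideal \<open>I B\<close>.\<close>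

definition extend_divisor :: "'a::field set \<Rightarrow> 'a set \<Rightarrow> 'a set" where
  "extend_divisor B I = divisorial_hull B (is_submodule B hull I)"


section \<open>Reduced representations\<close>

definition reduced_rep ::
    "'a::field set \<Rightarrow> nat \<Rightarrow> (nat \<Rightarrow> 'a) \<Rightarrow> 'a \<Rightarrow> 'a \<Rightarrow> (nat \<Rightarrow> 'a) \<Rightarrow> bool" where
  "reduced_rep R m w g d a \<longleftrightarrow>
     d \<in> R \<and> d \<noteq> 0 \<and> (\<forall>i<m. a i \<in> R) \<and> g = (\<Sum>i<m. (a i / d) * w i) \<and>
     gcd_one R (insert d (a ` {..<m}))"

end

theory Submission
  imports Defs
begin

text \<open>
  Everything is reduced to two stability statements for Noetherian, completely integrally closed
  subrings \<open>B\<close> of \<open>L\<close>, which are Krull domains. First, \<open>B[x]\<close> with \<open>x\<close> transcendental over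
  \<open>Frac B\<close> is again such a ring and \<open>I \<mapsto> I B[x]\<close> induces an isomorphism of divisor class groups:
  a divisorial ideal \<open>J\<close> generates a principal ideal \<open>h K[x]\<close>, and by Gauss' lemma \<open>h\<^sup>-\<^sup>1 J\<close> is
  determined by the ideal of coefficients. Hence all divisorial ideals of \<open>F[t\<^sub>1, \<dots>, t\<^sub>k]\<close> are principal,
  which gives greatest common divisors. Secondly, over such a polynomial ring \<open>R\<close>, if
  \<open>\<Sum> b\<^sub>i y\<^sup>i\<close> is integral then so are its conjugates \<open>\<Sum> b\<^sub>i \<zeta>\<^sup>i y\<^sup>i\<close>, hence the components
  \<open>b\<^sub>i y\<^sup>i\<close>; so \<open>b\<^sub>i\<^sup>m q\<^sup>i \<in> R\<close>, and the squarefree decomposition forces \<open>b\<^sub>i E\<^sub>i \<in> R\<close>.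
  Applied to \<open>F[t\<^sub>1, \<dots>, t\<^sub>k]\<close> for every \<open>k \<ge> j\<close>, this identifies each
  \<open>\<O>[t\<^sub>j\<^sub>+\<^sub>1, \<dots>, t\<^sub>k]\<close> with the integral closure \<open>\<Oplus> F[t\<^sub>1, \<dots>, t\<^sub>k] w\<^sub>i\<close>, and the first
  statement is used along the tower from \<open>\<O>\<close> to \<open>\<A>\<close>.
\<close>

section \<open>Subrings of a field\<close>

text \<open>The conditions carried along the tower are chosen for stability. The chain condition
  survives adjunction of an element and passage to a finite module, and turns almost integral
  elements into integral ones. Complete integral closedness is what makes \<open>A : I\<close>
  inverse to \<open>I\<close>, and it passes to \<open>A[x]\<close> one coefficient at a time. The
  valuations are recovered ring by ring from these two conditions and feed Gauss' lemma. Gcds arise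
  from principal divisorial ideals: \<open>A : S = z A\<close> makes \<open>1 / z\<close> a gcd of
  \<open>S\<close>, so a fraction multiplying a coprime set into \<open>A\<close> lies in
  \<open>A\<close>. All divisibility arguments rest on this. Two obstacles shape the rest. The
  hypotheses on the \<open>Q l\<close> speak of \<open>R0\<close> but are needed over every
  \<open>F[t_1, ..., t_k]\<close>; comparing degrees shows that factors of nonzero elements of the
  smaller ring stay in it (\<open>factor_closed\<close>), which also settles the units. And the
  \<open>m\<close>-th roots of unity may lie outside the ambient field, so conjugates are formed in
  its algebraic closure and integrality is pulled back along \<open>to_ac\<close>.\<close>

lemma rta_simps [simp]:
  "carrier ring_of_type_algebra = UNIV" "monoid.mult ring_of_type_algebra = (*)"
  "one ring_of_type_algebra = 1" "zero ring_of_type_algebra = 0" "add ring_of_type_algebra = (+)"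
  by (auto simp: ring_of_type_algebra_def)

lemma rta_a_inv [simp]: "\<ominus>\<^bsub>ring_of_type_algebra\<^esub> (x::'a::field) = - x"
proof -
  interpret field "ring_of_type_algebra :: 'a ring" by rule
  show ?thesis by (rule minus_equality) auto
qed

lemma rta_m_inv [simp]:
  fixes x :: "'a::field"
  assumes "x \<noteq> 0"
  shows "inv\<^bsub>ring_of_type_algebra\<^esub> x = inverse x"
proof -
  interpret field "ring_of_type_algebra :: 'a ring" by rule
  have "x \<otimes>\<^bsub>ring_of_type_algebra\<^esub> inverse x = \<one>\<^bsub>ring_of_type_algebra\<^esub>"
    using assms by simp
  then show "inv\<^bsub>ring_of_type_algebra\<^esub> x = inverse x"
    by (intro comm_inv_char) auto
qed

locale field_subring =
  fixes A :: "'a::field set"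
  assumes subring: "subring A ring_of_type_algebra"
begin

lemma one [simp, intro]: "1 \<in> A"
  and add [simp, intro]: "x \<in> A \<Longrightarrow> y \<in> A \<Longrightarrow> x + y \<in> A"
  and uminus [simp, intro]: "x \<in> A \<Longrightarrow> - x \<in> A"
  and mult [simp, intro]: "x \<in> A \<Longrightarrow> y \<in> A \<Longrightarrow> x * y \<in> A"
  and zero [simp, intro]: "0 \<in> A"
  using subringE[OF subring] by auto

lemma diff [simp, intro]: "x \<in> A \<Longrightarrow> y \<in> A \<Longrightarrow> x - y \<in> A"
  using add[of x "- y"] by auto

lemma power [simp, intro]: "x \<in> A \<Longrightarrow> x ^ n \<in> A"
  by (induction n) auto

lemma sum [intro]: "(\<And>i. i \<in> I \<Longrightarrow> f i \<in> A) \<Longrightarrow> (\<Sum>i\<in>I. f i) \<in> A"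
  by (induction I rule: infinite_finite_induct) auto

lemma prod [intro]: "(\<And>i. i \<in> I \<Longrightarrow> f i \<in> A) \<Longrightarrow> (\<Prod>i\<in>I. f i) \<in> A"
  by (induction I rule: infinite_finite_induct) auto

lemma of_nat [simp, intro]: "of_nat n \<in> A"
  by (induction n) auto

end

lemma field_subringI:
  assumes "1 \<in> A" "\<And>x. x \<in> A \<Longrightarrow> - x \<in> A" "\<And>x y. x \<in> A \<Longrightarrow> y \<in> A \<Longrightarrow> x + y \<in> A"
    "\<And>x y. x \<in> A \<Longrightarrow> y \<in> A \<Longrightarrow> x * y \<in> A"
  shows "field_subring (A :: 'a::field set)"
proof (rule field_subring.intro)
  interpret field "ring_of_type_algebra :: 'a ring" by rule
  show "subring A ring_of_type_algebra"
    by (rule subringI) (use assms in auto)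
qed

locale field_subfield = field_subring +
  assumes inverse [simp, intro]: "x \<in> A \<Longrightarrow> inverse x \<in> A"
begin

lemma divide [simp, intro]: "x \<in> A \<Longrightarrow> y \<in> A \<Longrightarrow> x / y \<in> A"
  by (simp add: divide_inverse)

end

lemma field_subfieldI:
  assumes "field_subring A" "\<And>x. x \<in> A \<Longrightarrow> x \<noteq> 0 \<Longrightarrow> inverse x \<in> A"
  shows "field_subfield A"
proof -
  interpret field_subring A by fact
  show ?thesis
  proof
    show "inverse x \<in> A" if "x \<in> A" for x
      using assms(2)[OF that] that by (cases "x = 0") auto
  qed
qed

lemma subfield_imp_field_subfield:
  assumes "subfield (A::'a::field set) ring_of_type_algebra"
  shows "field_subfield A"
proof (rule field_subfieldI)
  interpret field "ring_of_type_algebra :: 'a ring" by rule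
  show "field_subring A"
    using subfieldE(1)[OF assms] by (rule field_subring.intro)
  show "inverse x \<in> A" if "x \<in> A" "x \<noteq> 0" for x
    using subfield_m_inv(1)[OF assms, of x] that by auto
qed

lemma divides_induced_iff: "a divides\<^bsub>induced_ring A\<^esub> b \<longleftrightarrow> (\<exists>c\<in>A. b = a * c)"
  by (auto simp: factor_def)

lemma Units_induced_iff: "a \<in> Units (induced_ring A) \<longleftrightarrow> a \<in> A \<and> (\<exists>b\<in>A. a * b = 1)"
  by (auto simp: Units_def mult.commute)

lemma gcd_one_iff:
  "gcd_one A S \<longleftrightarrow> (\<forall>c\<in>A. (\<forall>s\<in>S. \<exists>d\<in>A. s = c * d) \<longrightarrow> (\<exists>d\<in>A. c * d = 1))"
  by (auto simp: gcd_one_def divides_induced_iff Units_induced_iff)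

lemma power_free_iff:
  "power_free k A x \<longleftrightarrow> (\<forall>c\<in>A. (\<exists>d\<in>A. x = c ^ k * d) \<longrightarrow> (\<exists>d\<in>A. c * d = 1))"
  by (auto simp: power_free_def divides_induced_iff Units_induced_iff)

lemma power_free_nonzero:
  assumes "power_free k A x" "field_subring A" "k > 0"
  shows "x \<noteq> 0"
proof
  interpret field_subring A by fact
  assume "x = 0"
  then have "\<exists>d\<in>A. x = 0 ^ k * d" using assms(3) by (intro bexI[of _ 0]) auto
  then have "\<exists>d\<in>A. 0 * d = (1::'a)"
    using assms(1) unfolding power_free_iff by blast
  then show False by auto
qed

subsection \<open>Fields of fractions\<close>

lemma fractionsE:
  assumes "x \<in> fractions A"
  obtains a b where "a \<in> A" "b \<in> A" "b \<noteq> 0" "x = a / b"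
  using assms by (auto simp: fractions_def)

lemma fractionsI: "a \<in> A \<Longrightarrow> b \<in> A \<Longrightarrow> b \<noteq> 0 \<Longrightarrow> a / b \<in> fractions A"
  by (auto simp: fractions_def)

context field_subring
begin

lemma subset_fractions: "A \<subseteq> fractions A"
  using fractionsI[of _ A 1] by auto

lemma fractionsD [simp, intro]: "x \<in> A \<Longrightarrow> x \<in> fractions A"
  using subset_fractions by blast

lemma field_subfield_fractions: "field_subfield (fractions A)"
proof (intro field_subfieldI field_subringI)
  show "1 \<in> fractions A" by simp
  show "- x \<in> fractions A" if "x \<in> fractions A" for x
    using that fractionsI[of "- a" A b for a b] by (elim fractionsE) auto
  show "x + y \<in> fractions A" if "x \<in> fractions A" "y \<in> fractions A" for x y
  proof -
    from that obtain a b c d where *: "a \<in> A" "b \<in> A" "b \<noteq> 0" "x = a / b" "c \<in> A" "d \<in> A" "d \<noteq> 0" "y = c / d"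
      by (elim fractionsE)
    then have "x + y = (a * d + c * b) / (b * d)" by (simp add: field_simps)
    also have "\<dots> \<in> fractions A" using * by (intro fractionsI) auto
    finally show ?thesis .
  qed
  show "x * y \<in> fractions A" if "x \<in> fractions A" "y \<in> fractions A" for x y
  proof -
    from that obtain a b c d where *: "a \<in> A" "b \<in> A" "b \<noteq> 0" "x = a / b" "c \<in> A" "d \<in> A" "d \<noteq> 0" "y = c / d"
      by (elim fractionsE)
    then have "x * y = (a * c) / (b * d)" by simp
    also have "\<dots> \<in> fractions A" using * by (intro fractionsI) auto
    finally show ?thesis .
  qed
  show "inverse x \<in> fractions A" if "x \<in> fractions A" "x \<noteq> 0" for x
    using that by (elim fractionsE) (auto intro!: fractionsI)
qed

lemma fractions_least:
  assumes "field_subfield K" "A \<subseteq> K" shows "fractions A \<subseteq> K"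
proof -
  interpret K: field_subfield K by fact
  show ?thesis using assms(2) by (auto simp: fractions_def)
qed

lemma common_denominator:
  assumes "finite I" "\<And>i. i \<in> I \<Longrightarrow> f i \<in> fractions A"
  obtains d where "d \<in> A" "d \<noteq> 0" "\<And>i. i \<in> I \<Longrightarrow> d * f i \<in> A"
proof -
  have "\<exists>d\<in>A. d \<noteq> 0 \<and> (\<forall>i\<in>I. d * f i \<in> A)"
    using assms
  proof (induction I rule: finite_induct)
    case empty
    show ?case by (intro bexI[of _ 1]) auto
  next
    case (insert i I)
    then obtain d where d: "d \<in> A" "d \<noteq> 0" "\<forall>i\<in>I. d * f i \<in> A" by auto
    obtain a b where ab: "a \<in> A" "b \<in> A" "b \<noteq> 0" "f i = a / b"
      using insert.prems[of i] by (auto elim: fractionsE)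
    show ?case
    proof (intro bexI[of _ "b * d"] conjI ballI)
      fix k assume "k \<in> insert i I"
      then show "b * d * f k \<in> A"
        using d ab by (auto simp: mult.assoc)
    qed (use d ab in auto)
  qed
  then show ?thesis using that by blast
qed

end

lemma fractions_mono: "A \<subseteq> B \<Longrightarrow> fractions A \<subseteq> fractions B"
  by (auto simp: fractions_def)

lemma (in field_subfield) fractions_eq: "fractions A = A"
  using fractions_least[of A] subset_fractions by (auto intro: field_subfield_axioms)

subsection \<open>Polynomials over a subring\<close>

lemma polys_overD [dest]: "p \<in> polys_over A \<Longrightarrow> Polynomial.coeff p i \<in> A"
  and polys_overI [intro]: "(\<And>i. Polynomial.coeff p i \<in> A) \<Longrightarrow> p \<in> polys_over A"
  by (auto simp: polys_over_def)

lemma polys_over_mono: "A \<subseteq> B \<Longrightarrow> polys_over A \<subseteq> polys_over B"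
  by (auto simp: polys_over_def)

lemma (in field_subring) field_subring_polys_over:
  shows polys_over_0 [simp, intro]: "0 \<in> polys_over A"
    and polys_over_1 [simp, intro]: "1 \<in> polys_over A"
    and polys_over_add [simp, intro]: "p \<in> polys_over A \<Longrightarrow> r \<in> polys_over A \<Longrightarrow> p + r \<in> polys_over A"
    and polys_over_uminus [simp, intro]: "p \<in> polys_over A \<Longrightarrow> - p \<in> polys_over A"
    and polys_over_diff [simp, intro]: "p \<in> polys_over A \<Longrightarrow> r \<in> polys_over A \<Longrightarrow> p - r \<in> polys_over A"
    and polys_over_mult [simp, intro]: "p \<in> polys_over A \<Longrightarrow> r \<in> polys_over A \<Longrightarrow> p * r \<in> polys_over A"
    and polys_over_smult [simp, intro]: "a \<in> A \<Longrightarrow> p \<in> polys_over A \<Longrightarrow> Polynomial.smult a p \<in> polys_over A"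
    and polys_over_monom [simp, intro]: "a \<in> A \<Longrightarrow> Polynomial.monom a n \<in> polys_over A"
    and polys_over_pCons [simp]: "pCons a p \<in> polys_over A \<longleftrightarrow> a \<in> A \<and> p \<in> polys_over A"
  by (auto simp: polys_over_def coeff_mult coeff_pCons split: nat.splits intro!: sum)

context field_subring
begin

lemma polys_over_power [simp, intro]: "p \<in> polys_over A \<Longrightarrow> p ^ n \<in> polys_over A"
  by (induction n) auto

lemma polys_over_sum [intro]: "(\<And>i. i \<in> I \<Longrightarrow> f i \<in> polys_over A) \<Longrightarrow> (\<Sum>i\<in>I. f i) \<in> polys_over A"
  by (induction I rule: infinite_finite_induct) auto

lemma poly_closed [intro]: "p \<in> polys_over A \<Longrightarrow> x \<in> A \<Longrightarrow> poly p x \<in> A"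
  by (auto simp: poly_altdef intro!: sum)

lemma polys_over_pcompose [intro]:
  "p \<in> polys_over A \<Longrightarrow> r \<in> polys_over A \<Longrightarrow> pcompose p r \<in> polys_over A"
  by (induction p) (auto simp: pcompose_pCons)

end

text \<open>Division is carried out by cancelling leading terms explicitly, so that quotient and
  remainder visibly keep their coefficients in the subfield \<open>A\<close>.\<close>

lemma (in field_subfield) polys_over_divmod:
  assumes "g \<in> polys_over A" "g \<noteq> 0" "f \<in> polys_over A"
  obtains h r where "h \<in> polys_over A" "r \<in> polys_over A" "f = g * h + r"
    "r = 0 \<or> Polynomial.degree r < Polynomial.degree g"
proof -
  have "\<exists>h\<in>polys_over A. \<exists>r\<in>polys_over A. f = g * h + r \<and>
      (r = 0 \<or> Polynomial.degree r < Polynomial.degree g)"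
    using assms(3)
  proof (induction "Polynomial.degree f" arbitrary: f rule: less_induct)
    case less
    show ?case
    proof (cases "f = 0 \<or> Polynomial.degree f < Polynomial.degree g")
      case True
      then show ?thesis using less.prems by (intro bexI[of _ 0] bexI[of _ f]) auto
    next
      case False
      define k where "k = Polynomial.degree f - Polynomial.degree g"
      define s where "s = Polynomial.monom (Polynomial.lead_coeff f / Polynomial.lead_coeff g) k"
      have s: "s \<in> polys_over A" using less.prems assms by (auto simp: s_def)
      have lc: "Polynomial.lead_coeff f / Polynomial.lead_coeff g \<noteq> 0" using False assms(2) by auto
      have deg: "Polynomial.degree (g * s) = Polynomial.degree f"
        using False assms(2) lc by (subst degree_mult_eq) (auto simp: s_def k_def degree_monom_eq)
      have "Polynomial.coeff (g * s) (Polynomial.degree f) = Polynomial.lead_coeff f"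
        using lead_coeff_mult[of g s] lc assms(2) unfolding deg by (auto simp: s_def degree_monom_eq)
      then have c0: "Polynomial.coeff (f - g * s) (Polynomial.degree f) = 0" by simp
      have le: "Polynomial.degree (f - g * s) \<le> Polynomial.degree f"
        using degree_diff_le[of f _ "g * s"] deg by auto
      show ?thesis
      proof (cases "f - g * s = 0")
        case True
        then show ?thesis using s by (intro bexI[of _ s] bexI[of _ 0]) auto
      next
        case False
        with c0 le have "Polynomial.degree (f - g * s) < Polynomial.degree f"
          by (metis leading_coeff_0_iff order_less_le)
        from less.hyps[OF this] obtain h r where "h \<in> polys_over A" "r \<in> polys_over A"
          "f - g * s = g * h + r" "r = 0 \<or> Polynomial.degree r < Polynomial.degree g"
          using less.prems s assms by auto
        then show ?thesis using s
          by (intro bexI[of _ "h + s"] bexI[of _ r]) (auto simp: algebra_simps)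
      qed
    qed
  qed
  then show ?thesis using that by blast
qed

subsection \<open>Adjunction\<close>

context field_subring
begin

lemma ring_adjoin_least: "H \<subseteq> A \<Longrightarrow> generate_ring ring_of_type_algebra H \<subseteq> A"
proof
  fix x assume "H \<subseteq> A" "x \<in> generate_ring ring_of_type_algebra H"
  from this(2,1) show "x \<in> A" by induction auto
qed

end

lemma (in field_subfield) field_adjoin_least: "H \<subseteq> A \<Longrightarrow> generate_field ring_of_type_algebra H \<subseteq> A"
proof
  fix x assume "H \<subseteq> A" "x \<in> generate_field ring_of_type_algebra H"
  from this(2,1) show "x \<in> A" by induction auto
qed

lemma field_subring_generate_ring: "field_subring (generate_ring ring_of_type_algebra (H :: 'a::field set))"
proof -
  interpret field "ring_of_type_algebra :: 'a ring" by rule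
  show ?thesis by (intro field_subring.intro generate_ring_is_subring) auto
qed

lemma field_subfield_generate_field: "field_subfield (generate_field ring_of_type_algebra (H :: 'a::field set))"
proof -
  interpret field "ring_of_type_algebra :: 'a ring" by rule
  show ?thesis by (intro subfield_imp_field_subfield generate_field_is_subfield) auto
qed

lemma generate_ring_incl_subset: "H \<subseteq> generate_ring ring_of_type_algebra H"
  and generate_field_incl_subset: "H \<subseteq> generate_field ring_of_type_algebra H"
  by (auto intro: generate_ring.incl generate_field.incl)

lemma ring_adjoin_insert:
  "ring_adjoin A (insert x S) = ring_adjoin (ring_adjoin A S) {x}" (is "?L = ?R")
proof
  interpret L: field_subring ?L by (rule field_subring_generate_ring)
  interpret R: field_subring ?R by (rule field_subring_generate_ring)
  show "?L \<subseteq> ?R"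
    by (rule R.ring_adjoin_least) (auto intro: generate_ring.incl)
  have "ring_adjoin A S \<subseteq> ?L"
    by (rule L.ring_adjoin_least) (auto intro: generate_ring.incl)
  then show "?R \<subseteq> ?L"
    by (intro L.ring_adjoin_least) (auto intro: generate_ring.incl)
qed

lemma (in field_subring) ring_adjoin_empty: "ring_adjoin A {} = A"
  using ring_adjoin_least[of A] generate_ring_incl_subset[of A] by auto

lemma (in field_subring) ring_adjoin_singleton: "ring_adjoin A {x} = (\<lambda>p. poly p x) ` polys_over A"
proof
  interpret R: field_subring "ring_adjoin A {x}" by (rule field_subring_generate_ring)
  have AR: "A \<subseteq> ring_adjoin A {x}" and "x \<in> ring_adjoin A {x}"
    by (auto intro: generate_ring.incl)
  then show "(\<lambda>p. poly p x) ` polys_over A \<subseteq> ring_adjoin A {x}"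
    using polys_over_mono[OF AR] by (blast intro: R.poly_closed)
  interpret Q: field_subring "(\<lambda>p. poly p x) ` polys_over A"
  proof (rule field_subringI; (elim imageE)?; simp?)
    show "1 \<in> (\<lambda>p. poly p x) ` polys_over A" by (intro image_eqI[of _ _ 1]) auto
    fix p r assume [simp]: "p \<in> polys_over A" "r \<in> polys_over A"
    show "- poly p x \<in> (\<lambda>p. poly p x) ` polys_over A" by (intro image_eqI[of _ _ "- p"]) auto
    show "poly p x + poly r x \<in> (\<lambda>p. poly p x) ` polys_over A" by (intro image_eqI[of _ _ "p + r"]) auto
    show "poly p x * poly r x \<in> (\<lambda>p. poly p x) ` polys_over A" by (intro image_eqI[of _ _ "p * r"]) auto
  qed
  show "ring_adjoin A {x} \<subseteq> (\<lambda>p. poly p x) ` polys_over A"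
  proof (rule Q.ring_adjoin_least)
    have "a \<in> (\<lambda>p. poly p x) ` polys_over A" if "a \<in> A" for a
      using that by (intro image_eqI[of _ _ "[:a:]"]) auto
    moreover have "x \<in> (\<lambda>p. poly p x) ` polys_over A"
      by (intro image_eqI[of _ _ "[:0, 1:]"]) auto
    ultimately show "A \<union> {x} \<subseteq> (\<lambda>p. poly p x) ` polys_over A" by auto
  qed
qed

section \<open>Submodules and the ascending chain condition\<close>

lemma is_submoduleD:
  assumes "is_submodule A M"
  shows "0 \<in> M" "x \<in> M \<Longrightarrow> y \<in> M \<Longrightarrow> x + y \<in> M" "a \<in> A \<Longrightarrow> x \<in> M \<Longrightarrow> a * x \<in> M"
  using assms by (auto simp: is_submodule_def)

lemma is_submoduleI:
  assumes "0 \<in> M" "\<And>x y. x \<in> M \<Longrightarrow> y \<in> M \<Longrightarrow> x + y \<in> M" "\<And>a x. a \<in> A \<Longrightarrow> x \<in> M \<Longrightarrow> a * x \<in> M"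
  shows "is_submodule A M"
  using assms by (auto simp: is_submodule_def)

lemma is_submodule_sum:
  assumes "is_submodule A M" "\<And>i. i \<in> I \<Longrightarrow> f i \<in> M"
  shows "(\<Sum>i\<in>I. f i) \<in> M"
  using assms(2) by (induction I rule: infinite_finite_induct) (auto intro: is_submoduleD[OF assms(1)])

lemma is_submodule_Inter:
  assumes "\<And>M. M \<in> \<M> \<Longrightarrow> is_submodule A M"
  shows "is_submodule A (\<Inter>\<M>)"
  using assms by (auto simp: is_submodule_def)

lemma (in field_subring) is_submodule_self: "is_submodule A A"
  by (rule is_submoduleI) auto

lemma (in field_subring) is_submodule_uminus:
  assumes "is_submodule A M" "x \<in> M" shows "- x \<in> M"
  using is_submoduleD(3)[OF assms(1), of "-1" x] assms(2) by simp

lemma (in field_subring) is_submodule_diff: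
  assumes "is_submodule A M" "x \<in> M" "y \<in> M" shows "x - y \<in> M"
  using is_submoduleD(2)[OF assms(1,2) is_submodule_uminus[OF assms(1,3)]] by simp

lemma is_submodule_antimono: "is_submodule B M \<Longrightarrow> A \<subseteq> B \<Longrightarrow> is_submodule A M"
  by (auto simp: is_submodule_def)

lemma is_submodule_scale: "is_submodule A M \<Longrightarrow> is_submodule A ((*) c ` M)"
  unfolding is_submodule_def
  by (auto simp: image_iff simp flip: distrib_left)

text \<open>\<open>acc_submodules A A\<close> says that \<open>A\<close> is Noetherian. A general
  \<open>M\<close> is allowed because finite modules over \<open>A\<close> inside the ambient field
  are needed as well.\<close>

definition acc_submodules :: "'a::field set \<Rightarrow> 'a set \<Rightarrow> bool" where
  "acc_submodules A M \<longleftrightarrow>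
     (\<forall>C. (\<forall>n. is_submodule A (C n) \<and> C n \<subseteq> M \<and> C n \<subseteq> C (Suc n)) \<longrightarrow> (\<exists>n. \<forall>k\<ge>n. C k = C n))"

lemma acc_submodulesE:
  assumes "acc_submodules A M"
    "\<And>n. is_submodule A (C n)" "\<And>n. C n \<subseteq> M" "\<And>n. C n \<subseteq> C (Suc n)"
  obtains n where "\<And>k. k \<ge> n \<Longrightarrow> C k = C n"
proof -
  have "\<exists>n. \<forall>k\<ge>n. C k = C n"
    using assms(1)[unfolded acc_submodules_def, THEN spec[of _ C]] assms(2-4) by simp
  then show ?thesis using that by blast
qed

lemma acc_submodules_extend: "acc_submodules A M \<Longrightarrow> A \<subseteq> B \<Longrightarrow> acc_submodules B M"
  unfolding acc_submodules_def by (meson is_submodule_antimono)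

lemma acc_submodules_maximal:
  assumes "acc_submodules A M" "\<S> \<noteq> {}" "\<And>I. I \<in> \<S> \<Longrightarrow> is_submodule A I \<and> I \<subseteq> M"
  obtains I where "I \<in> \<S>" "\<forall>J\<in>\<S>. I \<subseteq> J \<longrightarrow> J = I"
proof -
  have "\<exists>I\<in>\<S>. \<forall>J\<in>\<S>. I \<subseteq> J \<longrightarrow> J = I"
  proof (rule ccontr)
    assume "\<not> ?thesis"
    then have *: "\<exists>J. J \<in> \<S> \<and> I \<subset> J" if "I \<in> \<S>" for I
      using that by blast
    obtain I0 where I0: "I0 \<in> \<S>" using assms(2) by blast
    have "\<exists>C. \<forall>n. C n \<in> \<S> \<and> C n \<subset> C (Suc n)"
      by (rule dependent_nat_choice[of "\<lambda>_ I. I \<in> \<S>" "\<lambda>_ I J. I \<subset> J"]) (use I0 in blast, erule *)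
    then obtain C where C: "\<And>n. C n \<in> \<S>" "\<And>n. C n \<subset> C (Suc n)" by blast
    have "is_submodule A (C n)" "C n \<subseteq> M" "C n \<subseteq> C (Suc n)" for n
      using C[of n] assms(3) by auto
    from acc_submodulesE[OF assms(1), of C, OF this] obtain n where n: "\<And>k. k \<ge> n \<Longrightarrow> C k = C n"
      by blast
    have "C (Suc n) = C n" by (rule n) simp
    with C(2)[of n] show False by simp
  qed
  then show ?thesis using that by blast
qed

text \<open>The modular law: a chain in \<open>M + N\<close> is determined by its traces on \<open>M\<close> (modulo \<open>N\<close>) and \<open>N\<close>.\<close>

lemma (in field_subring) acc_submodules_add:
  assumes M: "acc_submodules A M" "is_submodule A M" and N: "acc_submodules A N" "is_submodule A N"
  shows "acc_submodules A {x + y | x y. x \<in> M \<and> y \<in> N}"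
  unfolding acc_submodules_def
proof (intro allI impI)
  fix C assume C: "\<forall>n. is_submodule A (C n) \<and> C n \<subseteq> {x + y | x y. x \<in> M \<and> y \<in> N} \<and> C n \<subseteq> C (Suc n)"
  define D where "D n = {x \<in> M. \<exists>y\<in>N. x + y \<in> C n}" for n
  have sub: "is_submodule A (C n)" for n using C by auto
  have mono: "C i \<subseteq> C k" if "i \<le> k" for i k
    using lift_Suc_mono_le[of C i k] that C by auto
  have "is_submodule A (D n)" for n
  proof (rule is_submoduleI)
    show "0 \<in> D n"
      using is_submoduleD(1)[OF M(2)] is_submoduleD(1)[OF N(2)] is_submoduleD(1)[OF sub[of n]]
      by (auto simp: D_def intro!: bexI[of _ 0])
  next
    fix x x' assume "x \<in> D n" "x' \<in> D n"
    then obtain y y' where "x \<in> M" "y \<in> N" "x + y \<in> C n" "x' \<in> M" "y' \<in> N" "x' + y' \<in> C n"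
      by (auto simp: D_def)
    then show "x + x' \<in> D n"
      using is_submoduleD(2)[OF sub, of "x + y" n "x' + y'"] is_submoduleD(2)[OF M(2)] is_submoduleD(2)[OF N(2)]
      by (auto simp: D_def add_ac intro!: bexI[of _ "y + y'"])
  next
    fix a x assume "a \<in> A" "x \<in> D n"
    then obtain y where "x \<in> M" "y \<in> N" "x + y \<in> C n" by (auto simp: D_def)
    then show "a * x \<in> D n"
      using is_submoduleD(3)[OF sub, of a "x + y" n] is_submoduleD(3)[OF M(2)] is_submoduleD(3)[OF N(2)] \<open>a \<in> A\<close>
      by (auto simp: D_def distrib_left intro!: bexI[of _ "a * y"])
  qed
  moreover have "D n \<subseteq> M" "D n \<subseteq> D (Suc n)" for n using C by (auto simp: D_def)
  ultimately obtain n1 where n1: "\<And>k. k \<ge> n1 \<Longrightarrow> D k = D n1"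
    by (rule acc_submodulesE[OF M(1), of D]) blast
  have "is_submodule A (C n \<inter> N)" for n
    using is_submodule_Inter[of "{C n, N}" A] sub N(2) by auto
  moreover have "C n \<inter> N \<subseteq> N" "C n \<inter> N \<subseteq> C (Suc n) \<inter> N" for n using C by auto
  ultimately obtain n2 where n2: "\<And>k. k \<ge> n2 \<Longrightarrow> C k \<inter> N = C n2 \<inter> N"
    by (rule acc_submodulesE[OF N(1), of "\<lambda>n. C n \<inter> N"]) blast
  define n where "n = max n1 n2"
  have "C k \<subseteq> C n" if "k \<ge> n" for k
  proof
    fix z assume z: "z \<in> C k"
    then obtain x y where xy: "z = x + y" "x \<in> M" "y \<in> N" using C by blast
    then have "x \<in> D k" using z by (auto simp: D_def)
    also have "D k = D n" using n1[of k] n1[of n] that by (auto simp: n_def)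
    finally obtain y' where y': "y' \<in> N" "x + y' \<in> C n" by (auto simp: D_def)
    have "y - y' \<in> N" using is_submodule_diff[OF N(2)] xy y' by auto
    moreover have "y - y' \<in> C k"
      using is_submodule_diff[OF sub z, of "x + y'"] y'(2) mono[OF that] xy by auto
    ultimately have "y - y' \<in> C n" using n2[of k] n2[of n] that by (auto simp: n_def)
    then show "z \<in> C n" using is_submoduleD(2)[OF sub y'(2), of "y - y'"] xy by simp
  qed
  then show "\<exists>n. \<forall>k\<ge>n. C k = C n" using mono by (intro exI[of _ n]) blast
qed

lemma acc_submodules_scale:
  assumes "acc_submodules A M" "is_submodule A M"
  shows "acc_submodules A ((*) c ` M)"
  unfolding acc_submodules_def
proof (intro allI impI)
  fix C assume C: "\<forall>n. is_submodule A (C n) \<and> C n \<subseteq> (*) c ` M \<and> C n \<subseteq> C (Suc n)"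
  define D where "D n = {x \<in> M. c * x \<in> C n}" for n
  have "is_submodule A (D n)" for n
    using assms(2) C unfolding D_def is_submodule_def by (auto simp: distrib_left mult.left_commute)
  moreover have "D n \<subseteq> M" "D n \<subseteq> D (Suc n)" for n using C by (auto simp: D_def)
  ultimately obtain n where n: "\<And>k. k \<ge> n \<Longrightarrow> D k = D n"
    by (rule acc_submodulesE[OF assms(1), of D]) blast
  have "C k = (*) c ` D k" for k using C by (auto simp: D_def)
  with n have "C k = C n" if "k \<ge> n" for k using that by metis
  then show "\<exists>n. \<forall>k\<ge>n. C k = C n" by blast
qed

definition lincomb :: "'a::field set \<Rightarrow> 'i set \<Rightarrow> ('i \<Rightarrow> 'a) \<Rightarrow> 'a set" where
  "lincomb A I f = {\<Sum>i\<in>I. a i * f i | a. \<forall>i\<in>I. a i \<in> A}"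

lemma lincombI: "(\<And>i. i \<in> I \<Longrightarrow> a i \<in> A) \<Longrightarrow> (\<Sum>i\<in>I. a i * f i) \<in> lincomb A I f"
  by (auto simp: lincomb_def)

lemma lincombE:
  assumes "x \<in> lincomb A I f"
  obtains a where "\<forall>i\<in>I. a i \<in> A" "x = (\<Sum>i\<in>I. a i * f i)"
  using assms by (auto simp: lincomb_def)

lemma lincomb_insert:
  assumes "finite I" "i \<notin> I"
  shows "lincomb A (insert i I) f = {x + y | x y. x \<in> (*) (f i) ` A \<and> y \<in> lincomb A I f}"
proof (intro equalityI subsetI)
  fix x assume "x \<in> lincomb A (insert i I) f"
  then show "x \<in> {x + y | x y. x \<in> (*) (f i) ` A \<and> y \<in> lincomb A I f}"
  proof (elim lincombE)
    fix a assume a: "\<forall>k\<in>insert i I. a k \<in> A" "x = (\<Sum>k\<in>insert i I. a k * f k)"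
    then have "x = f i * a i + (\<Sum>k\<in>I. a k * f k)" using assms by (simp add: mult.commute)
    moreover have "(\<Sum>k\<in>I. a k * f k) \<in> lincomb A I f" by (rule lincombI) (use a in auto)
    ultimately show ?thesis using a by blast
  qed
next
  fix x assume "x \<in> {x + y | x y. x \<in> (*) (f i) ` A \<and> y \<in> lincomb A I f}"
  then obtain b a where ba: "b \<in> A" "\<And>k. k \<in> I \<Longrightarrow> a k \<in> A" "x = f i * b + (\<Sum>k\<in>I. a k * f k)"
    by (auto elim!: lincombE)
  have "(\<Sum>k\<in>I. a k * f k) = (\<Sum>k\<in>I. (a(i := b)) k * f k)"
    using assms by (intro sum.cong) auto
  then have "x = (\<Sum>k\<in>insert i I. (a(i := b)) k * f k)"
    using assms ba(3) by (simp add: mult.commute)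
  also have "\<dots> \<in> lincomb A (insert i I) f" by (rule lincombI) (use ba in auto)
  finally show "x \<in> lincomb A (insert i I) f" .
qed

lemma lincomb_least:
  assumes "is_submodule A M" "\<And>i. i \<in> I \<Longrightarrow> f i \<in> M"
  shows "lincomb A I f \<subseteq> M"
  using assms by (auto elim!: lincombE intro!: is_submodule_sum is_submoduleD(3))

context field_subring
begin

lemma is_submodule_lincomb: "is_submodule A (lincomb A I f)"
proof (rule is_submoduleI)
  show "0 \<in> lincomb A I f" using lincombI[of I "\<lambda>_. 0" A f] by simp
next
  fix x y assume "x \<in> lincomb A I f" "y \<in> lincomb A I f"
  obtain a where a: "\<forall>i\<in>I. a i \<in> A" "x = (\<Sum>i\<in>I. a i * f i)"
    using \<open>x \<in> _\<close> by (rule lincombE)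
  obtain b where b: "\<forall>i\<in>I. b i \<in> A" "y = (\<Sum>i\<in>I. b i * f i)"
    using \<open>y \<in> _\<close> by (rule lincombE)
  show "x + y \<in> lincomb A I f"
    using lincombI[of I "\<lambda>i. a i + b i" A f] a b by (auto simp: sum.distrib distrib_right)
next
  fix c x assume "c \<in> A" "x \<in> lincomb A I f"
  then show "c * x \<in> lincomb A I f"
    by (auto elim!: lincombE simp: sum_distrib_left simp flip: mult.assoc intro!: lincombI)
qed

lemma lincomb_generator: "finite I \<Longrightarrow> i \<in> I \<Longrightarrow> f i \<in> lincomb A I f"
  using lincombI[of I "\<lambda>k. of_bool (k = i)" A f] by simp

lemma acc_submodules_lincomb:
  assumes "acc_submodules A A" "finite I"
  shows "acc_submodules A (lincomb A I f)"
  using assms(2)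
proof (induction I rule: finite_induct)
  case empty
  have "C k = C 0" if "\<forall>n. is_submodule A (C n) \<and> C n \<subseteq> {0} \<and> C n \<subseteq> C (Suc n)" for C k
    using that is_submoduleD(1)[of A "C k"] is_submoduleD(1)[of A "C 0"] by blast
  then show ?case by (auto simp: acc_submodules_def lincomb_def)
next
  case (insert i I)
  show ?case unfolding lincomb_insert[OF insert.hyps]
    by (intro acc_submodules_add acc_submodules_scale is_submodule_scale is_submodule_self
        is_submodule_lincomb assms insert.IH)
qed

end

subsection \<open>Hilbert's basis theorem\<close>

text \<open>Since \<open>x\<close> is arbitrary, elements of \<open>B\<close> have no degree; the
  chain is therefore pulled back to sets of polynomials, and ideals of top coefficients are compared
  there.\<close>

lemma (in field_subring) acc_submodules_adjoin:
  fixes x :: 'a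
  assumes "acc_submodules A A"
  defines "B \<equiv> ring_adjoin A {x}"
  shows "acc_submodules B B"
  unfolding acc_submodules_def
proof (intro allI impI)
  fix C assume C: "\<forall>n. is_submodule B (C n) \<and> C n \<subseteq> B \<and> C n \<subseteq> C (Suc n)"
  interpret B: field_subring B unfolding B_def by (rule field_subring_generate_ring)
  have B_eq: "B = (\<lambda>p. poly p x) ` polys_over A" unfolding B_def by (rule ring_adjoin_singleton)
  have AB: "A \<subseteq> B" "x \<in> B" by (auto simp: B_def intro: generate_ring.incl)
  have sub: "is_submodule B (C n)" for n using C by auto
  have mono: "C i \<subseteq> C k" if "i \<le> k" for i k
    using lift_Suc_mono_le[of C i k] that C by auto
  define P where "P n = {p \<in> polys_over A. poly p x \<in> C n}" for n
  \<comment> \<open>Degree at most \<open>d\<close> rather than exactly \<open>d\<close>: this keeps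
    \<open>0\<close> in \<open>L n d\<close> and makes the family increase in \<open>d\<close> as
    well as in \<open>n\<close>.\<close>
  define L where "L n d = (\<lambda>p. Polynomial.coeff p d) ` {p \<in> P n. \<forall>i>d. Polynomial.coeff p i = 0}" for n d
  have L_sub: "is_submodule A (L n d)" for n d
  proof (rule is_submoduleI)
    show "0 \<in> L n d"
      using is_submoduleD(1)[OF sub] by (auto simp: L_def P_def intro!: image_eqI[of _ _ 0])
  next
    fix a b assume "a \<in> L n d" "b \<in> L n d"
    then obtain p r where "p \<in> P n" "\<forall>i>d. Polynomial.coeff p i = 0" "a = Polynomial.coeff p d"
      "r \<in> P n" "\<forall>i>d. Polynomial.coeff r i = 0" "b = Polynomial.coeff r d" by (auto simp: L_def)
    then show "a + b \<in> L n d"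
      using is_submoduleD(2)[OF sub[of n], of "poly p x" "poly r x"]
      by (auto simp: L_def P_def intro!: image_eqI[of _ _ "p + r"])
  next
    fix c a assume "c \<in> A" "a \<in> L n d"
    then obtain p where "p \<in> P n" "\<forall>i>d. Polynomial.coeff p i = 0" "a = Polynomial.coeff p d"
      by (auto simp: L_def)
    then show "c * a \<in> L n d"
      using is_submoduleD(3)[OF sub[of n], of c "poly p x"] AB \<open>c \<in> A\<close>
      by (auto simp: L_def P_def intro!: image_eqI[of _ _ "Polynomial.smult c p"])
  qed
  have L_le: "L n d \<subseteq> A" for n d by (auto simp: L_def P_def)
  have L_Suc1: "L n d \<subseteq> L (Suc n) d" for n d using C by (auto simp: L_def P_def)
  have L_mono1: "L i d \<subseteq> L k d" if "i \<le> k" for i k d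
    using lift_Suc_mono_le[of "\<lambda>n. L n d" i k] that L_Suc1 by auto
  have L_Suc2: "L n d \<subseteq> L n (Suc d)" for n d
  proof
    fix a assume "a \<in> L n d"
    then obtain p where p: "p \<in> polys_over A" "poly p x \<in> C n" "\<forall>i>d. Polynomial.coeff p i = 0"
      "a = Polynomial.coeff p d" by (auto simp: L_def P_def)
    then show "a \<in> L n (Suc d)"
      using is_submoduleD(3)[OF sub, of x "poly p x" n] AB
      by (auto simp: L_def P_def coeff_pCons split: nat.splits intro!: image_eqI[of _ _ "pCons 0 p"])
  qed
  have L_mono2: "L n i \<subseteq> L n k" if "i \<le> k" for i k n
    using lift_Suc_mono_le[of "L n" i k] that L_Suc2 by auto
  obtain n0 d0 where max: "\<And>n d. L n0 d0 \<subseteq> L n d \<Longrightarrow> L n d = L n0 d0"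
  proof -
    have *: "is_submodule A J \<and> J \<subseteq> A" if "J \<in> range (\<lambda>(n, d). L n d)" for J
    proof -
      from that obtain n d where "J = L n d" by auto
      with L_sub L_le show ?thesis by auto
    qed
    have ne: "range (\<lambda>(n, d). L n d) \<noteq> {}" by simp
    obtain I where I: "I \<in> range (\<lambda>(n, d). L n d)"
      "\<forall>J\<in>range (\<lambda>(n, d). L n d). I \<subseteq> J \<longrightarrow> J = I"
      by (rule acc_submodules_maximal[OF assms(1) ne *])
    from I(1) obtain n0 d0 where I_eq: "I = L n0 d0" by auto
    have "L n d = L n0 d0" if "L n0 d0 \<subseteq> L n d" for n d
      using I(2)[unfolded I_eq, THEN bspec, of "L n d"] that by (auto simp: image_iff)
    then show thesis by (rule that)
  qed
  have "\<exists>N. \<forall>k\<ge>N. L k d = L N d" for d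
    using acc_submodulesE[OF assms(1), of "\<lambda>n. L n d"] L_sub L_le L_Suc1 by metis
  then obtain N where N: "\<And>d k. k \<ge> N d \<Longrightarrow> L k d = L (N d) d" by metis
  \<comment> \<open>The maximal member \<open>L n0 d0\<close> controls all degrees from
    \<open>d0\<close> on; each of the finitely many smaller degrees brings its own stabilisation
    index.\<close>
  define n1 where "n1 = Max (insert n0 (N ` {..<d0}))"
  have n1: "n0 \<le> n1" "d < d0 \<Longrightarrow> N d \<le> n1" for d by (auto simp: n1_def)
  have L_eq: "L k d = L n1 d" if "k \<ge> n1" for k d
  proof (cases "d < d0")
    case True
    then show ?thesis using N[of d k] N[of d n1] n1(2)[of d] that by simp
  next
    case False
    then have "L n0 d0 \<subseteq> L i d" if "i \<ge> n0" for i
      using L_mono1[OF that] L_mono2[of d0 d] by fastforce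
    then show ?thesis using max[of k d] max[of n1 d] n1(1) that by simp
  qed
  \<comment> \<open>Induction on the degree bound \<open>e\<close>: an element of
    \<open>P n1\<close> with the same coefficient at the top is subtracted from
    \<open>p\<close>.\<close>
  have "p \<in> P n1" if k: "k \<ge> n1" and "p \<in> P k" "\<forall>i\<ge>e. Polynomial.coeff p i = 0" for p k e
    using that(2,3)
  proof (induction e arbitrary: p)
    case 0
    then have "p = 0" by (auto simp: poly_eq_iff)
    then show ?case using is_submoduleD(1)[OF sub] by (auto simp: P_def)
  next
    case (Suc e)
    then have "Polynomial.coeff p e \<in> L k e" by (auto simp: L_def)
    then obtain r where r: "r \<in> P n1" "\<forall>i>e. Polynomial.coeff r i = 0"
      "Polynomial.coeff r e = Polynomial.coeff p e"
      unfolding L_eq[OF k] by (auto simp: L_def)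
    have "\<forall>i\<ge>e. Polynomial.coeff (p - r) i = 0"
    proof (intro allI impI)
      fix i assume "i \<ge> e"
      then show "Polynomial.coeff (p - r) i = 0"
        using Suc.prems(2)[rule_format, of i] r(2)[rule_format, of i] r(3) by (cases "i = e") auto
    qed
    moreover have "p - r \<in> P k"
      using Suc.prems r mono[OF k] B.is_submodule_diff[OF sub[of k]] by (auto simp: P_def)
    ultimately have "p - r \<in> P n1" using Suc.IH by blast
    then show ?case
      using r is_submoduleD(2)[OF sub[of n1], of "poly p x - poly r x" "poly r x"] Suc.prems by (auto simp: P_def)
  qed note * = this
  have "C k \<subseteq> C n1" if "k \<ge> n1" for k
  proof
    fix z assume z: "z \<in> C k"
    then obtain p where p: "p \<in> polys_over A" "z = poly p x" using C B_eq by blast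
    then have "p \<in> P n1"
      using z by (intro *[OF that, of _ "Suc (Polynomial.degree p)"]) (auto simp: P_def coeff_eq_0)
    then show "z \<in> C n1" using p by (auto simp: P_def)
  qed
  then show "\<exists>n. \<forall>k\<ge>n. C k = C n" using mono by (intro exI[of _ n1]) blast
qed

section \<open>Integral elements\<close>

definition integral_over :: "'a::field set \<Rightarrow> 'a \<Rightarrow> bool" where
  "integral_over A x \<longleftrightarrow> (\<exists>p\<in>polys_over A. Polynomial.lead_coeff p = 1 \<and> poly p x = 0)"

lemma integral_closure_eq: "integral_closure A K = {x \<in> K. integral_over A x}"
  by (auto simp: integral_closure_def integral_over_def)

text \<open>Almost integral fractions belong to \<open>A\<close>. Unlike a monic equation, the
  condition \<open>c * z ^ n \<in> A\<close> can be tested on colon ideals and on leading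
  coefficients.\<close>

definition completely_integrally_closed :: "'a::field set \<Rightarrow> bool" where
  "completely_integrally_closed A \<longleftrightarrow>
     (\<forall>z\<in>fractions A. \<forall>c\<in>A - {0}. (\<forall>n. c * z ^ n \<in> A) \<longrightarrow> z \<in> A)"

context field_subring
begin

text \<open>Replaces a monic equation by membership in a finitely generated module, the form to
  which the chain condition applies.\<close>

lemma integral_over_iff_power: "integral_over A z \<longleftrightarrow> (\<exists>n. z ^ n \<in> lincomb A {..<n} (\<lambda>k. z ^ k))"
proof
  assume "integral_over A z"
  then obtain p where p: "p \<in> polys_over A" "Polynomial.lead_coeff p = 1" "poly p z = 0"
    by (auto simp: integral_over_def)
  define n where "n = Polynomial.degree p"
  have "0 = (\<Sum>k\<le>n. Polynomial.coeff p k * z ^ k)" using p by (simp add: poly_altdef n_def)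
  also have "\<dots> = (\<Sum>k<n. Polynomial.coeff p k * z ^ k) + z ^ n"
    using p(2) by (simp add: n_def flip: lessThan_Suc_atMost)
  finally have "z ^ n = (\<Sum>k<n. (- Polynomial.coeff p k) * z ^ k)"
    by (simp add: sum_negf eq_neg_iff_add_eq_0 add.commute)
  then have "z ^ n \<in> lincomb A {..<n} (\<lambda>k. z ^ k)"
    by (elim ssubst) (rule lincombI, use p in auto)
  then show "\<exists>n. z ^ n \<in> lincomb A {..<n} (\<lambda>k. z ^ k)" ..
next
  assume "\<exists>n. z ^ n \<in> lincomb A {..<n} (\<lambda>k. z ^ k)"
  then obtain n a where a: "\<And>k. k < n \<Longrightarrow> a k \<in> A" "z ^ n = (\<Sum>k<n. a k * z ^ k)"
    by (auto elim!: lincombE)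
  define r where "r = (\<Sum>k<n. Polynomial.monom (a k) k)"
  define p where "p = Polynomial.monom 1 n - r"
  have r0: "Polynomial.coeff r i = 0" if "i \<ge> n" for i
    unfolding r_def coeff_sum using that by (intro sum.neutral) auto
  have deg: "Polynomial.degree p = n"
  proof (rule antisym)
    show "Polynomial.degree p \<le> n" by (rule degree_le) (auto simp: p_def r0)
    show "n \<le> Polynomial.degree p" by (rule le_degree) (auto simp: p_def r0)
  qed
  have "p \<in> polys_over A" unfolding p_def r_def using a by (intro polys_over_diff polys_over_sum) auto
  moreover have "Polynomial.lead_coeff p = 1" unfolding deg by (auto simp: p_def r0)
  moreover have "poly p z = 0" using a by (simp add: p_def r_def poly_sum poly_monom)
  ultimately show "integral_over A z" by (auto simp: integral_over_def)
qed

lemma integral_over_imp_powers: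
  assumes "z ^ n \<in> lincomb A {..<n} (\<lambda>k. z ^ k)"
  shows "z ^ i \<in> lincomb A {..<n} (\<lambda>k. z ^ k)"
proof (induction i)
  case 0
  show ?case
  \<comment> \<open>For \<open>n = 0\<close> the span is \<open>{0}\<close>, which cannot contain
    \<open>z ^ 0 = 1\<close>.\<close>
  proof (cases "n = 0")
    case True
    with assms show ?thesis by (auto simp: lincomb_def)
  next
    case False
    then show ?thesis using lincomb_generator[of "{..<n}" 0 "\<lambda>k. z ^ k"] by auto
  qed
next
  case (Suc i)
  let ?M = "lincomb A {..<n} (\<lambda>k. z ^ k)"
  obtain a where a: "\<And>k. k < n \<Longrightarrow> a k \<in> A" "z ^ i = (\<Sum>k<n. a k * z ^ k)"
    using Suc by (auto elim!: lincombE)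
  have "z ^ Suc i = (\<Sum>k<n. a k * z ^ Suc k)"
    by (simp add: a(2) sum_distrib_left mult_ac)
  also have "\<dots> \<in> ?M"
  proof (intro is_submodule_sum[OF is_submodule_lincomb] is_submoduleD(3)[OF is_submodule_lincomb])
    fix k assume "k \<in> {..<n}"
    then show "z ^ Suc k \<in> ?M"
      using assms lincomb_generator[of "{..<n}" "Suc k" "\<lambda>k. z ^ k"] by (cases "Suc k = n") auto
  qed (use a in auto)
  finally show ?case .
qed

text \<open>The chain condition takes the place of the determinant trick: the spans of
  \<open>u * z ^ k\<close> for \<open>k < n\<close> stabilise, and cancelling \<open>u\<close>
  leaves a monic equation. A general \<open>u\<close> covers almost integral elements;
  \<open>u = 1\<close> gives the usual criterion.\<close>

lemma integral_over_acc:
  assumes "acc_submodules A M" "is_submodule A M" "u \<noteq> 0" "\<And>n. u * z ^ n \<in> M"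
  shows "integral_over A z"
proof -
  define C where "C n = lincomb A {..<n} (\<lambda>k. u * z ^ k)" for n
  have sub: "is_submodule A (C n)" for n unfolding C_def by (rule is_submodule_lincomb)
  have "C n \<subseteq> M" for n
    unfolding C_def by (rule lincomb_least) (use assms in auto)
  moreover have gen: "u * z ^ k \<in> C n" if "k < n" for k n
    using that lincomb_generator[of "{..<n}" k "\<lambda>k. u * z ^ k"] by (auto simp: C_def)
  then have "C n \<subseteq> C (Suc n)" for n
    by (subst C_def, intro lincomb_least sub) auto
  ultimately obtain n where n: "\<And>k. k \<ge> n \<Longrightarrow> C k = C n"
    using acc_submodulesE[OF assms(1), of C] sub by blast
  have "u * z ^ n \<in> C n" using n[of "Suc n"] gen[of n "Suc n"] by simp
  then obtain a where a: "\<And>k. k < n \<Longrightarrow> a k \<in> A" "u * z ^ n = (\<Sum>k<n. a k * (u * z ^ k))"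
    by (auto simp: C_def elim!: lincombE)
  then have "u * z ^ n = u * (\<Sum>k<n. a k * z ^ k)" by (simp add: sum_distrib_left mult_ac)
  then have "z ^ n = (\<Sum>k<n. a k * z ^ k)" using assms(3) by simp
  then have "z ^ n \<in> lincomb A {..<n} (\<lambda>k. z ^ k)"
    by (elim ssubst) (rule lincombI, use a in auto)
  then show ?thesis unfolding integral_over_iff_power ..
qed

text \<open>The products \<open>x ^ i * y ^ k\<close> with bounded exponents span a module
  \<open>M\<close> that contains \<open>1\<close> and is stable under \<open>x\<close> and
  \<open>y\<close>, hence contains all powers of \<open>x + y\<close> and
  \<open>x * y\<close>.\<close>

lemma integral_over_add_mult:
  assumes acc: "acc_submodules A A" and "integral_over A x" "integral_over A y"
  shows "integral_over A (x + y)" "integral_over A (x * y)"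
proof -
  obtain a b where a: "x ^ a \<in> lincomb A {..<a} (\<lambda>k. x ^ k)" and b: "y ^ b \<in> lincomb A {..<b} (\<lambda>k. y ^ k)"
    using assms(2,3) unfolding integral_over_iff_power by blast
  define f where "f = (\<lambda>(i, k). x ^ i * y ^ k)"
  define M where "M = lincomb A ({..<a} \<times> {..<b}) f"
  have sub: "is_submodule A M" unfolding M_def by (rule is_submodule_lincomb)
  have gen: "x ^ i * y ^ k \<in> M" for i k
  proof -
    obtain c where c: "\<And>k. k < a \<Longrightarrow> c k \<in> A" "x ^ i = (\<Sum>k<a. c k * x ^ k)"
      using integral_over_imp_powers[OF a, of i] by (auto elim!: lincombE)
    obtain d where d: "\<And>k. k < b \<Longrightarrow> d k \<in> A" "y ^ k = (\<Sum>k<b. d k * y ^ k)"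
      using integral_over_imp_powers[OF b, of k] by (auto elim!: lincombE)
    have "x ^ i * y ^ k = (\<Sum>(r, s)\<in>{..<a} \<times> {..<b}. (c r * d s) * f (r, s))"
      unfolding c(2) d(2) sum_product sum.cartesian_product by (simp add: f_def mult_ac split_def)
    also have "\<dots> \<in> M"
      unfolding M_def split_def using c d lincombI[of "{..<a} \<times> {..<b}" "\<lambda>p. c (fst p) * d (snd p)" A f]
      by auto
    finally show ?thesis .
  qed
  have stable: "x * z \<in> M" "y * z \<in> M" if "z \<in> M" for z
  proof -
    from that obtain c where c: "\<forall>p\<in>{..<a} \<times> {..<b}. c p \<in> A" "z = (\<Sum>p\<in>{..<a} \<times> {..<b}. c p * f p)"
      unfolding M_def by (rule lincombE)
    have "x * z = (\<Sum>p\<in>{..<a} \<times> {..<b}. c p * (x ^ Suc (fst p) * y ^ snd p))"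
      unfolding c(2) by (simp add: sum_distrib_left f_def split_def mult_ac)
    also have "\<dots> \<in> M" using c(1) by (intro is_submodule_sum[OF sub] is_submoduleD(3)[OF sub] gen) auto
    finally show "x * z \<in> M" .
    have "y * z = (\<Sum>p\<in>{..<a} \<times> {..<b}. c p * (x ^ fst p * y ^ Suc (snd p)))"
      unfolding c(2) by (simp add: sum_distrib_left f_def split_def mult_ac)
    also have "\<dots> \<in> M" using c(1) by (intro is_submodule_sum[OF sub] is_submoduleD(3)[OF sub] gen) auto
    finally show "y * z \<in> M" .
  qed
  have accM: "acc_submodules A M" unfolding M_def by (intro acc_submodules_lincomb acc) auto
  have one: "1 \<in> M" using gen[of 0 0] by simp
  have "1 * (x + y) ^ n \<in> M" for n
    by (induction n) (auto simp: distrib_right one intro!: is_submoduleD(2)[OF sub] stable)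
  then show "integral_over A (x + y)" by (rule integral_over_acc[OF accM sub, rotated]) simp
  have "1 * (x * y) ^ n \<in> M" for n
    by (induction n) (auto simp: mult.assoc one intro!: stable)
  then show "integral_over A (x * y)" by (rule integral_over_acc[OF accM sub, rotated]) simp
qed

lemma integral_over_root:
  assumes "x ^ n \<in> A" "n > 0"
  shows "integral_over A x"
  unfolding integral_over_iff_power
proof
  have "x ^ n = x ^ n * x ^ 0" by simp
  also have "\<dots> \<in> lincomb A {..<n} (\<lambda>k. x ^ k)"
    using assms lincomb_generator[of "{..<n}" 0 "\<lambda>k. x ^ k"]
    by (intro is_submoduleD(3)[OF is_submodule_lincomb]) auto
  finally show "x ^ n \<in> lincomb A {..<n} (\<lambda>k. x ^ k)" .
qed

lemma integral_over_self: "x \<in> A \<Longrightarrow> integral_over A x"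
  using integral_over_root[of x 1] by simp

lemma integral_over_sum:
  assumes "acc_submodules A A" "\<And>i. i \<in> I \<Longrightarrow> integral_over A (f i)"
  shows "integral_over A (\<Sum>i\<in>I. f i)"
  using assms(2)
  by (induction I rule: infinite_finite_induct)
     (auto intro: integral_over_add_mult[OF assms(1)] integral_over_self)

lemma integral_over_power:
  assumes "acc_submodules A A" "integral_over A x"
  shows "integral_over A (x ^ n)"
  using assms(2) by (induction n) (auto intro: integral_over_add_mult[OF assms(1)] integral_over_self)

lemma completely_integrally_closedD:
  assumes "completely_integrally_closed A" "z \<in> fractions A" "c \<in> A" "c \<noteq> 0" "\<And>n. c * z ^ n \<in> A"
  shows "z \<in> A"
  using assms unfolding completely_integrally_closed_def by blast

lemma completely_integrally_closed_integral:
  assumes "completely_integrally_closed A" "z \<in> fractions A" "integral_over A z"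
  shows "z \<in> A"
proof -
  obtain n where n: "z ^ n \<in> lincomb A {..<n} (\<lambda>k. z ^ k)"
    using assms(3) unfolding integral_over_iff_power by blast
  obtain a b where ab: "a \<in> A" "b \<in> A" "b \<noteq> 0" "z = a / b" using assms(2) by (rule fractionsE)
  \<comment> \<open>One power of the denominator serves all \<open>i\<close>, because every
    \<open>z ^ i\<close> is a combination of \<open>z ^ k\<close> with \<open>k < n\<close>.\<close>
  have "b ^ n * z ^ i \<in> A" for i
  proof -
    obtain c where c: "\<And>k. k < n \<Longrightarrow> c k \<in> A" "z ^ i = (\<Sum>k<n. c k * z ^ k)"
      using integral_over_imp_powers[OF n, of i] by (auto elim!: lincombE)
    have "b ^ n * (c k * z ^ k) \<in> A" if "k < n" for k
    proof -
      have "b ^ n = b ^ (n - k) * b ^ k" using that by (simp flip: power_add)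
      then have "b ^ n * (c k * z ^ k) = b ^ (n - k) * c k * a ^ k"
        using ab(3) unfolding ab(4) by (simp add: power_divide)
      also have "\<dots> \<in> A" using ab c(1)[OF that] by simp
      finally show ?thesis .
    qed
    then show ?thesis unfolding c(2) sum_distrib_left by (intro sum) auto
  qed
  then show ?thesis using completely_integrally_closedD[OF assms(1,2), of "b ^ n"] ab by auto
qed

end

section \<open>Noetherian completely integrally closed domains are Krull domains\<close>

text \<open>
  A prime \<open>P\<close> for which some \<open>\<sigma>\<close> satisfies \<open>\<sigma> P \<subseteq> A\<close> and \<open>\<sigma> P \<not>\<subseteq> P\<close> has a
  localisation that is a discrete valuation ring with uniformiser \<open>\<pi>\<close>, where \<open>\<pi> \<in> P\<close> and \<open>\<sigma> \<pi> \<notin> P\<close>.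
\<close>

locale invertible_prime = field_subring A for A :: "'a::field set" +
  fixes P :: "'a set" and \<sigma> \<pi> :: 'a
  assumes cic: "completely_integrally_closed A"
    and P_sub: "is_submodule A P" "P \<subseteq> A" "1 \<notin> P"
    and prime: "\<And>a b. a \<in> A \<Longrightarrow> b \<in> A \<Longrightarrow> a * b \<in> P \<Longrightarrow> a \<in> P \<or> b \<in> P"
    and \<sigma>: "\<sigma> \<in> fractions A" "\<And>a. a \<in> P \<Longrightarrow> a * \<sigma> \<in> A"
    and \<pi>: "\<pi> \<in> P" "\<pi> * \<sigma> \<notin> P"
begin

sublocale K: field_subfield "fractions A" by (rule field_subfield_fractions)

lemma \<sigma>_nonzero: "\<sigma> \<noteq> 0" and \<pi>_nonzero: "\<pi> \<noteq> 0"
  using \<pi>(2) is_submoduleD(1)[OF P_sub(1)] by auto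

lemma complement_mult: "a \<in> A - P \<Longrightarrow> b \<in> A - P \<Longrightarrow> a * b \<in> A - P"
  using prime by blast

lemma complement_power: "a \<in> A - P \<Longrightarrow> a ^ n \<in> A - P"
  using P_sub(3) by (induction n) (use complement_mult in auto)

lemma complement_nonzero: "a \<in> A - P \<Longrightarrow> a \<noteq> 0"
  using is_submoduleD(1)[OF P_sub(1)] by auto

text \<open>Quotients of elements outside \<open>P\<close> are the units of the localisation at
  \<open>P\<close>. A relation is used because existence and uniqueness of the exponent need
  separate arguments.\<close>

definition has_val :: "'a \<Rightarrow> int \<Rightarrow> bool" where
  "has_val x n \<longleftrightarrow> (\<exists>a\<in>A - P. \<exists>b\<in>A - P. x = \<pi> powi n * (a / b))"

lemma has_val_complement: "x \<in> A - P \<Longrightarrow> has_val x 0"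
  using P_sub(3) unfolding has_val_def by (intro bexI[of _ x] bexI[of _ 1]) auto

text \<open>Multiply \<open>x\<close> by \<open>\<sigma>\<close> until it leaves \<open>P\<close>.
  If it never did, all \<open>x * \<sigma> ^ n\<close> would lie in \<open>A\<close>, so
  \<open>\<sigma> \<in> A\<close> and \<open>\<pi> * \<sigma> \<in> P\<close>, a
  contradiction.\<close>

lemma has_val_ring:
  assumes "x \<in> A" "x \<noteq> 0"
  obtains n where "has_val x (int n)"
proof -
  have "\<exists>n. x * \<sigma> ^ n \<in> A - P"
  proof (rule ccontr)
    assume contra: "\<not> ?thesis"
    have "x * \<sigma> ^ n \<in> A" for n
    proof (induction n)
      case (Suc n)
      with contra have "x * \<sigma> ^ n \<in> P" by blast
      from \<sigma>(2)[OF this] show ?case by (simp add: mult_ac)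
    qed (use assms in auto)
    from completely_integrally_closedD[OF cic \<sigma>(1) assms this] have "\<sigma> \<in> A" .
    then have "\<pi> * \<sigma> \<in> P" using is_submoduleD(3)[OF P_sub(1) _ \<pi>(1), of \<sigma>] by (simp add: mult.commute)
    with \<pi>(2) show False by simp
  qed
  then obtain n where n: "x * \<sigma> ^ n \<in> A - P" by blast
  have "\<pi> * \<sigma> \<in> A - P" using \<pi> \<sigma>(2) by auto
  from complement_power[OF this] have "(\<pi> * \<sigma>) ^ n \<in> A - P" .
  moreover have "x = \<pi> powi int n * ((x * \<sigma> ^ n) / (\<pi> * \<sigma>) ^ n)"
    using \<sigma>_nonzero \<pi>_nonzero by (simp add: power_mult_distrib)
  ultimately have "has_val x (int n)" using n unfolding has_val_def by blast
  then show ?thesis by (rule that)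
qed

lemma has_val_mult:
  assumes "has_val x n" "has_val y k"
  shows "has_val (x * y) (n + k)"
proof -
  obtain a b a' b' where *: "a \<in> A - P" "b \<in> A - P" "x = \<pi> powi n * (a / b)"
      "a' \<in> A - P" "b' \<in> A - P" "y = \<pi> powi k * (a' / b')"
    using assms unfolding has_val_def by blast
  have "x * y = \<pi> powi (n + k) * ((a * a') / (b * b'))"
    using \<pi>_nonzero by (simp add: * power_int_add)
  then show ?thesis using * complement_mult unfolding has_val_def by blast
qed

lemma has_val_inverse:
  assumes "has_val x n"
  shows "has_val (inverse x) (- n)"
proof -
  obtain a b where *: "a \<in> A - P" "b \<in> A - P" "x = \<pi> powi n * (a / b)"
    using assms unfolding has_val_def by blast
  then have "inverse x = \<pi> powi (- n) * (b / a)"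
    by (simp add: power_int_minus divide_inverse)
  then show ?thesis using * unfolding has_val_def by blast
qed

lemma has_val_exists:
  assumes "x \<in> fractions A" "x \<noteq> 0"
  obtains n where "has_val x n"
proof -
  obtain a b where ab: "a \<in> A" "b \<in> A" "b \<noteq> 0" "x = a / b" using assms(1) by (rule fractionsE)
  obtain n k where "has_val a (int n)" "has_val b (int k)"
    using has_val_ring[of a] has_val_ring[of b] ab assms(2) by (metis div_0)
  then have "has_val (a * inverse b) (int n + - int k)"
    by (intro has_val_mult has_val_inverse)
  then show ?thesis using that ab by (simp add: divide_inverse)
qed

text \<open>If \<open>k > n\<close>, cancelling \<open>\<pi> powi n\<close> puts
  \<open>a * b'\<close> in \<open>P\<close> although both factors lie outside. Used in both
  directions, this gives uniqueness of the exponent.\<close>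

lemma has_val_le:
  assumes "has_val x n" "has_val x k"
  shows "k \<le> n"
proof (rule ccontr)
  assume "\<not> k \<le> n"
  then obtain d where d: "k = n + int (Suc d)"
    by (metis add.commute add_diff_cancel_right' diff_add_cancel not_le zless_iff_Suc_zadd)
  obtain a b a' b' where *: "a \<in> A - P" "b \<in> A - P" "x = \<pi> powi n * (a / b)"
      "a' \<in> A - P" "b' \<in> A - P" "x = \<pi> powi k * (a' / b')"
    using assms unfolding has_val_def by blast
  have nz: "b \<noteq> 0" "b' \<noteq> 0" using * complement_nonzero by auto
  have "\<pi> powi n * (a / b) = \<pi> powi n * (\<pi> ^ Suc d * (a' / b'))"
    using *(3,6) \<pi>_nonzero by (simp add: d power_int_add mult.assoc del: power_Suc of_nat_Suc)
  then have "a / b = \<pi> ^ Suc d * (a' / b')"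
    using \<pi>_nonzero by (subst (asm) mult_cancel_left) simp
  then have "a * b' = (\<pi> ^ d * a' * b) * \<pi>" using nz by (simp add: field_simps)
  moreover have "\<dots> \<in> P"
    using * \<pi>(1) P_sub(2) by (intro is_submoduleD(3)[OF P_sub(1)]) auto
  ultimately show False using complement_mult[of a b'] * by auto
qed

definition val :: "'a \<Rightarrow> int" where "val x = (THE n. has_val x n)"

lemma val_eq: "has_val x n \<Longrightarrow> val x = n"
  unfolding val_def using has_val_le by (blast intro: antisym)

lemma has_val_val: "x \<in> fractions A \<Longrightarrow> x \<noteq> 0 \<Longrightarrow> has_val x (val x)"
  using has_val_exists val_eq by metis

lemma val_nonneg: "x \<in> A \<Longrightarrow> x \<noteq> 0 \<Longrightarrow> val x \<ge> 0"
  using has_val_ring val_eq by (metis of_nat_0_le_iff)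

lemma discrete_valuation_val: "discrete_valuation (fractions A) val"
  unfolding discrete_valuation_def
proof (intro conjI ballI impI)
  have "n \<in> val ` (fractions A - {0})" for n
  proof (rule image_eqI[of _ _ "\<pi> powi n"])
    show "n = val (\<pi> powi n)"
      using P_sub(3) by (intro val_eq[symmetric]) (auto simp: has_val_def intro!: bexI[of _ 1])
    show "\<pi> powi n \<in> fractions A - {0}"
      using \<pi>_nonzero \<pi>(1) P_sub(2) by (auto simp: power_int_def)
  qed
  then show "val ` (fractions A - {0}) = UNIV" by blast
next
  fix x y assume xy: "x \<in> fractions A - {0}" "y \<in> fractions A - {0}"
  then show "val (x * y) = val x + val y"
    by (intro val_eq has_val_mult has_val_val) auto
next
  fix x y assume xy: "x \<in> fractions A - {0}" "y \<in> fractions A - {0}" "x + y \<noteq> 0"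
  have main: "val (x + y) \<ge> val x" if xy: "x \<in> fractions A - {0}" "y \<in> fractions A - {0}" "x + y \<noteq> 0"
    and le: "val x \<le> val y" for x y
  proof -
    obtain a b a' b' where *: "a \<in> A - P" "b \<in> A - P" "x = \<pi> powi (val x) * (a / b)"
        "a' \<in> A - P" "b' \<in> A - P" "y = \<pi> powi (val y) * (a' / b')"
      using has_val_val[of x] has_val_val[of y] xy unfolding has_val_def by blast
    have nz: "b \<noteq> 0" "b' \<noteq> 0" using * complement_nonzero by auto
    obtain d where d: "val y = val x + int d" using le by (metis zle_iff_zadd)
    \<comment> \<open>\<open>c\<close> is the numerator after factoring out
      \<open>\<pi> powi (val x)\<close>. It may lie in \<open>P\<close>, so only a nonnegative value
      is available for it; that is enough.\<close>
    define c where "c = a * b' + \<pi> ^ d * a' * b"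
    have c: "c \<in> A" using * \<pi>(1) P_sub(2) by (auto simp: c_def)
    have "y = \<pi> powi (val x) * (\<pi> ^ d * (a' / b'))"
      using *(6) \<pi>_nonzero by (simp add: d power_int_add mult.assoc)
    then have "x + y = \<pi> powi (val x) * (a / b + \<pi> ^ d * (a' / b'))"
      using *(3) by (metis distrib_left)
    also have "a / b + \<pi> ^ d * (a' / b') = c / (b * b')"
      using nz by (simp add: c_def field_simps)
    finally have eq: "x + y = \<pi> powi (val x) * c * inverse (b * b')"
      by (simp add: divide_inverse)
    then have "c \<noteq> 0" using xy(3) by auto
    then obtain k where k: "has_val c (int k)" using has_val_ring[OF c] by blast
    have "has_val (\<pi> powi (val x)) (val x)"
      using P_sub(3) by (auto simp: has_val_def intro!: bexI[of _ 1])
    moreover have "has_val (b * b') 0"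
      using complement_mult[of b b'] * by (intro has_val_complement) auto
    ultimately have "has_val (x + y) (val x + int k + - 0)"
      unfolding eq by (intro has_val_mult has_val_inverse k)
    from val_eq[OF this] show ?thesis by simp
  qed
  show "val (x + y) \<ge> min (val x) (val y)"
    using main[OF xy] main[of y x] xy by (cases "val x \<le> val y") (auto simp: add.commute)
qed

lemma val_nonzero_imp_prime:
  assumes "x \<in> A" "x \<noteq> 0" "val x \<noteq> 0"
  shows "x \<in> P"
proof (rule ccontr)
  assume "x \<notin> P"
  then have "has_val x 0"
    using assms(1) by (intro has_val_complement) auto
  with assms(3) val_eq show False by auto
qed

text \<open>The valuation ring lies in the localisation at \<open>P\<close>; this is how nonnegative
  values produce denominators outside \<open>P\<close>.\<close>

lemma val_nonneg_denominator:
  assumes "x \<in> fractions A" "x \<noteq> 0" "val x \<ge> 0"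
  shows "\<exists>b\<in>A - P. b * x \<in> A"
proof -
  obtain a b where *: "a \<in> A - P" "b \<in> A - P" "x = \<pi> powi (val x) * (a / b)"
    using has_val_val[OF assms(1,2)] unfolding has_val_def by blast
  have "b \<noteq> 0" using * complement_nonzero by auto
  moreover have "x = \<pi> ^ nat (val x) * (a / b)"
    using *(3) assms(3) by (simp add: power_int_def)
  ultimately have "b * x = \<pi> ^ nat (val x) * a" by (metis mult.left_commute nonzero_mult_div_cancel_left times_divide_eq_right)
  moreover have "\<pi> \<in> A" using \<pi>(1) P_sub(2) by blast
  ultimately have "b * x \<in> A" using *(1) by simp
  with * show ?thesis by blast
qed

end

section \<open>Maximal ideals of denominators and their valuations\<close>

context field_subring
begin

definition denominators :: "'a \<Rightarrow> 'a set" where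
  "denominators x = {a \<in> A. a * x \<in> A}"

text \<open>Conductors \<open>A : x\<close> of elements outside \<open>A\<close>, maximal among
  such; they play the part of the height-one primes.\<close>

definition maximal_denominators :: "'a set set" where
  "maximal_denominators = {denominators x | x. x \<in> fractions A - A \<and>
     (\<forall>y\<in>fractions A - A. denominators x \<subseteq> denominators y \<longrightarrow> denominators y = denominators x)}"

lemma is_submodule_denominators: "is_submodule A (denominators x)"
  by (rule is_submoduleI) (auto simp: denominators_def distrib_right mult.assoc)

text \<open>If \<open>b \<notin> P\<close>, then \<open>b * x\<close> is still outside
  \<open>A\<close> and its conductor contains \<open>P\<close>, hence equals \<open>P\<close> by
  maximality; \<open>a\<close> lies in that conductor.\<close>

lemma maximal_denominators_prime:
  assumes "P \<in> maximal_denominators" "a \<in> A" "b \<in> A" "a * b \<in> P"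
  shows "a \<in> P \<or> b \<in> P"
proof (rule disjCI)
  assume "b \<notin> P"
  interpret K: field_subfield "fractions A" by (rule field_subfield_fractions)
  obtain x where x: "P = denominators x" "x \<in> fractions A - A"
    "\<And>y. y \<in> fractions A - A \<Longrightarrow> P \<subseteq> denominators y \<Longrightarrow> denominators y = P"
    using assms(1) unfolding maximal_denominators_def by blast
  have "b * x \<in> fractions A - A" using x \<open>b \<notin> P\<close> assms(3) by (auto simp: denominators_def)
  moreover have "P \<subseteq> denominators (b * x)"
    unfolding x(1) using assms(3) by (auto simp: denominators_def mult.left_commute[of _ b])
  ultimately have "denominators (b * x) = P" by (rule x(3))
  moreover have "a \<in> denominators (b * x)"
    using assms(2,4) unfolding x(1) by (simp add: denominators_def mult.assoc)
  ultimately show "a \<in> P" by simp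
qed

lemma maximal_denominators_prod:
  assumes "P \<in> maximal_denominators" "finite I" "\<And>i. i \<in> I \<Longrightarrow> d i \<in> A - P"
  shows "(\<Prod>i\<in>I. d i) \<in> A - P"
  using assms(2,3)
proof (induction I rule: finite_induct)
  case empty
  then show ?case using assms(1) by (auto simp: maximal_denominators_def denominators_def)
next
  case (insert i I)
  then show ?case using maximal_denominators_prime[OF assms(1), of "d i" "\<Prod>i\<in>I. d i"] by auto
qed

text \<open>Only \<open>\<pi>\<close> has to be found. If \<open>P\<close> were stable under
  \<open>\<sigma>\<close>, then \<open>b * \<sigma> ^ n \<in> P\<close> for a denominator
  \<open>b\<close> of \<open>\<sigma>\<close> and all \<open>n\<close>, so \<open>\<sigma>\<close>
  would be almost integral and lie in \<open>A\<close>.\<close>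

lemma maximal_denominators_valuation:
  assumes cic: "completely_integrally_closed A" and P: "P \<in> maximal_denominators"
  shows "\<exists>v. discrete_valuation (fractions A) v \<and> (\<forall>x\<in>A - {0}. v x \<ge> 0) \<and>
           (\<forall>x\<in>A - {0}. v x \<noteq> 0 \<longrightarrow> x \<in> P) \<and>
           (\<forall>x\<in>fractions A - {0}. v x \<ge> 0 \<longrightarrow> (\<exists>b\<in>A - P. b * x \<in> A))"
proof -
  obtain \<sigma> where \<sigma>: "P = denominators \<sigma>" "\<sigma> \<in> fractions A - A"
    using P unfolding maximal_denominators_def by blast
  have "\<exists>\<pi>\<in>P. \<pi> * \<sigma> \<notin> P"
  proof (rule ccontr)
    assume contra: "\<not> ?thesis"
    obtain a b where ab: "a \<in> A" "b \<in> A" "b \<noteq> 0" "\<sigma> = a / b" using \<sigma>(2) by (auto elim: fractionsE)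
    have "b \<in> P" using ab unfolding \<sigma>(1) by (simp add: denominators_def)
    then have "b * \<sigma> ^ n \<in> P" for n
      by (induction n) (use contra in \<open>auto simp: power_Suc2 simp flip: mult.assoc simp del: power_Suc\<close>)
    then have "b * \<sigma> ^ n \<in> A" for n unfolding \<sigma>(1) by (auto simp: denominators_def)
    then have "\<sigma> \<in> A" using completely_integrally_closedD[OF cic, of \<sigma> b] ab \<sigma>(2) by blast
    with \<sigma>(2) show False by simp
  qed
  then obtain \<pi> where \<pi>: "\<pi> \<in> P" "\<pi> * \<sigma> \<notin> P" by blast
  interpret invertible_prime A P \<sigma> \<pi>
  proof
    show "is_submodule A P" unfolding \<sigma>(1) by (rule is_submodule_denominators)
    show "a \<in> P \<or> b \<in> P" if "a \<in> A" "b \<in> A" "a * b \<in> P" for a b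
      using maximal_denominators_prime[OF P that] .
  qed (use cic \<sigma> \<pi> in \<open>auto simp: denominators_def\<close>)
  show ?thesis
    using discrete_valuation_val val_nonneg val_nonzero_imp_prime val_nonneg_denominator
    by (intro exI[of _ val]) auto
qed

text \<open>For infinitely many such primes, with conductor generators \<open>x i\<close>, the
  modules spanned by \<open>a\<close> and the \<open>a * x i\<close> would stabilise in
  \<open>A\<close>. Then some \<open>x n\<close> depends on \<open>1\<close> and the earlier
  \<open>x i\<close>, which forces an earlier prime into \<open>f n\<close> and contradicts
  maximality.\<close>

lemma finite_maximal_denominators:
  assumes acc: "acc_submodules A A" and a: "a \<in> A" "a \<noteq> 0"
  shows "finite {P \<in> maximal_denominators. a \<in> P}"
proof (rule ccontr)
  assume "infinite {P \<in> maximal_denominators. a \<in> P}"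
  then obtain f :: "nat \<Rightarrow> 'a set" where f: "inj f" "range f \<subseteq> {P \<in> maximal_denominators. a \<in> P}"
    using infinite_countable_subset by blast
  have f': "f n \<in> maximal_denominators" "a \<in> f n" for n using f(2) by auto
  have "\<exists>x. f n = denominators x \<and> x \<in> fractions A - A \<and>
      (\<forall>y\<in>fractions A - A. denominators x \<subseteq> denominators y \<longrightarrow> denominators y = denominators x)" for n
    using f'(1)[of n] unfolding maximal_denominators_def by blast
  then obtain x where x: "\<And>n. f n = denominators (x n)" "\<And>n. x n \<in> fractions A - A"
      "\<And>n y. y \<in> fractions A - A \<Longrightarrow> denominators (x n) \<subseteq> denominators y \<Longrightarrow> denominators y = denominators (x n)"
    by metis
  \<comment> \<open>The entry \<open>1\<close> in front shifts the index: \<open>C n\<close>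
    involves only \<open>x i\<close> with \<open>i < n\<close>, and the next generator is
    \<open>x n\<close>.\<close>
  define g where "g k = (case k of 0 \<Rightarrow> 1 | Suc i \<Rightarrow> x i)" for k
  define C where "C n = lincomb A {..n} (\<lambda>k. a * g k)" for n
  have ag: "a * g k \<in> A" for k
  proof (cases k)
    case (Suc i)
    then show ?thesis using f'(2)[of i] unfolding x(1) by (simp add: g_def denominators_def)
  qed (simp add: g_def a)
  have sub: "is_submodule A (C n)" for n unfolding C_def by (rule is_submodule_lincomb)
  have gen: "a * g k \<in> C n" if "k \<le> n" for k n
    using lincomb_generator[of "{..n}" k "\<lambda>k. a * g k"] that by (auto simp: C_def)
  have "C n \<subseteq> A" for n
    unfolding C_def by (rule lincomb_least[OF is_submodule_self]) (rule ag)
  moreover have "C n \<subseteq> C (Suc n)" for n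
    by (subst C_def, rule lincomb_least[OF sub]) (auto intro: gen)
  ultimately obtain n where n: "\<And>k. k \<ge> n \<Longrightarrow> C k = C n"
    using acc_submodulesE[OF acc, of C] sub by blast
  have "a * g (Suc n) \<in> C n" using n[of "Suc n"] gen[of "Suc n" "Suc n"] by simp
  then obtain c where c: "\<forall>k\<in>{..n}. c k \<in> A" "a * g (Suc n) = (\<Sum>k\<le>n. c k * (a * g k))"
    unfolding C_def by (rule lincombE)
  have "a * g (Suc n) = a * (\<Sum>k\<le>n. c k * g k)"
    unfolding c(2) sum_distrib_left by (simp add: mult_ac)
  then have xn: "x n = (\<Sum>k\<le>n. c k * g k)" using a(2) by (simp add: g_def)
  have inter: "d \<in> f n" if "d \<in> A" "\<And>i. i < n \<Longrightarrow> d \<in> f i" for d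
  proof -
    have "d * g k \<in> A" if "k \<le> n" for k
      using that \<open>d \<in> A\<close> \<open>\<And>i. i < n \<Longrightarrow> d \<in> f i\<close>[of "k - 1"] x(1)[of "k - 1"]
      by (cases k) (auto simp: g_def denominators_def)
    then have "d * x n \<in> A"
      unfolding xn sum_distrib_left mult.left_commute[of d] using c(1) by (intro sum) auto
    then show ?thesis using that(1) x(1) by (simp add: denominators_def)
  qed
  \<comment> \<open>Otherwise a product of elements \<open>d i\<close> of \<open>f i\<close> outside
    \<open>f n\<close> avoids the prime \<open>f n\<close>, yet lies in every \<open>f i\<close>
    with \<open>i < n\<close> and hence in \<open>f n\<close> by \<open>inter\<close>.\<close>
  have "\<exists>i<n. f i \<subseteq> f n"
  proof (rule ccontr)
    assume "\<not> ?thesis"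
    then have "\<forall>i\<in>{..<n}. \<exists>d. d \<in> f i - f n" by blast
    then obtain d where d: "\<And>i. i < n \<Longrightarrow> d i \<in> f i - f n" by (metis lessThan_iff)
    have fA: "f i \<subseteq> A" for i using x(1)[of i] by (auto simp: denominators_def)
    then have dA: "d i \<in> A" if "i < n" for i using d[OF that] by blast
    have "(\<Prod>i<n. d i) \<in> A - f n"
      using d dA by (intro maximal_denominators_prod f') auto
    moreover have "(\<Prod>i<n. d i) \<in> f i" if i: "i < n" for i
    proof -
      have "(\<Prod>i<n. d i) = (\<Prod>k\<in>{..<n} - {i}. d k) * d i"
        using i by (subst prod.remove[of _ i]) (auto simp: mult.commute)
      also have "\<dots> \<in> f i"
        unfolding x(1)[of i]
      proof (rule is_submoduleD(3)[OF is_submodule_denominators])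
        show "(\<Prod>k\<in>{..<n} - {i}. d k) \<in> A" by (rule prod) (use dA in auto)
        show "d i \<in> denominators (x i)" using d[OF i] x(1)[of i] by simp
      qed
      finally show ?thesis .
    qed
    ultimately show False using inter by blast
  qed
  then obtain i where "i < n" "f i \<subseteq> f n" by blast
  then have "f n = f i" using x(3)[OF x(2), of i n] x(1) by simp
  with \<open>i < n\<close> f(1) show False by (auto dest: injD)
qed

theorem krull_domain_if_noetherian:
  assumes acc: "acc_submodules A A" and cic: "completely_integrally_closed A"
  shows "krull_domain A"
proof -
  interpret K: field_subfield "fractions A" by (rule field_subfield_fractions)
  obtain v where v: "\<And>P. P \<in> maximal_denominators \<Longrightarrow> discrete_valuation (fractions A) (v P)"
      "\<And>P x. P \<in> maximal_denominators \<Longrightarrow> x \<in> A - {0} \<Longrightarrow> v P x \<ge> 0"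
      "\<And>P x. P \<in> maximal_denominators \<Longrightarrow> x \<in> A - {0} \<Longrightarrow> v P x \<noteq> 0 \<Longrightarrow> x \<in> P"
      "\<And>P x. P \<in> maximal_denominators \<Longrightarrow> x \<in> fractions A - {0} \<Longrightarrow> v P x \<ge> 0 \<Longrightarrow> \<exists>b\<in>A - P. b * x \<in> A"
  proof -
    have "\<forall>P\<in>maximal_denominators. \<exists>v. discrete_valuation (fractions A) v \<and> (\<forall>x\<in>A - {0}. v x \<ge> 0) \<and>
           (\<forall>x\<in>A - {0}. v x \<noteq> 0 \<longrightarrow> x \<in> P) \<and>
           (\<forall>x\<in>fractions A - {0}. v x \<ge> 0 \<longrightarrow> (\<exists>b\<in>A - P. b * x \<in> A))"
      using maximal_denominators_valuation[OF cic] by blast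
    from bchoice[OF this] show thesis using that by blast
  qed
  \<comment> \<open>If \<open>x \<notin> A\<close>, its conductor lies in some maximal
    \<open>P\<close>; a nonnegative value at \<open>P\<close> gives \<open>b \<notin> P\<close> with
    \<open>b * x \<in> A\<close>, that is, \<open>b\<close> in the conductor.\<close>
  have mem: "x \<in> A" if x: "x \<in> fractions A - {0}" "\<And>P. P \<in> maximal_denominators \<Longrightarrow> v P x \<ge> 0" for x
  proof (rule ccontr)
    assume "x \<notin> A"
    define \<S> where "\<S> = {denominators y | y. y \<in> fractions A - A \<and> denominators x \<subseteq> denominators y}"
    have "\<S> \<noteq> {}" using x(1) \<open>x \<notin> A\<close> by (auto simp: \<S>_def)
    moreover have "is_submodule A I \<and> I \<subseteq> A" if "I \<in> \<S>" for I
      using that is_submodule_denominators by (auto simp: \<S>_def denominators_def)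
    ultimately obtain P where P: "P \<in> \<S>" "\<forall>J\<in>\<S>. P \<subseteq> J \<longrightarrow> J = P"
      by (rule acc_submodules_maximal[OF acc])
    then obtain y where y: "P = denominators y" "y \<in> fractions A - A" "denominators x \<subseteq> P"
      by (auto simp: \<S>_def)
    have "P \<in> maximal_denominators"
    proof -
      have "denominators z = P" if "z \<in> fractions A - A" "P \<subseteq> denominators z" for z
      proof -
        have "denominators z \<in> \<S>" using that y(3) unfolding \<S>_def by blast
        then show ?thesis using P(2) that(2) by blast
      qed
      then show ?thesis unfolding maximal_denominators_def using y(1,2) by blast
    qed
    from v(4)[OF this x(1) x(2)[OF this]] obtain b where "b \<in> A - P" "b * x \<in> A" by blast
    with y(3) show False by (auto simp: denominators_def)
  qed
  have fin: "finite {w \<in> v ` maximal_denominators. w x \<noteq> 0}" if x: "x \<in> fractions A - {0}" for x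
  proof -
    obtain a b where ab: "a \<in> A" "b \<in> A" "b \<noteq> 0" "x = a / b" using x by (auto elim: fractionsE)
    then have a0: "a \<noteq> 0" using x by auto
    have "a \<in> P \<or> b \<in> P" if P: "P \<in> maximal_denominators" "v P x \<noteq> 0" for P
    proof -
      have "v P (x * b) = v P x + v P b"
        using v(1)[OF P(1)] x ab(2,3) unfolding discrete_valuation_def by blast
      then have "v P a \<noteq> 0 \<or> v P b \<noteq> 0" using P(2) ab by auto
      then show ?thesis using v(3)[OF P(1), of a] v(3)[OF P(1), of b] ab a0 by auto
    qed
    then have "{w \<in> v ` maximal_denominators. w x \<noteq> 0} \<subseteq>
        v ` ({P \<in> maximal_denominators. a \<in> P} \<union> {P \<in> maximal_denominators. b \<in> P})" by auto
    then show ?thesis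
      by (rule finite_subset) (use finite_maximal_denominators[OF acc] ab a0 in auto)
  qed
  have "x \<in> A \<longleftrightarrow> (\<forall>w\<in>v ` maximal_denominators. w x \<ge> 0)" if "x \<in> fractions A - {0}" for x
    using mem[OF that] v(2)[of _ x] that by blast
  then show ?thesis
    unfolding krull_domain_def using v(1) fin subring
    by (intro conjI exI[of _ "v ` maximal_denominators"]) blast+
qed

end

section \<open>Divisorial ideals and the divisor class group\<close>

abbreviation span_over :: "'a::field set \<Rightarrow> 'a set \<Rightarrow> 'a set" where
  "span_over A S \<equiv> is_submodule A hull S"

text \<open>Plain elementwise products: \<open>colon\<close> does not distinguish a set from the
  module it generates, so products of divisors may be computed on them.\<close>

abbreviation set_prod :: "'a::field set \<Rightarrow> 'a set \<Rightarrow> 'a set" where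
  "set_prod S T \<equiv> {x * y | x y. x \<in> S \<and> y \<in> T}"

lemma set_prod_commute: "set_prod S T = set_prod T (S :: 'a::field set)"
  by (auto simp: mult.commute) (metis mult.commute)+

lemma set_prod_assoc: "set_prod (set_prod S T) U = set_prod S (set_prod T (U :: 'a::field set))"
  by (auto simp: mult.assoc) (metis mult.assoc)+

lemma is_submodule_span: "is_submodule A (span_over A S)"
  by (rule hull_in) (auto intro: is_submodule_Inter)

lemma span_span_over:
  assumes "A \<subseteq> B" shows "span_over B (span_over A S) = span_over B S"
proof
  have "span_over A S \<subseteq> span_over B S"
    using is_submodule_antimono[OF is_submodule_span assms] by (rule hull_minimal[rotated]) (rule hull_subset)
  then show "span_over B (span_over A S) \<subseteq> span_over B S"
    by (rule hull_minimal) (rule is_submodule_span)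
  show "span_over B S \<subseteq> span_over B (span_over A S)" by (intro hull_mono hull_subset)
qed

lemma span_over_scale_subset: "span_over A ((*) z ` S) \<subseteq> (*) z ` span_over A S"
  by (intro hull_minimal is_submodule_scale is_submodule_span image_mono hull_subset)

lemma span_over_scale:
  assumes "z \<noteq> 0" shows "span_over A ((*) z ` S) = (*) z ` span_over A S"
proof
  have "span_over A S = span_over A ((*) (inverse z) ` (*) z ` S)"
    using assms by (simp add: image_image flip: mult.assoc)
  also have "\<dots> \<subseteq> (*) (inverse z) ` span_over A ((*) z ` S)" by (rule span_over_scale_subset)
  finally have "(*) z ` span_over A S \<subseteq> (*) z ` (*) (inverse z) ` span_over A ((*) z ` S)"
    by (rule image_mono)
  then show "(*) z ` span_over A S \<subseteq> span_over A ((*) z ` S)"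
    using assms by (simp add: image_image flip: mult.assoc)
qed (rule span_over_scale_subset)

lemma colonD: "x \<in> colon A S \<Longrightarrow> x \<in> fractions A" "x \<in> colon A S \<Longrightarrow> y \<in> S \<Longrightarrow> x * y \<in> A"
  by (auto simp: colon_def)

lemma colonI: "x \<in> fractions A \<Longrightarrow> (\<And>y. y \<in> S \<Longrightarrow> x * y \<in> A) \<Longrightarrow> x \<in> colon A S"
  by (auto simp: colon_def)

lemma colon_antimono: "S \<subseteq> T \<Longrightarrow> colon A T \<subseteq> colon A S"
  by (auto simp: colon_def)

lemma subset_divisorial_hull: "S \<subseteq> fractions A \<Longrightarrow> S \<subseteq> divisorial_hull A S"
  by (auto simp: divisorial_hull_def colon_def mult.commute)

lemma colon_subset_fractions: "colon A S \<subseteq> fractions A"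
  by (auto simp: colon_def)

lemma colon_divisorial_hull:
  assumes "S \<subseteq> fractions A" shows "colon A (divisorial_hull A S) = colon A S"
proof
  show "colon A (divisorial_hull A S) \<subseteq> colon A S"
    by (intro colon_antimono subset_divisorial_hull assms)
  show "colon A S \<subseteq> colon A (divisorial_hull A S)"
    using subset_divisorial_hull[OF colon_subset_fractions, of A S] by (simp add: divisorial_hull_def)
qed

lemma divisorial_hull_cong: "colon A S = colon A T \<Longrightarrow> divisorial_hull A S = divisorial_hull A T"
  by (simp add: divisorial_hull_def)

text \<open>What remains of \<open>fractional_ideal\<close> without the module condition, so that
  colons and hulls of mere generating sets can be handled.\<close>

definition bounded_in :: "'a::field set \<Rightarrow> 'a set \<Rightarrow> bool" where
  "bounded_in A S \<longleftrightarrow> S \<subseteq> fractions A \<and> (\<exists>s\<in>S. s \<noteq> 0) \<and> (\<exists>d\<in>A - {0}. \<forall>s\<in>S. d * s \<in> A)"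

lemma bounded_inI:
  assumes "S \<subseteq> fractions A" "s \<in> S" "s \<noteq> 0" "d \<in> A" "d \<noteq> 0" "\<And>x. x \<in> S \<Longrightarrow> d * x \<in> A"
  shows "bounded_in A S"
  using assms unfolding bounded_in_def by blast

lemma fractional_ideal_iff: "fractional_ideal A I \<longleftrightarrow> is_submodule A I \<and> bounded_in A I"
  unfolding fractional_ideal_def bounded_in_def using is_submoduleD(1)[of A I] by auto

lemma divisorialD:
  assumes "divisorial A I"
  shows "is_submodule A I" "bounded_in A I" "I \<subseteq> fractions A" "divisorial_hull A I = I"
  using assms unfolding divisorial_def fractional_ideal_iff by (auto simp: bounded_in_def)

context field_subring
begin

lemma fractions_add: "x \<in> fractions A \<Longrightarrow> y \<in> fractions A \<Longrightarrow> x + y \<in> fractions A"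
  and fractions_mult: "x \<in> fractions A \<Longrightarrow> y \<in> fractions A \<Longrightarrow> x * y \<in> fractions A"
  and fractions_inverse: "x \<in> fractions A \<Longrightarrow> inverse x \<in> fractions A"
proof -
  interpret K: field_subfield "fractions A" by (rule field_subfield_fractions)
  show "x \<in> fractions A \<Longrightarrow> y \<in> fractions A \<Longrightarrow> x + y \<in> fractions A"
    "x \<in> fractions A \<Longrightarrow> y \<in> fractions A \<Longrightarrow> x * y \<in> fractions A"
    "x \<in> fractions A \<Longrightarrow> inverse x \<in> fractions A" by auto
qed

lemma is_submodule_fractions: "is_submodule A (fractions A)"
  by (rule is_submoduleI) (auto intro: fractions_add fractions_mult)

lemma is_submodule_colon: "is_submodule A (colon A S)"
proof (rule is_submoduleI)
  show "0 \<in> colon A S" by (rule colonI) auto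
  show "x + y \<in> colon A S" if "x \<in> colon A S" "y \<in> colon A S" for x y
    using colonD[OF that(1)] colonD[OF that(2)] by (intro colonI fractions_add) (auto simp: distrib_right)
  show "a * x \<in> colon A S" if "a \<in> A" "x \<in> colon A S" for a x
    using that(1) colonD[OF that(2)] by (intro colonI fractions_mult) (auto simp: mult.assoc)
qed

lemma colon_span: "colon A (span_over A S) = colon A S"
proof
  show "colon A (span_over A S) \<subseteq> colon A S" by (intro colon_antimono hull_subset)
  show "colon A S \<subseteq> colon A (span_over A S)"
  proof
    fix x assume x: "x \<in> colon A S"
    have "span_over A S \<subseteq> {y. x * y \<in> A}"
      using x by (intro hull_minimal is_submoduleI) (auto simp: distrib_left mult.left_commute[of x] dest: colonD)
    then show "x \<in> colon A (span_over A S)" using x by (auto intro!: colonI dest: colonD)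
  qed
qed

text \<open>The rule \<open>A : S T = (A : S) : T\<close>. The left factor enters only through its
  colon, so it may be replaced by its hull.\<close>

lemma colon_set_prod:
  assumes "T \<subseteq> fractions A"
  shows "colon A (set_prod S T) = {z \<in> fractions A. \<forall>y\<in>T. z * y \<in> colon A S}"
proof (intro equalityI subsetI CollectI conjI ballI)
  fix z y assume "z \<in> colon A (set_prod S T)" "y \<in> T"
  then show "z * y \<in> colon A S"
    using assms by (intro colonI fractions_mult) (auto simp: mult.assoc mult.commute[of y] dest: colonD)
next
  fix z assume "z \<in> {z \<in> fractions A. \<forall>y\<in>T. z * y \<in> colon A S}"
  then show "z \<in> colon A (set_prod S T)"
    by (intro colonI) (auto simp: mult.left_commute[of z] dest!: colonD(2) bspec simp: mult_ac)
qed (auto dest: colonD)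

lemma divisorial_hull_product: "divisorial_hull A (ideal_product A I J) = divisorial_hull A (set_prod I J)"
  unfolding ideal_product_def by (intro divisorial_hull_cong colon_span)

lemma divisorial_hull_set_prod_left:
  assumes "S \<subseteq> fractions A" "T \<subseteq> fractions A"
  shows "divisorial_hull A (set_prod (divisorial_hull A S) T) = divisorial_hull A (set_prod S T)"
  using assms by (intro divisorial_hull_cong) (simp add: colon_set_prod colon_divisorial_hull)

lemma bounded_in_colon:
  assumes "bounded_in A S" shows "bounded_in A (colon A S)"
proof -
  obtain d s where *: "S \<subseteq> fractions A" "s \<in> S" "s \<noteq> 0" "d \<in> A" "d \<noteq> 0" "\<forall>s\<in>S. d * s \<in> A"
    using assms unfolding bounded_in_def by blast
  obtain a b where ab: "a \<in> A" "b \<in> A" "b \<noteq> 0" "s = a / b" using * by (auto elim: fractionsE)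
  have "d \<in> colon A S" using * by (intro colonI) auto
  \<comment> \<open>The numerator of \<open>s\<close> bounds the colon, since
    \<open>a * x = b * (x * s)\<close>.\<close>
  moreover have "a * x \<in> A" if "x \<in> colon A S" for x
    using ab * colonD(2)[OF that, of s] mult[of b "x * s"] by (simp add: mult.commute)
  ultimately show ?thesis
    unfolding bounded_in_def using * ab colon_subset_fractions[of A S] by (intro conjI bexI[of _ d] bexI[of _ a]) auto
qed

lemma bounded_in_set_prod:
  assumes "bounded_in A S" "bounded_in A T" shows "bounded_in A (set_prod S T)"
proof -
  obtain d s where *: "S \<subseteq> fractions A" "s \<in> S" "s \<noteq> 0" "d \<in> A" "d \<noteq> 0" "\<forall>s\<in>S. d * s \<in> A"
    using assms(1) unfolding bounded_in_def by blast
  obtain e t where **: "T \<subseteq> fractions A" "t \<in> T" "t \<noteq> 0" "e \<in> A" "e \<noteq> 0" "\<forall>s\<in>T. e * s \<in> A"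
    using assms(2) unfolding bounded_in_def by blast
  have "d * e * (x * y) \<in> A" if "x \<in> S" "y \<in> T" for x y
  proof -
    have "d * x \<in> A" "e * y \<in> A" using * ** that by auto
    then have "(d * x) * (e * y) \<in> A" by (rule mult)
    then show ?thesis by (simp add: mult_ac)
  qed
  moreover have "set_prod S T \<subseteq> fractions A" using *(1) **(1) fractions_mult by blast
  ultimately show ?thesis
    using * ** by (intro bounded_inI[of _ _ "s * t" "d * e"]) auto
qed

lemma bounded_in_insert_ring:
  assumes "S \<subseteq> A" "s \<in> S" "s \<noteq> 0"
  shows "bounded_in A S"
  using assms unfolding bounded_in_def by (intro conjI bexI[of _ s] bexI[of _ 1]) auto

lemma divisorial_colon:
  assumes "bounded_in A S" shows "divisorial A (colon A S)"
  using assms bounded_in_colon[OF assms] is_submodule_colon colon_divisorial_hull[of S A]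
  unfolding divisorial_def fractional_ideal_iff by (simp add: divisorial_hull_def bounded_in_def)

lemma divisorial_divisorial_hull:
  assumes "bounded_in A S" shows "divisorial A (divisorial_hull A S)"
  unfolding divisorial_hull_def by (intro divisorial_colon bounded_in_colon assms)

lemma bounded_in_self: "bounded_in A A"
  by (rule bounded_in_insert_ring[of _ 1]) auto

lemma colon_scale:
  assumes "z \<in> fractions A" "z \<noteq> 0"
  shows "colon A ((*) z ` S) = (*) (inverse z) ` colon A S"
proof (intro equalityI subsetI)
  fix x assume x: "x \<in> colon A ((*) z ` S)"
  have "z * x \<in> colon A S"
  proof (intro colonI fractions_mult)
    fix y assume "y \<in> S"
    then show "z * x * y \<in> A" using colonD(2)[OF x imageI[of y S "(*) z"]] by (simp add: mult_ac)
  qed (use assms colonD(1)[OF x] in auto)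
  moreover have "x = inverse z * (z * x)" using assms by simp
  ultimately show "x \<in> (*) (inverse z) ` colon A S" by blast
next
  fix x assume "x \<in> (*) (inverse z) ` colon A S"
  then obtain u where u: "u \<in> colon A S" "x = inverse z * u" by blast
  have "inverse z * u * (z * y) \<in> A" if "y \<in> S" for y
    using assms colonD(2)[OF u(1) that] by (simp add: mult_ac flip: mult.assoc)
  then show "x \<in> colon A ((*) z ` S)"
    using u assms colonD(1)[OF u(1)] by (auto intro!: colonI fractions_mult fractions_inverse)
qed

lemma divisorial_hull_scale:
  assumes "z \<in> fractions A" "z \<noteq> 0"
  shows "divisorial_hull A ((*) z ` S) = (*) z ` divisorial_hull A S"
  using assms by (simp add: divisorial_hull_def colon_scale fractions_inverse)

lemma bounded_in_scale:
  assumes "z \<in> fractions A" "z \<noteq> 0" "bounded_in A S"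
  shows "bounded_in A ((*) z ` S)"
proof -
  obtain a b where "a \<in> A" "b \<in> A" "b \<noteq> 0" "z = a / b" using assms(1) by (rule fractionsE)
  then have "bounded_in A {z}"
    using assms by (intro bounded_inI[of _ _ z b]) auto
  moreover have "(*) z ` S = set_prod {z} S" by auto
  ultimately show ?thesis using bounded_in_set_prod[of "{z}" S] assms(3) by simp
qed

lemma divisorial_scale:
  assumes "z \<in> fractions A" "z \<noteq> 0" "divisorial A I"
  shows "divisorial A ((*) z ` I)"
  using divisorial_divisorial_hull[OF bounded_in_scale[OF assms(1,2) divisorialD(2)[OF assms(3)]]]
    divisorialD(4)[OF assms(3)] by (simp add: divisorial_hull_scale[OF assms(1,2)])

lemma colon_self: "colon A A = A"
proof (intro equalityI subsetI)
  show "x \<in> A" if "x \<in> colon A A" for x using colonD(2)[OF that one] by simp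
  show "x \<in> colon A A" if "x \<in> A" for x using that by (intro colonI) auto
qed

lemma divisorial_self: "divisorial A A"
  using divisorial_colon[OF bounded_in_self] by (simp add: colon_self)

lemma principal_divisorsE:
  assumes "I \<in> principal_divisors A"
  obtains z where "z \<in> fractions A" "z \<noteq> 0" "I = (*) z ` A"
  using assms unfolding principal_divisors_def by auto

lemma principal_divisorsI: "z \<in> fractions A \<Longrightarrow> z \<noteq> 0 \<Longrightarrow> (*) z ` A \<in> principal_divisors A"
  unfolding principal_divisors_def by auto

lemma principal_divisors_subset: "principal_divisors A \<subseteq> carrier (divisor_group A)"
  by (auto simp: divisor_group_def elim!: principal_divisorsE intro: divisorial_scale divisorial_self)

lemma set_prod_self:
  assumes "is_submodule A I" shows "set_prod A I = I"
proof
  show "set_prod A I \<subseteq> I" using is_submoduleD(3)[OF assms] by auto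
  show "I \<subseteq> set_prod A I" using one by force
qed

lemma mult_divisor_group:
  "I \<otimes>\<^bsub>divisor_group A\<^esub> J = divisorial_hull A (set_prod I J)"
  by (simp add: divisor_group_def divisorial_hull_product)

lemma mult_principal_divisor:
  assumes "z \<in> fractions A" "z \<noteq> 0" "divisorial A I"
  shows "((*) z ` A) \<otimes>\<^bsub>divisor_group A\<^esub> I = (*) z ` I"
proof -
  have "(*) z ` A = set_prod {z} A" by auto
  then have "set_prod ((*) z ` A) I = set_prod {z} (set_prod A I)" by (simp only: set_prod_assoc)
  also have "\<dots> = (*) z ` set_prod A I" by auto
  finally have "set_prod ((*) z ` A) I = (*) z ` set_prod A I" .
  then show ?thesis
    using assms divisorialD[OF assms(3)] by (simp add: mult_divisor_group set_prod_self divisorial_hull_scale)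
qed

text \<open>An element \<open>z\<close> carrying \<open>(A : I) I\<close> into \<open>A\<close> maps
  \<open>A : I\<close> to itself, so \<open>u * i * z ^ n \<in> A\<close> for all \<open>n\<close>.
  Complete integral closedness then gives \<open>z \<in> A\<close>; this is what makes divisors
  invertible.\<close>

lemma colon_inverse:
  assumes "completely_integrally_closed A" "divisorial A I"
  shows "divisorial_hull A (set_prod (colon A I) I) = A"
proof -
  note I = divisorialD[OF assms(2)]
  have "colon A (set_prod (colon A I) I) = A"
  proof (intro equalityI subsetI)
    fix z assume z: "z \<in> A"
    then show "z \<in> colon A (set_prod (colon A I) I)"
      by (auto intro!: colonI dest: colonD)
  next
    fix z assume z: "z \<in> colon A (set_prod (colon A I) I)"
    have zu: "z * u \<in> colon A I" if "u \<in> colon A I" for u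
      using colonD[OF z] colonD(1)[OF that] that
      by (intro colonI fractions_mult) (auto simp: mult.assoc)
    obtain i u where iu: "i \<in> I" "i \<noteq> 0" "u \<in> colon A I" "u \<noteq> 0"
      using I(2) bounded_in_colon[OF I(2)] unfolding bounded_in_def by blast
    have "z ^ n * u \<in> colon A I" for n
      using iu(3) zu by (induction n) (auto simp: mult.assoc)
    then have "u * i * z ^ n \<in> A" for n
      using colonD(2)[of "z ^ n * u" A I i] iu(1) by (simp add: mult_ac)
    then show "z \<in> A"
      using completely_integrally_closedD[OF assms(1) colonD(1)[OF z], of "u * i"] iu colonD(2)[OF iu(3,1)] by auto
  qed
  then show ?thesis by (simp add: divisorial_hull_def colon_self)
qed

lemma comm_group_divisor_group:
  assumes "completely_integrally_closed A"
  shows "comm_group (divisor_group A)"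
proof (rule comm_groupI)
  let ?G = "divisor_group A"
  have carrier: "I \<in> carrier ?G \<longleftrightarrow> divisorial A I" for I by (simp add: divisor_group_def)
  have one: "\<one>\<^bsub>?G\<^esub> = A" by (simp add: divisor_group_def)
  show "I \<otimes>\<^bsub>?G\<^esub> J \<in> carrier ?G" if "I \<in> carrier ?G" "J \<in> carrier ?G" for I J
    using that unfolding carrier mult_divisor_group
    by (intro divisorial_divisorial_hull bounded_in_set_prod divisorialD)
  show "\<one>\<^bsub>?G\<^esub> \<in> carrier ?G" unfolding carrier one by (rule divisorial_self)
  show "I \<otimes>\<^bsub>?G\<^esub> J = J \<otimes>\<^bsub>?G\<^esub> I" for I J
    unfolding mult_divisor_group by (subst set_prod_commute) simp
  show "(I \<otimes>\<^bsub>?G\<^esub> J) \<otimes>\<^bsub>?G\<^esub> H = I \<otimes>\<^bsub>?G\<^esub> (J \<otimes>\<^bsub>?G\<^esub> H)"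
    if "I \<in> carrier ?G" "J \<in> carrier ?G" "H \<in> carrier ?G" for I J H
  proof -
    have sub: "set_prod S T \<subseteq> fractions A" if "S \<subseteq> fractions A" "T \<subseteq> fractions A" for S T
      using that fractions_mult by auto
    note div = that[unfolded carrier, THEN divisorialD(3)]
    have "(I \<otimes>\<^bsub>?G\<^esub> J) \<otimes>\<^bsub>?G\<^esub> H = divisorial_hull A (set_prod (set_prod I J) H)"
      unfolding mult_divisor_group using div by (intro divisorial_hull_set_prod_left sub)
    \<comment> \<open>The factors are rotated because a hull can be inserted or removed only on the
      left.\<close>
    also have "\<dots> = divisorial_hull A (set_prod (set_prod J H) I)"
      by (subst set_prod_assoc, subst set_prod_commute) simp
    also have "\<dots> = divisorial_hull A (set_prod (divisorial_hull A (set_prod J H)) I)"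
      using div by (intro divisorial_hull_set_prod_left[symmetric] sub)
    also have "\<dots> = I \<otimes>\<^bsub>?G\<^esub> (J \<otimes>\<^bsub>?G\<^esub> H)"
      unfolding mult_divisor_group by (subst set_prod_commute) simp
    finally show ?thesis .
  qed
  show "\<one>\<^bsub>?G\<^esub> \<otimes>\<^bsub>?G\<^esub> I = I" if "I \<in> carrier ?G" for I
    using that divisorialD[of A I] unfolding carrier one mult_divisor_group by (simp add: set_prod_self)
  show "\<exists>J\<in>carrier ?G. J \<otimes>\<^bsub>?G\<^esub> I = \<one>\<^bsub>?G\<^esub>" if "I \<in> carrier ?G" for I
    using that colon_inverse[OF assms, of I] divisorial_colon[OF divisorialD(2)[of A I]]
    unfolding carrier one mult_divisor_group by (intro bexI[of _ "colon A I"]) (auto simp: carrier)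
qed

lemma subgroup_principal_divisors:
  assumes "completely_integrally_closed A"
  shows "subgroup (principal_divisors A) (divisor_group A)"
proof -
  interpret G: comm_group "divisor_group A" by (rule comm_group_divisor_group[OF assms])
  have one: "\<one>\<^bsub>divisor_group A\<^esub> = A" by (simp add: divisor_group_def)
  have mult: "((*) z ` A) \<otimes>\<^bsub>divisor_group A\<^esub> ((*) u ` A) = (*) (z * u) ` A"
    if "z \<in> fractions A" "z \<noteq> 0" "u \<in> fractions A" "u \<noteq> 0" for z u
    using mult_principal_divisor[OF that(1,2) divisorial_scale[OF that(3,4) divisorial_self]]
    by (simp add: image_image mult.assoc)
  show ?thesis
  proof (rule G.subgroupI)
    show "principal_divisors A \<subseteq> carrier (divisor_group A)" by (rule principal_divisors_subset)
    show "principal_divisors A \<noteq> {}" using principal_divisorsI[of 1] by auto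
    fix I assume I: "I \<in> principal_divisors A"
    then obtain z where z: "z \<in> fractions A" "z \<noteq> 0" "I = (*) z ` A" by (rule principal_divisorsE)
    have inv: "(*) (inverse z) ` A \<in> principal_divisors A"
      using z by (intro principal_divisorsI fractions_inverse) auto
    have "(*) (inverse z) ` A \<otimes>\<^bsub>divisor_group A\<^esub> I = \<one>\<^bsub>divisor_group A\<^esub>"
      using z mult[of "inverse z" z] fractions_inverse by (simp add: one)
    then have "inv\<^bsub>divisor_group A\<^esub> I = (*) (inverse z) ` A"
      using principal_divisors_subset I inv by (intro G.inv_equality) auto
    then show "inv\<^bsub>divisor_group A\<^esub> I \<in> principal_divisors A" using inv by simp
    fix J assume "J \<in> principal_divisors A"
    then obtain u where u: "u \<in> fractions A" "u \<noteq> 0" "J = (*) u ` A" by (rule principal_divisorsE)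
    show "I \<otimes>\<^bsub>divisor_group A\<^esub> J \<in> principal_divisors A"
      using z u mult[of z u] principal_divisorsI[of "z * u"] fractions_mult by auto
  qed
qed

end

subsection \<open>Extensions preserving the divisor class group\<close>

text \<open>Extended ideals must be divisorial without taking a hull, products must be respected,
  and the last two clauses give injectivity and surjectivity modulo principal divisors. Being
  phrased on ideals, the notion composes along a tower.\<close>

definition divisor_extension :: "'a::field set \<Rightarrow> 'a set \<Rightarrow> bool" where
  "divisor_extension A B \<longleftrightarrow> A \<subseteq> B \<and>
     (\<forall>I. divisorial A I \<longrightarrow> divisorial B (span_over B I)) \<and>
     (\<forall>I J. divisorial A I \<longrightarrow> divisorial A J \<longrightarrow>
        divisorial_hull B (set_prod (span_over B I) (span_over B J)) =
        span_over B (divisorial_hull A (set_prod I J))) \<and>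
     (\<forall>I. divisorial A I \<longrightarrow> span_over B I \<in> principal_divisors B \<longrightarrow> I \<in> principal_divisors A) \<and>
     (\<forall>J. divisorial B J \<longrightarrow> (\<exists>I z. divisorial A I \<and> z \<in> fractions B \<and> z \<noteq> 0 \<and> J = (*) z ` span_over B I))"

lemma divisor_extensionD:
  assumes "divisor_extension A B"
  shows "A \<subseteq> B" "divisorial A I \<Longrightarrow> divisorial B (span_over B I)"
    "divisorial A I \<Longrightarrow> divisorial A J \<Longrightarrow>
       divisorial_hull B (set_prod (span_over B I) (span_over B J)) =
       span_over B (divisorial_hull A (set_prod I J))"
    "divisorial A I \<Longrightarrow> span_over B I \<in> principal_divisors B \<Longrightarrow> I \<in> principal_divisors A"
    "divisorial B H \<Longrightarrow> \<exists>I z. divisorial A I \<and> z \<in> fractions B \<and> z \<noteq> 0 \<and> H = (*) z ` span_over B I"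
  using assms[unfolded divisor_extension_def] by simp_all

lemma (in field_subring) divisor_extension_refl: "divisor_extension A A"
proof -
  have "span_over A I = I" if "divisorial A I" for I
    using divisorialD(1)[OF that] by (rule hull_same)
  moreover have "divisorial A (divisorial_hull A (set_prod I J))" if "divisorial A I" "divisorial A J" for I J
    using that by (intro divisorial_divisorial_hull bounded_in_set_prod divisorialD)
  ultimately show ?thesis
    unfolding divisor_extension_def using one
    by (auto intro!: exI[of _ "1::'a"])
qed

lemma divisor_extension_trans:
  assumes "field_subring A" "field_subring B" "field_subring C"
    and AB: "divisor_extension A B" and BC: "divisor_extension B C"
  shows "divisor_extension A C"
proof -
  interpret A: field_subring A by fact
  interpret B: field_subring B by fact
  interpret C: field_subring C by fact
  have sub: "A \<subseteq> B" "B \<subseteq> C" using AB BC by (auto simp: divisor_extension_def)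
  have span: "span_over C I = span_over C (span_over B I)" for I
    by (rule span_span_over[OF sub(2), symmetric])
  note AB' = divisor_extensionD[OF AB] and BC' = divisor_extensionD[OF BC]
  show ?thesis
    unfolding divisor_extension_def
  proof (intro conjI allI impI)
    show "A \<subseteq> C" using sub by blast
    show "divisorial C (span_over C I)" if "divisorial A I" for I
      by (subst span) (intro BC'(2) AB'(2) that)
    show "divisorial_hull C (set_prod (span_over C I) (span_over C J)) =
        span_over C (divisorial_hull A (set_prod I J))" if "divisorial A I" "divisorial A J" for I J
    proof -
      have "divisorial_hull C (set_prod (span_over C (span_over B I)) (span_over C (span_over B J))) =
          span_over C (divisorial_hull B (set_prod (span_over B I) (span_over B J)))"
        by (intro BC'(3) AB'(2) that)
      also have "divisorial_hull B (set_prod (span_over B I) (span_over B J)) =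
          span_over B (divisorial_hull A (set_prod I J))" by (intro AB'(3) that)
      finally show ?thesis by (simp flip: span)
    qed
    show "I \<in> principal_divisors A" if "divisorial A I" "span_over C I \<in> principal_divisors C" for I
      using that(2) AB'(4)[OF that(1) BC'(4)[OF AB'(2)[OF that(1)]]] by (simp add: span[of I])
    show "\<exists>I z. divisorial A I \<and> z \<in> fractions C \<and> z \<noteq> 0 \<and> J = (*) z ` span_over C I"
      if "divisorial C J" for J
    proof -
      from BC'(5)[OF that] obtain I z where I: "divisorial B I" "z \<in> fractions C" "z \<noteq> 0" "J = (*) z ` span_over C I"
        by blast
      from AB'(5)[OF I(1)] obtain I' u where I': "divisorial A I'" "u \<in> fractions B" "u \<noteq> 0"
          "I = (*) u ` span_over B I'" by blast
      have "J = (*) z ` (*) u ` span_over C (span_over B I')"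
        unfolding I(4) I'(4) by (subst span_over_scale[OF I'(3)]) simp
      also have "\<dots> = (*) (z * u) ` span_over C I'"
        by (simp add: image_image mult.assoc flip: span)
      finally show ?thesis
        using I I' fractions_mono[OF sub(2)] by (intro exI[of _ I'] exI[of _ "z * u"]) (auto intro: C.fractions_mult)
    qed
  qed
qed

text \<open>The first isomorphism theorem for \<open>I \<mapsto>\<close> class of the extended
  ideal, from the divisor group of \<open>A\<close> to the class group of \<open>B\<close>: its
  kernel consists of the principal divisors. The hull in \<open>extend_divisor\<close> changes
  nothing here.\<close>

theorem class_group_iso_if_divisor_extension:
  assumes "field_subring A" "field_subring B"
    and cic: "completely_integrally_closed A" "completely_integrally_closed B"
    and ext: "divisor_extension A B"
  shows "\<exists>\<phi> \<in> iso (class_group A) (class_group B).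
           \<forall>I. divisorial A I \<longrightarrow> \<phi> (divisor_class A I) = divisor_class B (extend_divisor B I)"
proof -
  interpret A: field_subring A by fact
  interpret B: field_subring B by fact
  let ?GA = "divisor_group A" and ?GB = "divisor_group B"
  interpret GA: comm_group ?GA by (rule A.comm_group_divisor_group[OF cic(1)])
  interpret GB: comm_group ?GB by (rule B.comm_group_divisor_group[OF cic(2)])
  have subA: "subgroup (principal_divisors A) ?GA" by (rule A.subgroup_principal_divisors[OF cic(1)])
  have subB: "subgroup (principal_divisors B) ?GB" by (rule B.subgroup_principal_divisors[OF cic(2)])
  interpret NB: normal "principal_divisors B" ?GB using subB GB.normal_iff_subgroup by blast
  have carrier: "I \<in> carrier ?GA \<longleftrightarrow> divisorial A I" "J \<in> carrier ?GB \<longleftrightarrow> divisorial B J" for I J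
    by (auto simp: divisor_group_def)
  note ext' = divisor_extensionD[OF ext]
  note span = ext'(2)
  define h where "h I = divisor_class B (span_over B I)" for I
  have "h \<in> hom ?GA (class_group B)"
  proof (rule homI)
    fix I J assume IJ: "I \<in> carrier ?GA" "J \<in> carrier ?GA"
    show "h I \<in> carrier (class_group B)"
      using span IJ by (auto simp: class_group_def carrier_FactGroup h_def divisor_class_def carrier)
    have "h I \<otimes>\<^bsub>class_group B\<^esub> h J = divisor_class B (span_over B I \<otimes>\<^bsub>?GB\<^esub> span_over B J)"
      using span IJ unfolding h_def divisor_class_def class_group_def
      by (simp add: NB.rcos_sum carrier)
    also have "span_over B I \<otimes>\<^bsub>?GB\<^esub> span_over B J = span_over B (I \<otimes>\<^bsub>?GA\<^esub> J)"
      unfolding A.mult_divisor_group B.mult_divisor_group using IJ by (intro ext'(3)) (auto simp: carrier)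
    finally show "h (I \<otimes>\<^bsub>?GA\<^esub> J) = h I \<otimes>\<^bsub>class_group B\<^esub> h J" by (simp add: h_def)
  qed
  moreover have "group (class_group B)" unfolding class_group_def by (rule NB.factorgroup_is_group)
  ultimately interpret h: group_hom ?GA "class_group B" h
    by (simp add: group_hom_def group_hom_axioms_def GA.is_group)
  have "h I = principal_divisors B \<longleftrightarrow> I \<in> principal_divisors A" if I: "divisorial A I" for I
  proof
    assume "h I = principal_divisors B"
    then have "span_over B I \<in> principal_divisors B"
      using GB.coset_join1[OF _ _ subB] span[OF I] by (auto simp: h_def divisor_class_def carrier)
    then show "I \<in> principal_divisors A" by (rule ext'(4)[OF I])
  next
    assume "I \<in> principal_divisors A"
    then obtain z where z: "z \<in> fractions A" "z \<noteq> 0" "I = (*) z ` A" by (rule A.principal_divisorsE)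
    have "span_over B A = B"
    proof
      show "span_over B A \<subseteq> B"
        using ext by (intro hull_minimal B.is_submodule_self) (auto simp: divisor_extension_def)
      have "1 \<in> span_over B A" by (intro hull_inc) simp
      from is_submoduleD(3)[OF is_submodule_span _ this] show "B \<subseteq> span_over B A" by fastforce
    qed
    then have "span_over B I = (*) z ` B" using z by (simp add: span_over_scale)
    also have "\<dots> \<in> principal_divisors B"
      using z fractions_mono[of A B] ext by (intro B.principal_divisorsI) (auto simp: divisor_extension_def)
    finally show "h I = principal_divisors B"
      using GB.coset_join2[OF _ subB] span[OF I] by (auto simp: h_def divisor_class_def carrier)
  qed
  then have kernel: "kernel ?GA (class_group B) h = principal_divisors A"
    using A.principal_divisors_subset carrier(1) unfolding kernel_def class_group_def one_FactGroup by blast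
  have surj: "h ` carrier ?GA = carrier (class_group B)"
  proof
    show "h ` carrier ?GA \<subseteq> carrier (class_group B)" by auto
    show "carrier (class_group B) \<subseteq> h ` carrier ?GA"
    proof
      fix Z assume "Z \<in> carrier (class_group B)"
      then obtain J where J: "divisorial B J" "Z = divisor_class B J"
        by (auto simp: class_group_def carrier_FactGroup divisor_class_def carrier)
      then obtain I z where I: "divisorial A I" "z \<in> fractions B" "z \<noteq> 0" "J = (*) z ` span_over B I"
        using ext'(5) by blast
      have zB: "(*) z ` B \<in> principal_divisors B" by (intro B.principal_divisorsI I)
      have J_eq: "J = (*) z ` B \<otimes>\<^bsub>?GB\<^esub> span_over B I"
        using I span by (simp add: B.mult_principal_divisor)
      have "Z = (principal_divisors B #>\<^bsub>?GB\<^esub> ((*) z ` B)) #>\<^bsub>?GB\<^esub> span_over B I"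
        unfolding J(2) divisor_class_def J_eq
        using zB I span B.principal_divisors_subset by (intro GB.coset_mult_assoc[symmetric]) (auto simp: carrier)
      also have "principal_divisors B #>\<^bsub>?GB\<^esub> ((*) z ` B) = principal_divisors B"
        using zB B.principal_divisors_subset by (intro GB.coset_join2[OF _ subB]) auto
      finally have "Z = h I" by (simp add: h_def divisor_class_def)
      then show "Z \<in> h ` carrier ?GA" using I carrier by blast
    qed
  qed
  have iso: "(\<lambda>Z. the_elem (h ` Z)) \<in> iso (class_group A) (class_group B)"
    using h.FactGroup_iso_set[OF surj] unfolding kernel class_group_def[of A] .
  have "the_elem (h ` divisor_class A I) = divisor_class B (extend_divisor B I)"
    if I: "divisorial A I" for I
  proof -
    have "h ` divisor_class A I = {h I}"
    proof -
      have "I \<in> divisor_class A I"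
        using I GA.rcos_self[OF _ subA] by (simp add: divisor_class_def carrier)
      moreover have "h J = h I" if "J \<in> divisor_class A I" for J
      proof -
        from that obtain P where P: "P \<in> principal_divisors A" "J = P \<otimes>\<^bsub>?GA\<^esub> I"
          by (auto simp: divisor_class_def r_coset_def)
        have "P \<in> kernel ?GA (class_group B) h" using P kernel by simp
        then have "h P = \<one>\<^bsub>class_group B\<^esub>" "P \<in> carrier ?GA" by (auto simp: kernel_def)
        then show ?thesis using P(2) I by (simp add: carrier)
      qed
      ultimately show ?thesis by blast
    qed
    moreover have "extend_divisor B I = span_over B I"
      unfolding extend_divisor_def using divisorialD(4)[OF span[OF I]] .
    ultimately show ?thesis by (simp add: h_def)
  qed
  then show ?thesis by (intro bexI[OF _ iso] allI impI)
qed

section \<open>Adjoining a transcendental element\<close>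

text \<open>Gauss' lemma: the minimal value of the coefficients is multiplicative for every essential valuation.\<close>

lemma krull_domain_coeff_mult:
  assumes "krull_domain A" and f: "f \<in> polys_over (fractions A)" and u: "u \<in> polys_over (fractions A)"
    and fu: "f * u \<in> polys_over A"
  shows "Polynomial.coeff f i * Polynomial.coeff u k \<in> A"
proof (rule ccontr)
  assume contra: "Polynomial.coeff f i * Polynomial.coeff u k \<notin> A"
  interpret field_subring A using assms(1) by (auto simp: krull_domain_def field_subring_def)
  interpret K: field_subfield "fractions A" by (rule field_subfield_fractions)
  obtain V where V': "\<forall>v\<in>V. discrete_valuation (fractions A) v"
      "\<forall>x\<in>fractions A - {0}. x \<in> A \<longleftrightarrow> (\<forall>v\<in>V. v x \<ge> 0)"
    using assms(1) unfolding krull_domain_def by (elim conjE exE) (rule that)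
  note V = V'[rule_format]
  have nz: "Polynomial.coeff f i * Polynomial.coeff u k \<noteq> 0" using contra by auto
  obtain v where v: "v \<in> V" "v (Polynomial.coeff f i * Polynomial.coeff u k) < 0"
  proof -
    have "Polynomial.coeff f i * Polynomial.coeff u k \<in> fractions A - {0}" using f u nz by auto
    from V(2)[OF this] contra show thesis using that by (meson not_le)
  qed
  have v_mult: "v (x * y) = v x + v y" if "x \<in> fractions A" "y \<in> fractions A" "x \<noteq> 0" "y \<noteq> 0" for x y
    using V(1)[OF v(1)] that by (auto simp: discrete_valuation_def)
  have v_add: "v (x + y) \<ge> min (v x) (v y)"
    if "x \<in> fractions A" "y \<in> fractions A" "x \<noteq> 0" "y \<noteq> 0" "x + y \<noteq> 0" for x y
    using V(1)[OF v(1)] that by (auto simp: discrete_valuation_def)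
  have v_uminus: "v (- x) = v x" if "x \<in> fractions A" "x \<noteq> 0" for x
    using v_mult[of "-1" x] v_mult[of "-1" "-1"] v_mult[of 1 1] that by auto
  \<comment> \<open>The first index at which the least value of the coefficients is attained; zero
    coefficients are excluded because \<open>v 0\<close> is meaningless.\<close>
  have minimal: "\<exists>i a. Polynomial.coeff p i \<noteq> 0 \<and> v (Polynomial.coeff p i) = a \<and>
      (\<forall>k. Polynomial.coeff p k \<noteq> 0 \<longrightarrow> v (Polynomial.coeff p k) \<ge> a) \<and>
      (\<forall>k<i. Polynomial.coeff p k \<noteq> 0 \<longrightarrow> v (Polynomial.coeff p k) > a)" if "p \<noteq> 0" for p
  proof -
    define T where "T = {k. Polynomial.coeff p k \<noteq> 0}"
    have T: "finite T" "T \<noteq> {}"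
      using that finite_subset[of T "{..Polynomial.degree p}"] le_degree unfolding T_def poly_eq_iff
      by fastforce+
    define a where "a = Min ((\<lambda>k. v (Polynomial.coeff p k)) ` T)"
    define i where "i = (LEAST i. i \<in> T \<and> v (Polynomial.coeff p i) = a)"
    have a_le: "v (Polynomial.coeff p k) \<ge> a" if "k \<in> T" for k
      using that T by (auto simp: a_def)
    have "a \<in> (\<lambda>k. v (Polynomial.coeff p k)) ` T"
      unfolding a_def by (rule Min_in) (use T in auto)
    then have "\<exists>i. i \<in> T \<and> v (Polynomial.coeff p i) = a" by (metis imageE)
    then have i: "i \<in> T \<and> v (Polynomial.coeff p i) = a"
      unfolding i_def by (rule LeastI_ex)
    have "v (Polynomial.coeff p k) > a" if "k < i" "k \<in> T" for k
      using not_less_Least[of k "\<lambda>i. i \<in> T \<and> v (Polynomial.coeff p i) = a"] that a_le[of k]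
      unfolding i_def by simp
    then show ?thesis
      using a_le i by (intro exI[of _ i] exI[of _ a]) (simp add: T_def)
  qed
  have "f \<noteq> 0" "u \<noteq> 0" using nz by auto
  then obtain i0 a k0 b where
      i0: "Polynomial.coeff f i0 \<noteq> 0" "v (Polynomial.coeff f i0) = a"
        "\<And>k. Polynomial.coeff f k \<noteq> 0 \<Longrightarrow> v (Polynomial.coeff f k) \<ge> a"
        "\<And>k. k < i0 \<Longrightarrow> Polynomial.coeff f k \<noteq> 0 \<Longrightarrow> v (Polynomial.coeff f k) > a"
    and k0: "Polynomial.coeff u k0 \<noteq> 0" "v (Polynomial.coeff u k0) = b"
        "\<And>k. Polynomial.coeff u k \<noteq> 0 \<Longrightarrow> v (Polynomial.coeff u k) \<ge> b"
        "\<And>k. k < k0 \<Longrightarrow> Polynomial.coeff u k \<noteq> 0 \<Longrightarrow> v (Polynomial.coeff u k) > b"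
    using minimal[of f] minimal[of u] by metis
  have fK: "Polynomial.coeff f k \<in> fractions A" and uK: "Polynomial.coeff u k \<in> fractions A" for k
    using f u by auto
  have "v (Polynomial.coeff f i) + v (Polynomial.coeff u k) < 0"
    using v(2) v_mult[OF fK uK, of i k] nz by simp
  then have neg: "a + b < 0" using i0(3)[of i] k0(3)[of k] nz by simp
  \<comment> \<open>\<open>W\<close> is an additive group. In the coefficient of
    \<open>f * u\<close> at \<open>i0 + k0\<close>, all summands except that of \<open>i0\<close>
    lie in \<open>W\<close>; so does the coefficient itself, whose value is nonnegative. Hence the
    remaining summand lies in \<open>W\<close>, although its value is exactly
    \<open>a + b\<close>.\<close>
  define W where "W = {z \<in> fractions A. z = 0 \<or> v z > a + b}"
  have W_add: "x + y \<in> W" if "x \<in> W" "y \<in> W" for x y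
  proof (cases "x = 0 \<or> y = 0 \<or> x + y = 0")
    case False
    then show ?thesis using that v_add[of x y] by (auto simp: W_def)
  qed (use that in \<open>auto simp: W_def\<close>)
  have W_uminus: "- x \<in> W" if "x \<in> W" for x
    using that v_uminus[of x] by (cases "x = 0") (auto simp: W_def)
  define n where "n = i0 + k0"
  let ?t = "\<lambda>i. Polynomial.coeff f i * Polynomial.coeff u (n - i)"
  have rest: "(\<Sum>i\<in>{..n} - {i0}. ?t i) \<in> W"
  proof -
    have "?t i \<in> W" if i: "i \<in> {..n} - {i0}" for i
    proof (cases "?t i = 0")
      case False
      then have nz: "Polynomial.coeff f i \<noteq> 0" "Polynomial.coeff u (n - i) \<noteq> 0" by auto
      have "v (?t i) > a + b"
      proof (cases "i < i0")
        case True
        then show ?thesis using v_mult[OF fK uK nz] i0(4)[OF True nz(1)] k0(3)[OF nz(2)] by simp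
      next
        case False
        then have "n - i < k0" using i by (auto simp: n_def)
        then show ?thesis using v_mult[OF fK uK nz] i0(3)[OF nz(1)] k0(4)[OF _ nz(2)] by simp
      qed
      then show ?thesis using fK uK by (simp add: W_def)
    qed (use K.zero in \<open>simp add: W_def del: mult_eq_0_iff\<close>)
    then have "(\<Sum>i\<in>S. ?t i) \<in> W" if "S \<subseteq> {..n} - {i0}" for S
      using that by (induction S rule: infinite_finite_induct) (auto intro!: W_add, auto simp: W_def)
    then show ?thesis by blast
  qed
  have "Polynomial.coeff (f * u) n \<in> W"
  proof (cases "Polynomial.coeff (f * u) n = 0")
    case False
    have "Polynomial.coeff (f * u) n \<in> A" using fu by auto
    then show ?thesis using V(2)[of "Polynomial.coeff (f * u) n"] v(1) False neg by (force simp: W_def)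
  qed (simp add: W_def)
  moreover have "Polynomial.coeff (f * u) n = ?t i0 + (\<Sum>i\<in>{..n} - {i0}. ?t i)"
    unfolding coeff_mult by (subst sum.remove[of _ i0]) (auto simp: n_def)
  ultimately have "?t i0 \<in> W"
    using W_add[OF _ W_uminus[OF rest], of "Polynomial.coeff (f * u) n"] by simp
  moreover have "v (?t i0) = a + b"
    using v_mult[OF fK uK i0(1) k0(1)] i0(2) k0(2) by (simp add: n_def)
  ultimately show False using i0(1) k0(1) by (simp add: W_def n_def)
qed

text \<open>Saturation of \<open>A\<close> in \<open>B\<close>. It moves coprimality and
  power-freeness from \<open>A\<close> up to \<open>B\<close>, where new divisors could otherwise
  appear. Zero is excluded because every element divides it.\<close>

definition factor_closed :: "'a::field set \<Rightarrow> 'a set \<Rightarrow> bool" where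
  "factor_closed A B \<longleftrightarrow> A \<subseteq> B \<and> (\<forall>a\<in>B. \<forall>b\<in>B. a * b \<in> A \<longrightarrow> a * b \<noteq> 0 \<longrightarrow> a \<in> A)"

lemma factor_closedD:
  assumes "factor_closed A B" "a \<in> B" "b \<in> B" "a * b \<in> A" "a * b \<noteq> 0"
  shows "a \<in> A" "b \<in> A"
  using assms unfolding factor_closed_def by (auto simp: mult.commute)

lemma factor_closed_refl: "factor_closed A A"
  by (auto simp: factor_closed_def)

lemma factor_closed_trans: "factor_closed A B \<Longrightarrow> factor_closed B C \<Longrightarrow> factor_closed A C"
proof -
  assume AB: "factor_closed A B" and BC: "factor_closed B C"
  have "a \<in> A" if "a \<in> C" "b \<in> C" "a * b \<in> A" "a * b \<noteq> 0" for a b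
  proof -
    have "a * b \<in> B" using AB that(3) by (auto simp: factor_closed_def)
    then show ?thesis
      using factor_closedD[OF BC that(1,2) _ that(4)] factor_closedD(1)[OF AB _ _ that(3,4)] by simp
  qed
  then show "factor_closed A C" using AB BC by (auto simp: factor_closed_def)
qed

text \<open>A divisor \<open>c\<close> in \<open>B\<close> of the nonzero \<open>x\<close> and its
  cofactor already lie in \<open>A\<close>, where the hypothesis applies.\<close>

lemma factor_closed_power_free:
  assumes "factor_closed A B" "field_subring B" "power_free k A x" "x \<in> A" "x \<noteq> 0" "k > 0"
  shows "power_free k B x"
  unfolding power_free_iff
proof (intro ballI impI)
  interpret B: field_subring B by fact
  fix c assume c: "c \<in> B" "\<exists>d\<in>B. x = c ^ k * d"
  then obtain d where d: "d \<in> B" "x = c ^ k * d" by blast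
  have "x = c * (c ^ (k - 1) * d)" using d(2) assms(6) by (cases k) (auto simp: mult_ac)
  then have "c \<in> A" using factor_closedD(1)[OF assms(1) c(1), of "c ^ (k - 1) * d"] d(1) c(1) assms(4,5) by auto
  moreover have "d \<in> A" using factor_closedD(2)[OF assms(1), of "c ^ k" d] d c(1) assms(4,5) by auto
  ultimately obtain e where "e \<in> A" "c * e = 1" using assms(3) d(2) unfolding power_free_iff by blast
  then show "\<exists>d\<in>B. c * d = 1" using assms(1) by (auto simp: factor_closed_def)
qed

lemma factor_closed_gcd_one:
  assumes "factor_closed A B" "field_subring A" "gcd_one A {a, b}" "a \<in> A" "b \<in> A" "a \<noteq> 0" "b \<noteq> 0"
  shows "gcd_one B {a, b}"
  unfolding gcd_one_iff
proof (intro ballI impI)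
  interpret A: field_subring A by fact
  fix c assume c: "c \<in> B" "\<forall>s\<in>{a, b}. \<exists>d\<in>B. s = c * d"
  then obtain d e where de: "d \<in> B" "e \<in> B" "a = c * d" "b = c * e" by auto
  have "c \<in> A" "d \<in> A"
    using factor_closedD[OF assms(1) c(1) de(1)] assms(4,6) unfolding de(3) by simp_all
  moreover have "e \<in> A"
    using factor_closedD(2)[OF assms(1) c(1) de(2)] assms(5,7) unfolding de(4) by simp
  ultimately obtain e' where "e' \<in> A" "c * e' = 1"
    using assms(3) de(3,4) unfolding gcd_one_iff by (metis insert_iff singletonD)
  then show "\<exists>d\<in>B. c * d = 1" using assms(1) by (auto simp: factor_closed_def)
qed

lemma factor_closed_Units:
  assumes "factor_closed A B" "field_subring A"
  shows "Units (induced_ring B) = Units (induced_ring A)"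
proof (intro equalityI subsetI)
  interpret A: field_subring A by fact
  fix u assume "u \<in> Units (induced_ring B)"
  then obtain v where v: "u \<in> B" "v \<in> B" "u * v = 1" by (auto simp: Units_induced_iff)
  then have "u \<in> A" "v \<in> A" using factor_closedD[OF assms(1) v(1,2)] by auto
  then show "u \<in> Units (induced_ring A)" using v(3) by (auto simp: Units_induced_iff)
next
  fix u assume "u \<in> Units (induced_ring A)"
  then show "u \<in> Units (induced_ring B)" using assms(1) by (auto simp: Units_induced_iff factor_closed_def)
qed

section \<open>The polynomial ring \<open>A[x]\<close> inside the principal ideal domain
  \<open>K[x]\<close>\<close>

locale transcendental_extension = field_subring A for A :: "'a::field set" +
  fixes x :: 'a
  assumes transcendental: "transcendental_over (fractions A) x"
begin

abbreviation K :: "'a set" where "K \<equiv> fractions A"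

text \<open>The coefficients range over any set, so the same notation serves \<open>A[x]\<close>,
  \<open>K[x]\<close> and the extension \<open>I[x]\<close> of an ideal.\<close>

definition polys_at :: "'a set \<Rightarrow> 'a set" where
  "polys_at S = (\<lambda>p. poly p x) ` polys_over S"

sublocale K: field_subfield K by (rule field_subfield_fractions)

lemma ring_adjoin_eq: "ring_adjoin A {x} = polys_at A"
  unfolding polys_at_def by (rule ring_adjoin_singleton)

lemma field_subring_polys_at: "field_subring S \<Longrightarrow> field_subring (polys_at S)"
  using field_subring.ring_adjoin_singleton[of S x] field_subring_generate_ring[of "S \<union> {x}"]
  by (simp add: polys_at_def)

sublocale B: field_subring "polys_at A" by (rule field_subring_polys_at) (rule field_subring_axioms)

sublocale KX: field_subring "polys_at K" by (rule field_subring_polys_at) (rule K.field_subring_axioms)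

lemma poly_eq_iff_K: "p \<in> polys_over K \<Longrightarrow> r \<in> polys_over K \<Longrightarrow> poly p x = poly r x \<longleftrightarrow> p = r"
  using transcendental[unfolded transcendental_over_def, rule_format, of "p - r"] by auto

lemma polys_over_K: "p \<in> polys_over A \<Longrightarrow> p \<in> polys_over K"
  using polys_over_mono[OF subset_fractions] by blast

lemma polys_at_mono: "S \<subseteq> T \<Longrightarrow> polys_at S \<subseteq> polys_at T"
  unfolding polys_at_def using polys_over_mono by blast

lemma subset_polys_at: "0 \<in> S \<Longrightarrow> S \<subseteq> polys_at S"
proof
  fix a assume "0 \<in> S" "a \<in> S"
  then have "[:a:] \<in> polys_over S" by (auto simp: coeff_pCons split: nat.split)
  then show "a \<in> polys_at S" unfolding polys_at_def by (rule image_eqI[rotated]) simp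
qed

lemma mem_polys_at_iff: "S \<subseteq> K \<Longrightarrow> p \<in> polys_over K \<Longrightarrow> poly p x \<in> polys_at S \<longleftrightarrow> p \<in> polys_over S"
  unfolding polys_at_def using poly_eq_iff_K polys_over_mono[of S K] by (auto simp: image_iff)

lemma polys_at_inter: "S \<subseteq> K \<Longrightarrow> a \<in> K \<Longrightarrow> a \<in> polys_at S \<Longrightarrow> a \<in> S"
  using mem_polys_at_iff[of S "[:a:]"] polys_overD[of "[:a:]" S 0] by simp

lemma polys_at_subset: "polys_at A \<subseteq> polys_at K"
  by (intro polys_at_mono subset_fractions)

lemma KX_subset_fractions: "polys_at K \<subseteq> fractions (polys_at A)"
proof
  fix z assume "z \<in> polys_at K"
  then obtain p where p: "p \<in> polys_over K" "z = poly p x" by (auto simp: polys_at_def)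
  obtain d where d: "d \<in> A" "d \<noteq> 0" "\<And>i. i \<in> {..Polynomial.degree p} \<Longrightarrow> d * Polynomial.coeff p i \<in> A"
    using common_denominator[of "{..Polynomial.degree p}" "Polynomial.coeff p"] p by auto
  have "d * Polynomial.coeff p i \<in> A" for i
    using d(3)[of i] by (cases "i \<le> Polynomial.degree p") (auto simp: coeff_eq_0)
  then have "d * z \<in> polys_at A"
    unfolding polys_at_def p(2) by (intro image_eqI[of _ _ "Polynomial.smult d p"]) auto
  moreover have "d \<in> polys_at A" using d subset_polys_at[of A] by auto
  ultimately have "(d * z) / d \<in> fractions (polys_at A)" using d(2) by (intro fractionsI)
  then show "z \<in> fractions (polys_at A)" using d(2) by simp
qed

lemma K_subset_fractions: "K \<subseteq> fractions (polys_at A)"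
  using KX_subset_fractions subset_polys_at[of K] by auto

lemma fractions_KX: "fractions (polys_at K) = fractions (polys_at A)"
  by (intro equalityI KX.fractions_least B.field_subfield_fractions KX_subset_fractions
      fractions_mono polys_at_subset)

text \<open>Degrees add up, so a factor of a nonzero constant is constant. Used for
  \<open>S = A\<close> and for \<open>S = K\<close>.\<close>

lemma factor_closed_polys_at:
  assumes "field_subring S" "S \<subseteq> K"
  shows "factor_closed S (polys_at S)"
  unfolding factor_closed_def
proof (intro conjI ballI impI)
  interpret S: field_subring S by fact
  show "S \<subseteq> polys_at S" by (rule subset_polys_at) auto
  fix a b assume ab: "a \<in> polys_at S" "b \<in> polys_at S" "a * b \<in> S" "a * b \<noteq> 0"
  then obtain p r where pr: "p \<in> polys_over S" "a = poly p x" "r \<in> polys_over S" "b = poly r x"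
    by (auto simp: polys_at_def)
  have "p * r \<in> polys_over K" "[:a * b:] \<in> polys_over K"
    using pr ab assms polys_over_mono[OF assms(2)] by (auto simp del: K.polys_over_mult intro!: K.polys_over_mult)
  then have "p * r = [:a * b:]" using poly_eq_iff_K[of "p * r" "[:a * b:]"] pr by simp
  then have "Polynomial.degree (p * r) = 0" "p * r \<noteq> 0" using ab(4) by auto
  then have "Polynomial.degree p = 0" by (auto simp: degree_mult_eq)
  then obtain c where "p = [:c:]" by (auto elim: degree_eq_zeroE)
  then show "a \<in> S" using pr by auto
qed

text \<open>The Euclidean argument for fractional ideals: \<open>d\<close> clears denominators, and
  an element of least degree in \<open>d M\<close> divides all others.\<close>

lemma KX_submodule_principal:
  assumes M: "is_submodule (polys_at K) M" "m \<in> M" "m \<noteq> 0"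
    and d: "d \<noteq> 0" "\<And>y. y \<in> M \<Longrightarrow> d * y \<in> polys_at K"
  obtains h where "h \<in> M" "h \<noteq> 0" "M = (*) h ` polys_at K"
proof -
  define J where "J = {p \<in> polys_over K. p \<noteq> 0 \<and> poly p x \<in> (*) d ` M}"
  have sub: "is_submodule (polys_at K) ((*) d ` M)" by (rule is_submodule_scale[OF M(1)])
  obtain p where "p \<in> polys_over K" "d * m = poly p x" using d(2)[OF M(2)] by (auto simp: polys_at_def)
  moreover have "d * m \<in> (*) d ` M" using M(2) by blast
  ultimately have "p \<in> J" using M(3) d(1) by (auto simp: J_def)
  then obtain g where g: "g \<in> J" "\<And>p. p \<in> J \<Longrightarrow> Polynomial.degree g \<le> Polynomial.degree p"
    using arg_min_natI[of "\<lambda>p. p \<in> J" p Polynomial.degree] arg_min_nat_le[of "\<lambda>p. p \<in> J" _ Polynomial.degree]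
    by metis
  then obtain h where h: "h \<in> M" "poly g x = d * h" and gK: "g \<in> polys_over K" "g \<noteq> 0"
    by (auto simp: J_def)
  have "poly g x \<noteq> 0" using poly_eq_iff_K[of g 0] gK by auto
  then have h0: "h \<noteq> 0" using h by auto
  have "M \<subseteq> (*) h ` polys_at K"
  proof
    fix y assume y: "y \<in> M"
    obtain f where f: "f \<in> polys_over K" "d * y = poly f x" using d(2)[OF y] by (auto simp: polys_at_def)
    obtain k r where kr: "k \<in> polys_over K" "r \<in> polys_over K" "f = g * k + r"
        "r = 0 \<or> Polynomial.degree r < Polynomial.degree g"
      using K.polys_over_divmod[OF gK f(1)] by blast
    have kx: "poly k x \<in> polys_at K" using kr(1) by (auto simp: polys_at_def)
    have "d * y - poly k x * (d * h) \<in> (*) d ` M"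
      using KX.is_submodule_diff[OF sub, of "d * y"] is_submoduleD(3)[OF sub kx, of "d * h"] y h(1) by auto
    moreover have "poly r x = d * y - poly k x * (d * h)"
      using f(2) kr(3) h(2) by (simp add: mult.commute)
    ultimately have "r = 0"
      using kr(2,4) g(2)[of r] by (cases "r = 0") (auto simp: J_def)
    then have "d * y = d * (h * poly k x)" using f(2) kr(3) h(2) by (simp add: mult_ac)
    then have "y = h * poly k x" using d(1) by simp
    then show "y \<in> (*) h ` polys_at K" using kx by blast
  qed
  moreover have "(*) h ` polys_at K \<subseteq> M"
    using is_submoduleD(3)[OF M(1) _ h(1)] by (auto simp: mult.commute[of h])
  ultimately show ?thesis using that h(1) h0 by blast
qed

text \<open>The elements that multiply every \<open>c * z ^ n\<close> into \<open>K[x]\<close> form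
  a principal fractional ideal stable under \<open>z\<close>; cancelling its generator puts
  \<open>z\<close> in \<open>K[x]\<close>.\<close>

lemma completely_integrally_closed_KX:
  assumes "c \<in> polys_at K" "c \<noteq> 0" "\<And>n. c * z ^ n \<in> polys_at K"
  shows "z \<in> polys_at K"
proof -
  define M where "M = {y. \<forall>n. c * z ^ n * y \<in> polys_at K}"
  have "is_submodule (polys_at K) M"
    by (rule is_submoduleI) (auto simp: M_def distrib_left mult.left_commute)
  moreover have "1 \<in> M" using assms by (auto simp: M_def)
  moreover have "c * y \<in> polys_at K" if "y \<in> M" for y
    using that[unfolded M_def, simplified, rule_format, of 0] by simp
  ultimately obtain h where h: "h \<in> M" "h \<noteq> 0" "M = (*) h ` polys_at K"
    using KX_submodule_principal[of M 1 c] assms(2) by auto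
  have "c * z ^ n * (z * h) \<in> polys_at K" for n
    using h(1)[unfolded M_def, simplified, rule_format, of "Suc n"] by (simp add: mult_ac)
  then have "z * h \<in> M" by (simp add: M_def)
  then obtain k where "k \<in> polys_at K" "z * h = h * k" unfolding h(3) by auto
  then show ?thesis using h(2) by simp
qed

text \<open>Induction on the degree: subtracting the leading term preserves almost integrality.\<close>

lemma polys_over_almost_integral:
  assumes cic: "completely_integrally_closed A" and g: "g \<in> polys_over A" "g \<noteq> 0"
    and "f \<in> polys_over K" "\<And>n. g * f ^ n \<in> polys_over A"
  shows "f \<in> polys_over A"
proof -
  have "f \<in> polys_over A" if "f \<in> polys_over K" "\<And>n. g * f ^ n \<in> polys_over A"
    "\<forall>i\<ge>e. Polynomial.coeff f i = 0" for f e
    using that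
  proof (induction e arbitrary: f)
    case 0
    then have "f = 0" by (auto simp: poly_eq_iff)
    then show ?case by simp
  next
    case (Suc e)
    define a where "a = Polynomial.coeff f e"
    have "a \<in> A"
    proof (cases "a = 0")
      case False
      then have deg: "Polynomial.degree f = e"
        using Suc.prems(3) by (intro antisym degree_le le_degree) (auto simp: a_def Suc_le_eq)
      \<comment> \<open>The leading coefficients of \<open>g * f ^ n\<close> exhibit
        \<open>a\<close> as almost integral over \<open>A\<close>.\<close>
      have "Polynomial.lead_coeff (g * f ^ n) = Polynomial.lead_coeff g * a ^ n" for n
        by (simp add: lead_coeff_mult lead_coeff_power deg a_def)
      then have "Polynomial.lead_coeff g * a ^ n \<in> A" for n
        using polys_overD[OF Suc.prems(2)[of n]] by metis
      then show ?thesis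
        using completely_integrally_closedD[OF cic, of a "Polynomial.lead_coeff g"] g polys_overD[OF Suc.prems(1)]
        by (auto simp: a_def)
    qed simp
    define r where "r = f + Polynomial.monom (- a) e"
    \<comment> \<open>With \<open>a \<in> A\<close>, the binomial expansion expresses this through
      the products \<open>g * f ^ k\<close>, so \<open>r\<close> satisfies the same
      hypothesis.\<close>
    have "g * r ^ n \<in> polys_over A" for n
    proof -
      have "g * r ^ n = (\<Sum>k\<le>n. of_nat (n choose k) * (g * f ^ k) * Polynomial.monom (- a) e ^ (n - k))"
        unfolding r_def binomial_ring sum_distrib_left by (simp add: mult_ac)
      also have "\<dots> \<in> polys_over A"
      proof (rule polys_over_sum)
        fix k
        have "of_nat (n choose k) \<in> polys_over A" by (simp add: of_nat_poly)
        moreover have "Polynomial.monom (- a) e ^ (n - k) \<in> polys_over A" using \<open>a \<in> A\<close> by auto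
        ultimately show "of_nat (n choose k) * (g * f ^ k) * Polynomial.monom (- a) e ^ (n - k) \<in> polys_over A"
          by (rule polys_over_mult[OF polys_over_mult[OF _ Suc.prems(2)]])
      qed
      finally show ?thesis .
    qed
    moreover have "r \<in> polys_over K" using Suc.prems(1) \<open>a \<in> A\<close> by (simp add: r_def)
    moreover have "\<forall>i\<ge>e. Polynomial.coeff r i = 0"
      using Suc.prems(3) by (auto simp: r_def a_def)
    ultimately have "r \<in> polys_over A" using Suc.IH by blast
    moreover have "f = r + Polynomial.monom a e" by (simp add: r_def minus_monom[symmetric])
    ultimately show ?case using \<open>a \<in> A\<close> by simp
  qed
  from this[of f "Suc (Polynomial.degree f)"] show ?thesis
    using assms(4,5) by (auto simp: coeff_eq_0)
qed

text \<open>The principal ideal domain \<open>K[x]\<close> first turns the fraction \<open>z\<close>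
  into a polynomial over \<open>K\<close>; its coefficients are then treated one by one.\<close>

lemma completely_integrally_closed_adjoin:
  assumes "completely_integrally_closed A"
  shows "completely_integrally_closed (polys_at A)"
  unfolding completely_integrally_closed_def
proof (intro ballI impI)
  fix z c assume zc: "z \<in> fractions (polys_at A)" "c \<in> polys_at A - {0}" "\<forall>n. c * z ^ n \<in> polys_at A"
  then have "z \<in> polys_at K"
    using completely_integrally_closed_KX[of c z] polys_at_subset by blast
  then obtain f where f: "f \<in> polys_over K" "z = poly f x" by (auto simp: polys_at_def)
  obtain g where g: "g \<in> polys_over A" "c = poly g x" using zc(2) by (auto simp: polys_at_def)
  have "poly (g * f ^ n) x \<in> polys_at A" for n using zc(3) f(2) g(2) by simp
  then have "g * f ^ n \<in> polys_over A" for n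
    using mem_polys_at_iff[OF subset_fractions, of "g * f ^ n"] f(1) polys_over_K[OF g(1)] by blast
  then have "f \<in> polys_over A"
    using zc(2) g(2) by (intro polys_over_almost_integral[OF assms g(1) _ f(1)]) auto
  then show "z \<in> polys_at A" using f(2) by (auto simp: polys_at_def)
qed

lemma span_over_polys_at:
  assumes "is_submodule A I"
  shows "span_over (polys_at A) I = polys_at I"
proof
  note I = is_submoduleD[OF assms]
  show "span_over (polys_at A) I \<subseteq> polys_at I"
  proof (rule hull_minimal)
    show "I \<subseteq> polys_at I" by (rule subset_polys_at) (rule I)
    show "is_submodule (polys_at A) (polys_at I)"
    proof (rule is_submoduleI)
      show "0 \<in> polys_at I" unfolding polys_at_def using I(1) by (intro image_eqI[of _ _ 0]) auto
      fix y z assume "y \<in> polys_at I" "z \<in> polys_at I"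
      then obtain p r where "p \<in> polys_over I" "y = poly p x" "r \<in> polys_over I" "z = poly r x"
        by (auto simp: polys_at_def)
      then show "y + z \<in> polys_at I"
        unfolding polys_at_def using I(2) by (intro image_eqI[of _ _ "p + r"] polys_overI) auto
    next
      fix y z assume "y \<in> polys_at A" "z \<in> polys_at I"
      then obtain p r where "p \<in> polys_over A" "y = poly p x" "r \<in> polys_over I" "z = poly r x"
        by (auto simp: polys_at_def)
      then show "y * z \<in> polys_at I"
        unfolding polys_at_def using I(3)
        by (intro image_eqI[of _ _ "p * r"] polys_overI) (auto simp: coeff_mult intro!: is_submodule_sum[OF assms])
    qed
  qed
  show "polys_at I \<subseteq> span_over (polys_at A) I"
  proof
    fix z assume "z \<in> polys_at I"
    then obtain p where p: "p \<in> polys_over I" "z = poly p x" by (auto simp: polys_at_def)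
    have xi: "x ^ i \<in> polys_at A" for i
      unfolding polys_at_def by (intro image_eqI[of _ _ "Polynomial.monom 1 i"]) (auto simp: poly_monom)
    have "z = (\<Sum>i\<le>Polynomial.degree p. x ^ i * Polynomial.coeff p i)"
      by (simp add: p(2) poly_altdef mult.commute)
    also have "\<dots> \<in> span_over (polys_at A) I"
      using p(1) by (intro is_submodule_sum[OF is_submodule_span] is_submoduleD(3)[OF is_submodule_span] xi hull_inc) auto
    finally show "z \<in> span_over (polys_at A) I" .
  qed
qed

text \<open>The nonzero \<open>s\<close> confines the left side to \<open>K[x]\<close>, through
  \<open>z = (z * s) * inverse s\<close>; after that the condition is read off coefficientwise.
  Applied twice, it shows that hulls commute with polynomial extension.\<close>

lemma colon_polys_at:
  assumes S: "S \<subseteq> K" "s \<in> S" "s \<noteq> 0"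
  shows "colon (polys_at A) S = polys_at (colon A S)"
proof (intro equalityI subsetI)
  fix z assume z: "z \<in> colon (polys_at A) S"
  have "z * s \<in> polys_at K" using colonD(2)[OF z S(2)] polys_at_subset by blast
  moreover have "inverse s \<in> polys_at K" using S(1,2) K.inverse subset_polys_at[of K] by blast
  ultimately have "z * s * inverse s \<in> polys_at K" by (rule KX.mult)
  then have "z \<in> polys_at K" using S(3) by (simp add: mult.assoc)
  then obtain f where f: "f \<in> polys_over K" "z = poly f x" by (auto simp: polys_at_def)
  have "Polynomial.smult y f \<in> polys_over A" if y: "y \<in> S" for y
  proof -
    have "poly (Polynomial.smult y f) x \<in> polys_at A" using colonD(2)[OF z y] f(2) by (simp add: mult.commute)
    then show ?thesis
      using mem_polys_at_iff[OF subset_fractions, of "Polynomial.smult y f"] f(1) y S(1) by auto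
  qed
  then have "Polynomial.coeff f i \<in> colon A S" for i
    using f(1) by (intro colonI) (auto simp: mult.commute polys_over_def)
  then show "z \<in> polys_at (colon A S)" using f(2) by (auto simp: polys_at_def)
next
  fix z assume "z \<in> polys_at (colon A S)"
  then obtain f where f: "f \<in> polys_over (colon A S)" "z = poly f x" by (auto simp: polys_at_def)
  show "z \<in> colon (polys_at A) S"
  proof (rule colonI)
    show "z \<in> fractions (polys_at A)"
      using f polys_at_mono[OF colon_subset_fractions, of A S] KX_subset_fractions \<open>z \<in> polys_at (colon A S)\<close> by blast
    fix y assume y: "y \<in> S"
    have "Polynomial.smult y f \<in> polys_over A"
    proof (rule polys_overI)
      fix i show "Polynomial.coeff (Polynomial.smult y f) i \<in> A"
        using colonD(2)[OF polys_overD[OF f(1)] y, of i] by (simp add: mult.commute)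
    qed
    then show "z * y \<in> polys_at A"
      unfolding polys_at_def f(2) by (intro image_eqI[of _ _ "Polynomial.smult y f"]) auto
  qed
qed

lemma divisorial_hull_polys_at:
  assumes "bounded_in A S"
  shows "divisorial_hull (polys_at A) S = span_over (polys_at A) (divisorial_hull A S)"
proof -
  obtain s where S: "S \<subseteq> K" "s \<in> S" "s \<noteq> 0" using assms unfolding bounded_in_def by blast
  obtain t where T: "colon A S \<subseteq> K" "t \<in> colon A S" "t \<noteq> 0"
    using bounded_in_colon[OF assms] unfolding bounded_in_def by blast
  have "divisorial_hull (polys_at A) S = colon (polys_at A) (span_over (polys_at A) (colon A S))"
    unfolding divisorial_hull_def colon_polys_at[OF S] span_over_polys_at[OF is_submodule_colon] ..
  also have "\<dots> = polys_at (divisorial_hull A S)"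
    unfolding B.colon_span colon_polys_at[OF T] divisorial_hull_def ..
  also have "\<dots> = span_over (polys_at A) (divisorial_hull A S)"
    unfolding divisorial_hull_def by (rule span_over_polys_at[OF is_submodule_colon, symmetric])
  finally show ?thesis .
qed

lemma bounded_in_polys_at:
  assumes "bounded_in A S" shows "bounded_in (polys_at A) S"
proof -
  obtain s d where "S \<subseteq> K" "s \<in> S" "s \<noteq> 0" "d \<in> A" "d \<noteq> 0" "\<forall>s\<in>S. d * s \<in> A"
    using assms unfolding bounded_in_def by blast
  then show ?thesis
    using K_subset_fractions subset_polys_at[of A] by (intro bounded_inI[of _ _ s d]) auto
qed

lemma divisorial_span_over:
  assumes "divisorial A I"
  shows "divisorial (polys_at A) (span_over (polys_at A) I)"
  using B.divisorial_divisorial_hull[OF bounded_in_polys_at[OF divisorialD(2)[OF assms]]]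
    divisorial_hull_polys_at[OF divisorialD(2)[OF assms]] divisorialD(4)[OF assms] by simp

text \<open>Each extended ideal is the hull of the original one in \<open>A[x]\<close>, so it can be
  stripped from either factor, using commutativity for the second.\<close>

lemma divisorial_hull_set_prod_span:
  assumes "divisorial A I" "divisorial A J"
  shows "divisorial_hull (polys_at A) (set_prod (span_over (polys_at A) I) (span_over (polys_at A) J)) =
         span_over (polys_at A) (divisorial_hull A (set_prod I J))"
proof -
  note I = divisorialD[OF assms(1)] and J = divisorialD[OF assms(2)]
  have hull: "divisorial_hull (polys_at A) H = span_over (polys_at A) H" if "divisorial A H" for H
    using divisorial_hull_polys_at[OF divisorialD(2)[OF that]] divisorialD(4)[OF that] by simp
  have sub: "I \<subseteq> fractions (polys_at A)" "J \<subseteq> fractions (polys_at A)" "span_over (polys_at A) J \<subseteq> fractions (polys_at A)"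
    using I(3) J(3) K_subset_fractions divisorialD(3)[OF divisorial_span_over[OF assms(2)]] by auto
  have "divisorial_hull (polys_at A) (set_prod (span_over (polys_at A) I) (span_over (polys_at A) J)) =
      divisorial_hull (polys_at A) (set_prod I (span_over (polys_at A) J))"
    using sub by (subst hull[OF assms(1), symmetric]) (rule B.divisorial_hull_set_prod_left)
  also have "\<dots> = divisorial_hull (polys_at A) (set_prod (span_over (polys_at A) J) I)"
    by (subst set_prod_commute) simp
  also have "\<dots> = divisorial_hull (polys_at A) (set_prod J I)"
    using sub by (subst hull[OF assms(2), symmetric]) (rule B.divisorial_hull_set_prod_left)
  also have "\<dots> = span_over (polys_at A) (divisorial_hull A (set_prod J I))"
    using I J by (intro divisorial_hull_polys_at bounded_in_set_prod)
  finally show ?thesis by (subst set_prod_commute[of I]) simp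
qed

text \<open>A generator of \<open>I[x]\<close> divides a nonzero element of \<open>I\<close>, which
  is a constant of \<open>K[x]\<close>; so the generator is itself constant and generates
  \<open>I\<close>.\<close>

lemma principal_if_span_principal:
  assumes "divisorial A I" "span_over (polys_at A) I \<in> principal_divisors (polys_at A)"
  shows "I \<in> principal_divisors A"
proof -
  note I = divisorialD[OF assms(1)]
  obtain z where z: "z \<in> fractions (polys_at A)" "z \<noteq> 0" "polys_at I = (*) z ` polys_at A"
    using assms(2) unfolding span_over_polys_at[OF I(1)] by (rule B.principal_divisorsE)
  have I_sub: "I \<subseteq> polys_at I" by (intro subset_polys_at is_submoduleD(1)[OF I(1)])
  obtain i where i: "i \<in> I" "i \<noteq> 0" using I(2) unfolding bounded_in_def by blast
  have zI: "z \<in> polys_at I" unfolding z(3) by (rule image_eqI[of _ _ 1]) auto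
  have "i \<in> (*) z ` polys_at A" using i(1) I_sub z(3) by blast
  then obtain b where b: "b \<in> polys_at A" "i = z * b" by blast
  have "z \<in> K"
    using factor_closedD(1)[OF factor_closed_polys_at[OF K.field_subring_axioms subset_refl], of z b]
      zI b i I(3) polys_at_subset polys_at_mono[OF I(3)] by blast
  then have "z \<in> I" using polys_at_inter[OF I(3)] zI by blast
  have "I \<subseteq> (*) z ` A"
  proof
    fix u assume u: "u \<in> I"
    then obtain b where b: "b \<in> polys_at A" "u = z * b" using I_sub z(3) by blast
    then have "b = inverse z * u" using z(2) by simp
    then have "b \<in> K" using u I(3) \<open>z \<in> K\<close> by auto
    then show "u \<in> (*) z ` A" using polys_at_inter[OF subset_fractions] b by blast
  qed
  moreover have "(*) z ` A \<subseteq> I"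
    using is_submoduleD(3)[OF I(1) _ \<open>z \<in> I\<close>] by (auto simp: mult.commute[of z])
  ultimately show ?thesis using principal_divisorsI[OF \<open>z \<in> K\<close> z(2)] by simp
qed

lemma divisorial_eq_scale_span:
  assumes krull: "krull_domain A" and J: "divisorial (polys_at A) J"
  shows "\<exists>I z. divisorial A I \<and> z \<in> fractions (polys_at A) \<and> z \<noteq> 0 \<and> J = (*) z ` span_over (polys_at A) I"
proof -
  note J' = divisorialD[OF J]
  define M where "M = span_over (polys_at K) J"
  have Msub: "is_submodule (polys_at K) M" unfolding M_def by (rule is_submodule_span)
  obtain j d where jd: "j \<in> J" "j \<noteq> 0" "d \<noteq> 0" "\<forall>y\<in>J. d * y \<in> polys_at A"
    using J'(2) unfolding bounded_in_def by blast
  have "M \<subseteq> {y. d * y \<in> polys_at K}"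
    unfolding M_def using jd(4) polys_at_subset
    by (intro hull_minimal is_submoduleI) (auto simp: distrib_left mult.left_commute[of d])
  then obtain h where h: "h \<in> M" "h \<noteq> 0" "M = (*) h ` polys_at K"
    using KX_submodule_principal[OF Msub, of j d] jd hull_inc[of j J] unfolding M_def by blast
  have "M \<subseteq> fractions (polys_at A)"
    unfolding M_def using J'(3) KX.is_submodule_fractions by (intro hull_minimal) (simp_all add: fractions_KX)
  then have hK: "h \<in> fractions (polys_at A)" using h(1) by blast
  \<comment> \<open>After division by \<open>h\<close> the ideal \<open>J0\<close> generates all of
    \<open>K[x]\<close>. As \<open>1\<close> then lies in its span, every element of the colon is a
    polynomial over \<open>K\<close>.\<close>
  define J0 where "J0 = (*) (inverse h) ` J"
  have J0: "divisorial (polys_at A) J0"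
    unfolding J0_def using hK h(2) J by (intro B.divisorial_scale B.fractions_inverse) auto
  have span0: "span_over (polys_at K) J0 = polys_at K"
    unfolding J0_def using h by (simp add: span_over_scale image_image flip: M_def mult.assoc)
  then have J0_KX: "J0 \<subseteq> polys_at K" using hull_subset[of J0] by blast
  have colon_KX: "colon (polys_at A) J0 \<subseteq> polys_at K"
  proof
    fix z assume z: "z \<in> colon (polys_at A) J0"
    have "span_over (polys_at K) J0 \<subseteq> {y. z * y \<in> polys_at K}"
      using colonD(2)[OF z] polys_at_subset
      by (intro hull_minimal is_submoduleI) (auto simp: distrib_left mult.left_commute[of z])
    then show "z \<in> polys_at K" unfolding span0 using KX.one by force
  qed
  \<comment> \<open>The coefficients in \<open>S\<close> come from the colon of \<open>J0\<close>,
    not from \<open>J0\<close>: as \<open>J0\<close> is the colon of that colon, membership means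
    \<open>f * u \<in> A[x]\<close> for all \<open>u \<in> U\<close>, which Gauss' lemma splits into
    products of coefficients.\<close>
  define U where "U = {u \<in> polys_over K. poly u x \<in> colon (polys_at A) J0}"
  define S where "S = {Polynomial.coeff u i | u i. u \<in> U}"
  have mem_J0: "poly f x \<in> J0 \<longleftrightarrow> f \<in> polys_over (colon A S)" if f: "f \<in> polys_over K" for f
  proof
    assume fJ: "poly f x \<in> J0"
    have "Polynomial.coeff f i * s \<in> A" if "s \<in> S" for i s
    proof -
      from that obtain u k where u: "u \<in> U" "s = Polynomial.coeff u k" by (auto simp: S_def)
      then have "poly u x * poly f x \<in> polys_at A" using fJ by (auto simp: U_def dest: colonD)
      then have "f * u \<in> polys_over A"
        using mem_polys_at_iff[OF subset_fractions, of "f * u"] f u by (auto simp: U_def mult.commute)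
      then show ?thesis
        using krull_domain_coeff_mult[OF krull f] u by (auto simp: U_def)
    qed
    then show "f \<in> polys_over (colon A S)" using f by (auto intro!: colonI)
  next
    assume fS: "f \<in> polys_over (colon A S)"
    have "poly f x \<in> colon (polys_at A) (colon (polys_at A) J0)"
    proof (rule colonI)
      show "poly f x \<in> fractions (polys_at A)" using f KX_subset_fractions by (auto simp: polys_at_def)
      fix y assume y: "y \<in> colon (polys_at A) J0"
      then obtain u where u: "u \<in> polys_over K" "y = poly u x" using colon_KX by (auto simp: polys_at_def)
      then have "u \<in> U" using y by (auto simp: U_def)
      then have "Polynomial.coeff f i * Polynomial.coeff u k \<in> A" for i k
        using fS by (auto simp: S_def dest!: polys_overD colonD(2))
      then have "f * u \<in> polys_over A" by (intro polys_overI) (auto simp: coeff_mult intro!: sum)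
      then show "poly f x * y \<in> polys_at A"
        unfolding polys_at_def u(2) by (intro image_eqI[of _ _ "f * u"]) auto
    qed
    then show "poly f x \<in> J0" using divisorialD(4)[OF J0] by (simp add: divisorial_hull_def)
  qed
  \<comment> \<open>Some element of \<open>J0\<close> has a nonzero coefficient; it lies in
    \<open>A : S\<close>, so its numerator \<open>a\<close> is a common denominator for
    \<open>S\<close>.\<close>
  have "bounded_in A S"
  proof -
    have SK: "S \<subseteq> K" by (auto simp: S_def U_def)
    obtain y where y: "y \<in> colon (polys_at A) J0" "y \<noteq> 0"
      using B.bounded_in_colon[OF divisorialD(2)[OF J0]] unfolding bounded_in_def by blast
    then obtain u where u: "u \<in> polys_over K" "y = poly u x" using colon_KX by (auto simp: polys_at_def)
    then obtain i where i: "Polynomial.coeff u i \<noteq> 0" using y(2) by (auto simp: poly_eq_iff) (metis poly_0 poly_eqI coeff_0)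
    obtain y' where y': "y' \<in> J0" "y' \<noteq> 0" using divisorialD(2)[OF J0] unfolding bounded_in_def by blast
    then obtain f where f: "f \<in> polys_over K" "y' = poly f x" using J0_KX by (auto simp: polys_at_def)
    then obtain k where k: "Polynomial.coeff f k \<noteq> 0" using y'(2) by (auto simp: poly_eq_iff) (metis poly_0 poly_eqI coeff_0)
    obtain a b where ab: "a \<in> A" "b \<in> A" "b \<noteq> 0" "Polynomial.coeff f k = a / b"
      using polys_overD[OF f(1), of k] by (rule fractionsE)
    have "Polynomial.coeff f k \<in> colon A S" using mem_J0[OF f(1)] y'(1) f(2) by auto
    then have "a * s \<in> A" if "s \<in> S" for s
      using colonD(2)[OF _ that, of "Polynomial.coeff f k"] ab mult[of b "Polynomial.coeff f k * s"] by simp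
    then show ?thesis
      using SK i k u y ab by (intro bounded_inI[of _ _ "Polynomial.coeff u i" a]) (auto simp: S_def U_def)
  qed
  then have "divisorial A (colon A S)" by (rule divisorial_colon)
  moreover have "J0 = span_over (polys_at A) (colon A S)"
    unfolding span_over_polys_at[OF is_submodule_colon]
  proof (intro equalityI subsetI)
    fix y assume y: "y \<in> J0"
    then obtain f where f: "f \<in> polys_over K" "y = poly f x" using J0_KX by (auto simp: polys_at_def)
    then show "y \<in> polys_at (colon A S)" using mem_J0[OF f(1)] y by (auto simp: polys_at_def)
  next
    fix y assume "y \<in> polys_at (colon A S)"
    then obtain f where "f \<in> polys_over (colon A S)" "y = poly f x" by (auto simp: polys_at_def)
    then show "y \<in> J0" using mem_J0[of f] polys_over_mono[OF colon_subset_fractions, of A S] by auto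
  qed
  moreover have "J = (*) h ` J0" unfolding J0_def using h(2) by (simp add: image_image flip: mult.assoc)
  ultimately show ?thesis using hK h(2) by blast
qed

lemma divisor_extension_adjoin:
  assumes "krull_domain A"
  shows "divisor_extension A (polys_at A)"
  unfolding divisor_extension_def
  using subset_polys_at[of A] divisorial_span_over divisorial_hull_set_prod_span
    principal_if_span_principal divisorial_eq_scale_span[OF assms]
  by (intro conjI allI impI) simp_all

end

section \<open>Properties carried along a tower of polynomial rings over a field\<close>

definition noetherian_normal :: "'a::field set \<Rightarrow> bool" where
  "noetherian_normal A \<longleftrightarrow>
     field_subring A \<and> acc_submodules A A \<and> completely_integrally_closed A"

lemma noetherian_normalD:
  assumes "noetherian_normal A"
  shows "field_subring A" "acc_submodules A A" "completely_integrally_closed A" "krull_domain A"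
  using assms field_subring.krull_domain_if_noetherian by (auto simp: noetherian_normal_def)

theorem noetherian_normal_adjoin:
  assumes "noetherian_normal A" "transcendental_over (fractions A) x"
  shows "noetherian_normal (ring_adjoin A {x})" "divisor_extension A (ring_adjoin A {x})"
    "factor_closed A (ring_adjoin A {x})"
proof -
  note A = noetherian_normalD[OF assms(1)]
  interpret transcendental_extension A x
    using A(1) assms(2) by (simp add: transcendental_extension_def transcendental_extension_axioms_def)
  show "noetherian_normal (ring_adjoin A {x})"
    using A acc_submodules_adjoin[OF A(2), of x] completely_integrally_closed_adjoin[OF A(3)] B.field_subring_axioms
    unfolding noetherian_normal_def ring_adjoin_eq by blast
  show "divisor_extension A (ring_adjoin A {x})"
    unfolding ring_adjoin_eq by (rule divisor_extension_adjoin[OF A(4)])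
  show "factor_closed A (ring_adjoin A {x})"
    unfolding ring_adjoin_eq by (rule factor_closed_polys_at[OF A(1) subset_fractions])
qed

text \<open>Triviality of the class group expressed on ideals; this is the source of greatest common
  divisors.\<close>

definition class_trivial :: "'a::field set \<Rightarrow> bool" where
  "class_trivial A \<longleftrightarrow> (\<forall>I. divisorial A I \<longrightarrow> I \<in> principal_divisors A)"

lemma class_trivial_extension:
  assumes "field_subring A" "field_subring B" "divisor_extension A B" "class_trivial A"
  shows "class_trivial B"
  unfolding class_trivial_def
proof (intro allI impI)
  interpret A: field_subring A by fact
  interpret B: field_subring B by fact
  have sub: "A \<subseteq> B" by (rule divisor_extensionD(1)[OF assms(3)])
  fix J assume "divisorial B J"
  then obtain I z where I: "divisorial A I" "z \<in> fractions B" "z \<noteq> 0" "J = (*) z ` span_over B I"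
    using divisor_extensionD(5)[OF assms(3)] by blast
  then obtain u where u: "u \<in> fractions A" "u \<noteq> 0" "I = (*) u ` A"
    using assms(4) A.principal_divisorsE unfolding class_trivial_def by metis
  have "span_over B A = B"
  proof
    show "span_over B A \<subseteq> B" by (rule hull_minimal) (fact sub, rule B.is_submodule_self)
    have "1 \<in> span_over B A" by (intro hull_inc) simp
    from is_submoduleD(3)[OF is_submodule_span _ this] show "B \<subseteq> span_over B A" by fastforce
  qed
  then have "J = (*) (z * u) ` B"
    unfolding I(4) u(3) using u(2) by (simp add: span_over_scale image_image mult.assoc)
  then show "J \<in> principal_divisors B"
    using I u fractions_mono[OF sub] by (auto intro!: B.principal_divisorsI B.fractions_mult)
qed

lemma (in field_subfield) is_submodule_field:
  assumes "is_submodule A M" "M \<subseteq> A" "M \<noteq> {0}" shows "M = A"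
proof -
  obtain u where u: "u \<in> M" "u \<noteq> 0" using assms is_submoduleD(1)[OF assms(1)] by blast
  have "a \<in> M" if "a \<in> A" for a
    using is_submoduleD(3)[OF assms(1) _ u(1), of "a / u"] that u assms(2) by auto
  then show ?thesis using assms(2) by blast
qed

lemma (in field_subfield) acc_submodules_field: "acc_submodules A A"
  unfolding acc_submodules_def
proof (intro allI impI)
  fix C assume C: "\<forall>n. is_submodule A (C n) \<and> C n \<subseteq> A \<and> C n \<subseteq> C (Suc n)"
  have mono: "C i \<subseteq> C k" if "i \<le> k" for i k
    using lift_Suc_mono_le[of C i k] that C by auto
  show "\<exists>n. \<forall>k\<ge>n. C k = C n"
  proof (cases "\<forall>n. C n = {0}")
    case False
    then obtain n where n: "C n \<noteq> {0}" by blast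
    have "C k = A" if "k \<ge> n" for k
    proof (rule is_submodule_field)
      have "0 \<in> C n" using C is_submoduleD(1) by blast
      then show "C k \<noteq> {0}" using n mono[OF that] by blast
    qed (use C in auto)
    then show ?thesis by (metis order_refl)
  qed auto
qed

lemma (in field_subfield) noetherian_normal_field: "noetherian_normal A"
  unfolding noetherian_normal_def completely_integrally_closed_def fractions_eq
  using acc_submodules_field field_subring_axioms by blast

lemma (in field_subfield) class_trivial_field: "class_trivial A"
  unfolding class_trivial_def
proof (intro allI impI)
  fix I assume "divisorial A I"
  note I = divisorialD[OF this]
  have "I \<noteq> {0}" using I(2) by (auto simp: bounded_in_def)
  then have "I = (*) 1 ` A" using is_submodule_field[OF I(1)] I(3) by (simp add: fractions_eq)
  then show "I \<in> principal_divisors A" using principal_divisorsI[of 1] by auto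
qed

section \<open>Divisibility when all divisorial ideals are principal\<close>

context field_subring
begin

text \<open>With \<open>A : S = z A\<close>, the gcd is \<open>e = inverse z\<close>. The last
  clause determines the whole colon by \<open>e\<close>, which says more than that common divisors
  divide \<open>e\<close>.\<close>

lemma class_trivial_gcd:
  assumes "class_trivial A" "S \<subseteq> A" "s \<in> S" "s \<noteq> 0"
  obtains e where "e \<in> A" "e \<noteq> 0" "\<forall>s\<in>S. s / e \<in> A"
    "\<forall>z\<in>fractions A. (\<forall>s\<in>S. z * s \<in> A) \<longrightarrow> z * e \<in> A"
proof -
  have "divisorial A (colon A S)" by (intro divisorial_colon bounded_in_insert_ring[OF assms(2-4)])
  then obtain z where z: "z \<in> fractions A" "z \<noteq> 0" "colon A S = (*) z ` A"
    using assms(1) principal_divisorsE unfolding class_trivial_def by metis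
  have "1 \<in> colon A S" using assms(2) by (intro colonI) auto
  then obtain e where e: "e \<in> A" "1 = z * e" using z(3) by auto
  then have e': "e \<noteq> 0" "z = inverse e"
    using z(2) inverse_unique[of e z] by (auto simp: mult.commute)
  have "z \<in> colon A S" unfolding z(3) by (rule image_eqI[of _ _ 1]) auto
  then have "s / e \<in> A" if "s \<in> S" for s
    using colonD(2)[of z A S s] that e'(2) by (simp add: divide_inverse mult.commute)
  moreover have "u * e \<in> A" if "u \<in> fractions A" "\<And>s. s \<in> S \<Longrightarrow> u * s \<in> A" for u
  proof -
    have "u \<in> colon A S" using that by (intro colonI)
    then show ?thesis unfolding z(3) e'(2) using e'(1) by (auto simp: field_simps)
  qed
  ultimately show ?thesis by (intro that[OF e(1) e'(1)]) simp_all
qed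

text \<open>For coprime \<open>S\<close> the gcd is a unit, hence \<open>A : S = A\<close>. Euclid's
  lemma and the uniqueness of reduced representations both reduce to this.\<close>

lemma gcd_one_colon:
  assumes "class_trivial A" "gcd_one A S" "S \<subseteq> A" "s \<in> S" "s \<noteq> 0"
    "z \<in> fractions A" "\<And>s. s \<in> S \<Longrightarrow> z * s \<in> A"
  shows "z \<in> A"
proof -
  obtain e where e: "e \<in> A" "e \<noteq> 0" "\<forall>s\<in>S. s / e \<in> A"
      "\<forall>z\<in>fractions A. (\<forall>s\<in>S. z * s \<in> A) \<longrightarrow> z * e \<in> A"
    by (rule class_trivial_gcd[OF assms(1,3-5)])
  have "\<exists>d\<in>A. s = e * d" if "s \<in> S" for s
    using e(2,3) that by (intro bexI[of _ "s / e"]) auto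
  then obtain u where u: "u \<in> A" "e * u = 1" using assms(2) e(1) unfolding gcd_one_iff by blast
  have "z = (z * e) * u" using u(2) by (simp add: mult.assoc)
  also have "\<dots> \<in> A" using e(4) assms(6,7) u(1) by blast
  finally show ?thesis .
qed

lemma reduced_fraction:
  assumes "class_trivial A" "finite I" "\<And>i. i \<in> I \<Longrightarrow> f i \<in> fractions A"
  obtains d a where "d \<in> A" "d \<noteq> 0" "\<forall>i\<in>I. a i \<in> A" "\<forall>i\<in>I. f i = a i / d"
    "gcd_one A (insert d (a ` I))"
proof -
  obtain b where b: "b \<in> A" "b \<noteq> 0" "\<And>i. i \<in> I \<Longrightarrow> b * f i \<in> A"
    using common_denominator[of I f, OF assms(2,3)] by blast
  let ?S = "insert b ((\<lambda>i. b * f i) ` I)"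
  have S: "?S \<subseteq> A" "b \<in> ?S" using b by auto
  obtain e where e: "e \<in> A" "e \<noteq> 0" "\<forall>s\<in>?S. s / e \<in> A"
      "\<forall>z\<in>fractions A. (\<forall>s\<in>?S. z * s \<in> A) \<longrightarrow> z * e \<in> A"
    by (rule class_trivial_gcd[OF assms(1) S b(2)])
  show ?thesis
  proof (rule that)
    show "b / e \<in> A" using e(3) by auto
    show "b / e \<noteq> 0" using b e by auto
    show "\<forall>i\<in>I. b * f i / e \<in> A" using e(3) by auto
    show "\<forall>i\<in>I. f i = (b * f i / e) / (b / e)" using b e by simp
    \<comment> \<open>A further common divisor \<open>c\<close> would put
      \<open>inverse (c * e)\<close> in the colon of \<open>?S\<close>; the clause on
      \<open>e\<close> then gives \<open>inverse c \<in> A\<close>.\<close>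
    show "gcd_one A (insert (b / e) ((\<lambda>i. b * f i / e) ` I))"
      unfolding gcd_one_iff
    proof (intro ballI impI)
      fix c assume c: "c \<in> A" "\<forall>s\<in>insert (b / e) ((\<lambda>i. b * f i / e) ` I). \<exists>d\<in>A. s = c * d"
      then have c0: "c \<noteq> 0" using b(2) e(2) by auto
      have div: "\<exists>d\<in>A. s / e = c * d" if "s \<in> ?S" for s using that c(2) by auto
      have "inverse (c * e) * s \<in> A" if s: "s \<in> ?S" for s
      proof -
        obtain d where "d \<in> A" "s / e = c * d" using div[OF s] by blast
        then have "inverse (c * e) * s = d" using c0 e(2) by (simp add: field_simps)
        then show ?thesis using \<open>d \<in> A\<close> by simp
      qed
      moreover have "inverse (c * e) \<in> fractions A" using c(1) e(1) by (intro fractions_inverse) auto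
      ultimately have "inverse (c * e) * e \<in> A" using e(4) by blast
      then have "inverse c \<in> A" using e(2) c0 by (simp add: field_simps)
      then show "\<exists>d\<in>A. c * d = 1" using c0 by (intro bexI[of _ "inverse c"]) auto
    qed
  qed
qed

section \<open>Coprimality and power-freeness\<close>

lemma gcd_one_subst:
  assumes "gcd_one A {a, b}" "\<And>d. d \<in> A \<Longrightarrow> \<exists>u\<in>A. c = d * u \<Longrightarrow> \<exists>u\<in>A. a = d * u"
  shows "gcd_one A {c, b}"
  using assms unfolding gcd_one_iff by blast

lemma gcd_one_dvd:
  assumes "gcd_one A {a, b}" "a \<in> A" "c \<in> A" "a = c * d" "d \<in> A"
  shows "gcd_one A {c, b}"
  by (rule gcd_one_subst[OF assms(1)]) (use assms in \<open>auto simp: mult.assoc\<close>)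

text \<open>The fraction \<open>c / b\<close> sends \<open>a\<close> to \<open>d\<close> and
  \<open>b\<close> to \<open>c\<close>, so it multiplies a coprime pair into
  \<open>A\<close>.\<close>

lemma euclid_lemma:
  assumes "class_trivial A" "gcd_one A {a, b}" "a \<in> A" "b \<in> A" "b \<noteq> 0" "c \<in> A" "a * c = b * d" "d \<in> A"
  shows "\<exists>k\<in>A. c = b * k"
proof -
  have "c / b * s \<in> A" if "s \<in> {a, b}" for s
    using that assms(4-8) by (auto simp: mult.commute)
  moreover have "{a, b} \<subseteq> A" "b \<in> {a, b}" "c / b \<in> fractions A"
    using assms(3-6) by (auto intro: fractionsI)
  ultimately have "c / b \<in> A" by (intro gcd_one_colon[OF assms(1,2) _ _ assms(5), of "c / b"])
  moreover have "c = b * (c / b)" using assms(5) by simp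
  ultimately show ?thesis by (rule bexI[rotated])
qed

lemma gcd_one_mult:
  assumes "class_trivial A" "gcd_one A {a, c}" "gcd_one A {b, c}" "a \<in> A" "b \<in> A" "c \<in> A" "c \<noteq> 0"
  shows "gcd_one A {a * b, c}"
  unfolding gcd_one_iff
proof (intro ballI impI)
  fix d assume d: "d \<in> A" "\<forall>s\<in>{a * b, c}. \<exists>u\<in>A. s = d * u"
  obtain u where u: "u \<in> A" "a * b = d * u" using bspec[OF d(2), of "a * b"] by auto
  obtain v where v: "v \<in> A" "c = d * v" using bspec[OF d(2), of c] by auto
  note uv = u v
  have d0: "d \<noteq> 0" using uv(4) assms(7) by auto
  have "gcd_one A {d, a}"
    using gcd_one_dvd[of c a d v] assms(2,6) d(1) uv by (simp add: insert_commute)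
  then have "\<exists>k\<in>A. b = d * k"
    using euclid_lemma[OF assms(1), of a d b u] assms(4,5) d(1) d0 uv by (simp add: insert_commute)
  then show "\<exists>u\<in>A. d * u = 1" using assms(3) d(1) uv(3,4) unfolding gcd_one_iff by blast
qed

lemma gcd_one_one: "gcd_one A {1, c}"
  by (auto simp: gcd_one_iff)

lemma gcd_one_power:
  assumes "class_trivial A" "gcd_one A {a, c}" "a \<in> A" "c \<in> A" "c \<noteq> 0"
  shows "gcd_one A {a ^ n, c}"
  by (induction n) (auto simp: gcd_one_one intro!: gcd_one_mult assms)

lemma gcd_one_prod:
  assumes "class_trivial A" "\<And>i. i \<in> I \<Longrightarrow> gcd_one A {f i, c}" "\<And>i. i \<in> I \<Longrightarrow> f i \<in> A" "c \<in> A" "c \<noteq> 0"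
  shows "gcd_one A {\<Prod>i\<in>I. f i, c}"
  using assms(2,3)
  by (induction I rule: infinite_finite_induct) (auto simp: gcd_one_one intro!: gcd_one_mult assms(1,4,5))

lemma gcd_one_self: "gcd_one A {a, a} \<Longrightarrow> a \<in> A \<Longrightarrow> \<exists>u\<in>A. a * u = 1"
  unfolding gcd_one_iff using one by force

text \<open>If \<open>s\<close> is coprime to every \<open>Q l\<close>, it is coprime to the product
  it divides. Otherwise a common nonunit \<open>g\<close> of \<open>s\<close> and some
  \<open>Q l = g * h\<close> is split off: squarefreeness makes \<open>h\<close> coprime to
  \<open>g\<close>, and after cancelling \<open>g ^ e l\<close> the cofactor, coprime to
  \<open>g\<close>, is still divisible by \<open>g\<close>.\<close>

lemma dvd_prod_powers_unit:
  assumes triv: "class_trivial A"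
    and Q: "\<And>l. l \<in> I \<Longrightarrow> Q l \<in> A" "\<And>l. l \<in> I \<Longrightarrow> power_free 2 A (Q l)"
    and coprime: "\<And>k l. k \<in> I \<Longrightarrow> l \<in> I \<Longrightarrow> k \<noteq> l \<Longrightarrow> gcd_one A {Q k, Q l}"
    and e: "\<And>l. l \<in> I \<Longrightarrow> e l < m" and fin: "finite I"
    and s: "s \<in> A" "d \<in> A" "(\<Prod>l\<in>I. Q l ^ e l) = s ^ m * d" and m: "m > 0"
  shows "\<exists>u\<in>A. s * u = 1"
proof -
  have Q0: "Q l \<noteq> 0" if "l \<in> I" for l
    using power_free_nonzero[OF Q(2)[OF that] field_subring_axioms] by simp
  have prod0: "(\<Prod>l\<in>I. Q l ^ e l) \<noteq> 0" using Q0 fin by auto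
  have s0: "s \<noteq> 0" using s(3) prod0 m by auto
  show ?thesis
  proof (cases "\<forall>l\<in>I. gcd_one A {Q l, s}")
    case True
    then have cop: "gcd_one A {\<Prod>l\<in>I. Q l ^ e l, s}"
      using Q s s0 by (intro gcd_one_prod gcd_one_power triv) auto
    have eq: "(\<Prod>l\<in>I. Q l ^ e l) = s * (s ^ (m - 1) * d)"
      unfolding s(3) using m by (cases m) auto
    have mem: "(\<Prod>l\<in>I. Q l ^ e l) \<in> A" "s ^ (m - 1) * d \<in> A" using s(1,2) Q by (auto intro!: prod)
    have "gcd_one A {s, s}" by (rule gcd_one_dvd[OF cop mem(1) s(1) eq mem(2)])
    then show ?thesis using s(1) by (rule gcd_one_self)
  next
    case False
    then obtain l where l: "l \<in> I" "\<not> gcd_one A {Q l, s}" by blast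
    obtain g where g': "g \<in> A" "\<not> (\<exists>u\<in>A. g * u = 1)" "\<forall>a\<in>{Q l, s}. \<exists>d\<in>A. a = g * d"
      using l(2) unfolding gcd_one_iff by blast
    obtain h where h: "h \<in> A" "Q l = g * h" using bspec[OF g'(3), of "Q l"] by auto
    obtain k where k: "k \<in> A" "s = g * k" using bspec[OF g'(3), of s] by auto
    note g = g'(1,2) h k
    have g0: "g \<noteq> 0" "h \<noteq> 0" using g(4) Q0[OF l(1)] by auto
    have gh: "gcd_one A {h, g}"
      unfolding gcd_one_iff
    proof (intro ballI impI)
      fix c assume c: "c \<in> A" "\<forall>s\<in>{h, g}. \<exists>d\<in>A. s = c * d"
      obtain a where "a \<in> A" "h = c * a" using bspec[OF c(2), of h] by auto
      moreover obtain b where "b \<in> A" "g = c * b" using bspec[OF c(2), of g] by auto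
      ultimately have "a * b \<in> A" "Q l = c ^ 2 * (a * b)" using g(4) by (auto simp: power2_eq_square mult_ac)
      then show "\<exists>d\<in>A. c * d = 1" using Q(2)[OF l(1)] c(1) unfolding power_free_iff by blast
    qed
    let ?P = "\<Prod>k\<in>I - {l}. Q k ^ e k"
    have P: "?P \<in> A" using Q by (auto intro!: prod)
    have "gcd_one A {?P, g}"
    proof (intro gcd_one_prod gcd_one_power triv)
      fix k assume k: "k \<in> I - {l}"
      then have "gcd_one A {Q l, Q k}" using coprime l(1) by blast
      then have "gcd_one A {g, Q k}" using g Q(1)[OF l(1)] by (intro gcd_one_dvd[of "Q l" "Q k" g h])
      then show "gcd_one A {Q k, g}" by (simp add: insert_commute)
    qed (use Q g g0 in auto)
    moreover have "gcd_one A {h ^ e l, g}" by (intro gcd_one_power triv gh g g0)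
    ultimately have cop: "gcd_one A {?P * h ^ e l, g}" using P g g0 by (intro gcd_one_mult triv) auto
    have "g ^ e l * (?P * h ^ e l) = (\<Prod>l\<in>I. Q l ^ e l)"
      using l(1) fin g(4) by (subst prod.remove[of _ l]) (auto simp: power_mult_distrib mult_ac)
    also have "\<dots> = g ^ e l * (g ^ (m - e l) * k ^ m * d)"
      using s(3) g(6) e[OF l(1)] by (simp add: power_mult_distrib mult.assoc flip: power_add mult.assoc)
    \<comment> \<open>Here \<open>e l < m\<close> matters: a positive power of \<open>g\<close>
      survives the cancellation.\<close>
    finally have "?P * h ^ e l = g ^ (m - e l) * k ^ m * d" using g0 by simp
    also have "\<dots> = g * (g ^ (m - e l - 1) * k ^ m * d)"
      using e[OF l(1)] by (cases "m - e l") (auto simp: mult_ac)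
    finally have eq: "?P * h ^ e l = g * (g ^ (m - e l - 1) * k ^ m * d)" .
    have mem: "?P * h ^ e l \<in> A" "g ^ (m - e l - 1) * k ^ m * d \<in> A" using g s P by auto
    have "gcd_one A {g, g}" by (rule gcd_one_dvd[OF cop mem(1) g(1) eq mem(2)])
    then show ?thesis using g(1,2) gcd_one_self by blast
  qed
qed

text \<open>
  The coefficient bound behind the integral basis: a denominator \<open>s\<close> of \<open>\<beta>\<close> would satisfy
  \<open>s\<^sup>m dvd (\<Prod>l\<in>I. Q l ^ e l)\<close>, which is \<open>m\<close>-th-power-free.
\<close>

lemma mem_ring_if_power_mult_prod:
  assumes triv: "class_trivial A"
    and Q: "\<And>l. l \<in> I \<Longrightarrow> Q l \<in> A" "\<And>l. l \<in> I \<Longrightarrow> power_free 2 A (Q l)"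
    and coprime: "\<And>k l. k \<in> I \<Longrightarrow> l \<in> I \<Longrightarrow> k \<noteq> l \<Longrightarrow> gcd_one A {Q k, Q l}"
    and e: "\<And>l. l \<in> I \<Longrightarrow> e l < m" and fin: "finite I"
    and \<beta>: "\<beta> \<in> fractions A" "\<beta> ^ m * (\<Prod>l\<in>I. Q l ^ e l) \<in> A" and m: "m > 0"
  shows "\<beta> \<in> A"
proof -
  let ?u = "\<Prod>l\<in>I. Q l ^ e l"
  have u: "?u \<in> A" using Q by (auto intro!: prod)
  obtain s a where sa: "s \<in> A" "s \<noteq> 0" "a \<in> A" "\<beta> = a / s" "gcd_one A {s, a}"
  proof -
    obtain d a where "d \<in> A" "d \<noteq> 0" "\<forall>i\<in>{()}. a i \<in> A" "\<forall>i\<in>{()}. \<beta> = a i / d"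
        "gcd_one A (insert d (a ` {()}))"
      using reduced_fraction[OF triv, of "{()}" "\<lambda>_. \<beta>"] \<beta>(1) by blast
    then show thesis by (intro that[of d "a ()"]) auto
  qed
  have "gcd_one A {a ^ m, s}"
    using sa by (intro gcd_one_power triv) (auto simp: insert_commute)
  then have "\<exists>k\<in>A. ?u = s ^ m * k"
  proof (cases "a = 0")
    case False
    assume "gcd_one A {a ^ m, s}"
    then have "gcd_one A {s ^ m, a ^ m}"
      using sa False by (intro gcd_one_power triv) (auto simp: insert_commute)
    then have g: "gcd_one A {a ^ m, s ^ m}" by (simp add: insert_commute)
    have eq: "a ^ m * ?u = s ^ m * (\<beta> ^ m * ?u)" using sa by (simp add: power_divide)
    have "s ^ m \<noteq> 0" using sa(2) by simp
    from euclid_lemma[OF triv g power[OF sa(3)] power[OF sa(1)] this u eq \<beta>(2)] show ?thesis .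
  next
    case True
    \<comment> \<open>For \<open>a = 0\<close> the power lemma, which asks for a nonzero second
      entry, does not apply; but \<open>s\<close> divides both \<open>s\<close> and
      \<open>0\<close>, so it is a unit.\<close>
    then have "gcd_one A {s, 0}" using sa(5) by simp
    then obtain v where v: "v \<in> A" "s * v = 1" using sa(1) zero one unfolding gcd_one_iff by force
    then have "?u = s ^ m * (v ^ m * ?u)" by (simp flip: mult.assoc power_mult_distrib)
    then show ?thesis using u v by (intro bexI[of _ "v ^ m * ?u"]) auto
  qed
  then obtain d where d: "d \<in> A" "?u = s ^ m * d" by blast
  obtain v where "v \<in> A" "s * v = 1"
    using dvd_prod_powers_unit[OF triv Q coprime e fin sa(1) d m] by blast
  then have "\<beta> = a * v" using sa by (simp add: field_simps) (metis mult.assoc mult.commute mult_1)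
  then show ?thesis using sa \<open>v \<in> A\<close> by simp
qed

end

section \<open>Roots of unity\<close>

text \<open>In characteristic \<open>0\<close>, \<open>X^m - 1\<close> shares no root with its
  derivative. It splits over an algebraically closed field, so its \<open>m\<close> roots are
  distinct.\<close>

lemma card_roots_of_unity:
  assumes "m > 0"
  shows "card {\<zeta> :: 'a::{alg_closed_field, field_char_0}. \<zeta> ^ m = 1} = m"
proof -
  define p :: "'a poly" where "p = Polynomial.monom 1 m - 1"
  have coeff: "Polynomial.coeff p i = (if i = m then 1 else if i = 0 then - 1 else 0)" for i
    using assms by (auto simp: p_def)
  have deg: "Polynomial.degree p = m"
    by (intro antisym degree_le le_degree) (auto simp: coeff)
  have p0: "p \<noteq> 0" using assms deg by auto
  have poly: "poly p z = z ^ m - 1" for z by (simp add: p_def poly_monom)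
  have pd: "poly (pderiv p) z = of_nat m * z ^ (m - 1)" for z
    by (simp add: p_def pderiv_diff pderiv_monom poly_monom)
  have "rsquarefree p"
    unfolding rsquarefree_roots poly pd using assms by (auto simp: power_0_left)
  then have order: "order z p = 1" if "z ^ m = 1" for z
    using rsquarefree_root_order[OF _ _ p0, of z] that poly by simp
  obtain Z where Z: "size Z = Polynomial.degree p" "p = smult (Polynomial.lead_coeff p) (\<Prod>x\<in>#Z. [:- x, 1:])"
    using alg_closed_imp_factorization[OF p0] by blast
  have "proots p = proots (\<Prod>x\<in>#Z. [:- x, 1:])"
    using p0 by (subst Z(2)) (rule proots_smult, simp)
  also have "\<dots> = (\<Sum>x\<in>#Z. {#x#})"
  proof -
    have "0 \<notin># image_mset (\<lambda>x. [:- x, 1:]) Z" by auto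
    from proots_prod_mset[OF this] show ?thesis by (simp add: image_mset.compositionality o_def)
  qed
  finally have proots: "proots p = Z" by simp
  have "m = size (proots p)" using Z(1) deg proots by simp
  also have "\<dots> = (\<Sum>z\<in>{z. z ^ m = 1}. order z p)"
    using p0 by (simp add: size_multiset_overloaded_eq poly)
  also have "\<dots> = card {z :: 'a. z ^ m = 1}" using order by simp
  finally show ?thesis by simp
qed

text \<open>Multiplication by a root \<open>\<xi>\<close> permutes the summands. When
  \<open>m\<close> does not divide \<open>n\<close>, a root with \<open>\<xi> ^ n \<noteq> 1\<close>
  exists by counting: with \<open>r = n mod m\<close>, there are only \<open>r < m\<close> roots of
  \<open>X^r - 1\<close>.\<close>

lemma sum_roots_of_unity_power:
  fixes m n :: nat
  assumes "m > 0"
  shows "(\<Sum>\<zeta> | \<zeta> ^ m = 1. \<zeta> ^ n) = (if m dvd n then of_nat m else (0 :: 'a::{alg_closed_field, field_char_0}))"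
proof (cases "m dvd n")
  case True
  have "(\<Sum>\<zeta> | \<zeta> ^ m = 1. \<zeta> ^ n) = (\<Sum>\<zeta> | \<zeta> ^ m = (1 :: 'a). 1 :: 'a)"
    by (rule sum.cong) (use True in \<open>auto elim!: dvdE simp: power_mult\<close>)
  then show ?thesis using True card_roots_of_unity[OF assms, where 'a = 'a] by simp
next
  case False
  let ?U = "{\<zeta> :: 'a. \<zeta> ^ m = 1}"
  define r where "r = n mod m"
  have r: "0 < r" "r < m" using False assms by (auto simp: r_def mod_greater_zero_iff_not_dvd)
  have pow: "\<zeta> ^ n = \<zeta> ^ r" if "\<zeta> \<in> ?U" for \<zeta>
  proof -
    have "\<zeta> ^ n = \<zeta> ^ (m * (n div m) + r)" by (simp add: r_def)
    then show ?thesis using that by (simp add: power_add power_mult)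
  qed
  have "\<exists>\<xi>\<in>?U. \<xi> ^ r \<noteq> 1"
  proof (rule ccontr)
    assume "\<not> ?thesis"
    then have "?U \<subseteq> {\<zeta>. \<zeta> ^ r = 1}" by blast
    moreover have "finite {\<zeta> :: 'a. \<zeta> ^ r = 1}"
      using card_roots_of_unity[OF r(1), where 'a = 'a] r(1) card_ge_0_finite by force
    ultimately have "card ?U \<le> card {\<zeta> :: 'a. \<zeta> ^ r = 1}" by (rule card_mono[rotated])
    then show False using card_roots_of_unity[OF r(1), where 'a = 'a] card_roots_of_unity[OF assms, where 'a = 'a] r(2) by simp
  qed
  then obtain \<xi> where \<xi>: "\<xi> \<in> ?U" "\<xi> ^ r \<noteq> 1" by blast
  then have \<xi>0: "\<xi> \<noteq> 0" using r by (auto simp: power_0_left)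
  have "(\<Sum>\<zeta>\<in>?U. \<zeta> ^ n) = (\<Sum>\<zeta>\<in>?U. (\<xi> * \<zeta>) ^ n)"
    using \<xi>(1) \<xi>0
    by (intro sum.reindex_bij_witness[of _ "\<lambda>\<zeta>. \<xi> * \<zeta>" "\<lambda>\<zeta>. \<zeta> / \<xi>"]) (auto simp: power_mult_distrib power_divide)
  also have "\<dots> = \<xi> ^ n * (\<Sum>\<zeta>\<in>?U. \<zeta> ^ n)" by (simp add: power_mult_distrib sum_distrib_left)
  finally have "(1 - \<xi> ^ n) * (\<Sum>\<zeta>\<in>?U. \<zeta> ^ n) = 0" by (simp add: algebra_simps)
  then have "(\<Sum>\<zeta>\<in>?U. \<zeta> ^ n) = 0" using \<xi>(2) pow[OF \<xi>(1)] by simp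
  then show ?thesis using False by simp
qed

section \<open>Passing to the algebraic closure\<close>

text \<open>Evaluates polynomials over the ambient field at points of its algebraic closure, where
  the conjugates live.\<close>

definition eval_ac :: "'a::field poly \<Rightarrow> 'a alg_closure \<Rightarrow> 'a alg_closure" where
  "eval_ac p z = poly (map_poly to_ac p) z"

lemma eval_ac_simps [simp]:
  "eval_ac 0 z = 0" "eval_ac (pCons a p) z = to_ac a + z * eval_ac p z"
  "eval_ac (p + r) z = eval_ac p z + eval_ac r z"
proof -
  have "map_poly to_ac (p + r) = map_poly to_ac p + map_poly to_ac r"
    by (simp add: poly_eq_iff coeff_map_poly)
  then show "eval_ac (p + r) z = eval_ac p z + eval_ac r z" by (simp add: eval_ac_def)
qed (auto simp: eval_ac_def map_poly_pCons)

lemma eval_ac_uminus [simp]: "eval_ac (- p) z = - eval_ac p z"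
  using eval_ac_simps(3)[of p "- p" z] by (simp add: eq_neg_iff_add_eq_0 add.commute)

lemma eval_ac_diff [simp]: "eval_ac (p - r) z = eval_ac p z - eval_ac r z"
  using eval_ac_simps(3)[of p "- r" z] by simp

lemma eval_ac_smult [simp]: "eval_ac (Polynomial.smult a p) z = to_ac a * eval_ac p z"
  by (induction p) (auto simp: algebra_simps)

lemma eval_ac_mult [simp]: "eval_ac (p * r) z = eval_ac p z * eval_ac r z"
  by (induction p) (auto simp: algebra_simps)

lemma eval_ac_monom [simp]: "eval_ac (Polynomial.monom a n) z = to_ac a * z ^ n"
  by (induction n) (auto simp: monom_0 monom_Suc mult_ac)

lemma eval_ac_sum [simp]: "eval_ac (\<Sum>i\<in>I. f i) z = (\<Sum>i\<in>I. eval_ac (f i) z)"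
  by (induction I rule: infinite_finite_induct) auto

lemma eval_ac_pcompose [simp]: "eval_ac (pcompose p r) z = eval_ac p (eval_ac r z)"
  by (induction p) (auto simp: pcompose_pCons)

lemma field_subring_to_ac:
  assumes "field_subring A" shows "field_subring (to_ac ` A)"
proof -
  interpret field_subring A by fact
  show ?thesis
  proof (rule field_subringI)
    show "1 \<in> to_ac ` A" using imageI[OF one, of to_ac] by simp
    fix u assume "u \<in> to_ac ` A"
    then obtain a where a: "a \<in> A" "u = to_ac a" by blast
    show "- u \<in> to_ac ` A" unfolding a(2) using imageI[OF uminus[OF a(1)], of to_ac] by simp
    fix v assume "v \<in> to_ac ` A"
    then obtain b where b: "b \<in> A" "v = to_ac b" by blast
    show "u + v \<in> to_ac ` A" unfolding a(2) b(2) using imageI[OF add[OF a(1) b(1)], of to_ac] by simp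
    show "u * v \<in> to_ac ` A" unfolding a(2) b(2) using imageI[OF mult[OF a(1) b(1)], of to_ac] by simp
  qed
qed

lemma acc_submodules_to_ac:
  assumes "acc_submodules A A" shows "acc_submodules (to_ac ` A) (to_ac ` A)"
  unfolding acc_submodules_def
proof (intro allI impI)
  fix C assume C: "\<forall>n. is_submodule (to_ac ` A) (C n) \<and> C n \<subseteq> to_ac ` A \<and> C n \<subseteq> C (Suc n)"
  define D where "D n = {a. to_ac a \<in> C n}" for n
  have "is_submodule A (D n)" for n
    using C by (auto simp: D_def is_submodule_def)
  moreover have "D n \<subseteq> A" "D n \<subseteq> D (Suc n)" for n
    using C inj_image_mem_iff[OF inj_to_ac] unfolding D_def by blast+
  ultimately obtain n where n: "\<And>k. k \<ge> n \<Longrightarrow> D k = D n"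
    by (rule acc_submodulesE[OF assms, of D]) blast
  have "C k = to_ac ` D k" for k using C by (auto simp: D_def)
  with n have "C k = C n" if "k \<ge> n" for k using that by metis
  then show "\<exists>n. \<forall>k\<ge>n. C k = C n" by blast
qed

text \<open>The coefficients of the relation come from \<open>A\<close> by assumption, so
  injectivity of \<open>to_ac\<close> pulls the whole relation back.\<close>

lemma integral_over_to_acD:
  assumes "field_subring A" "integral_over (to_ac ` A) (to_ac z)"
  shows "integral_over A z"
proof -
  interpret field_subring A by fact
  interpret ac: field_subring "to_ac ` A" by (rule field_subring_to_ac) fact
  obtain n where n: "to_ac z ^ n \<in> lincomb (to_ac ` A) {..<n} (\<lambda>k. to_ac z ^ k)"
    using assms(2) unfolding ac.integral_over_iff_power by blast
  then obtain a where a: "\<forall>k\<in>{..<n}. a k \<in> to_ac ` A" "to_ac z ^ n = (\<Sum>k<n. a k * to_ac z ^ k)"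
    by (rule lincombE)
  then have "\<forall>k\<in>{..<n}. \<exists>b. b \<in> A \<and> a k = to_ac b" by blast
  from bchoice[OF this] obtain b where b: "\<forall>k\<in>{..<n}. b k \<in> A \<and> a k = to_ac (b k)" by blast
  have "to_ac (z ^ n) = to_ac (\<Sum>k<n. b k * z ^ k)"
    using a(2) b by (simp add: to_ac_sum)
  then have "z ^ n = (\<Sum>k<n. b k * z ^ k)" by (simp only: to_ac_eq_iff)
  then have "z ^ n \<in> lincomb A {..<n} (\<lambda>k. z ^ k)"
    by (elim ssubst) (rule lincombI, use b in auto)
  then show ?thesis unfolding integral_over_iff_power ..
qed

section \<open>Radical extensions of rings with trivial class group\<close>

text \<open>Linear independence of the powers of \<open>y\<close> stands in for irreducibility of
  \<open>Y^m - q\<close>, because it can be transported from one polynomial ring to the next. The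
  unit \<open>c\<close> is the constant left over in the squarefree decomposition.\<close>

locale radical_extension =
  fixes R :: "'a::field_char_0 set" and y q c :: 'a and m :: nat and Q :: "nat \<Rightarrow> 'a"
  assumes R: "noetherian_normal R" "class_trivial R"
    and m: "m \<ge> 1" "inverse (of_nat m) \<in> R"
    and Q: "\<And>l. l \<in> {1..<m} \<Longrightarrow> Q l \<in> R"
      "\<And>l. l \<in> {1..<m} \<Longrightarrow> power_free 2 R (Q l)"
      "\<And>k l. k \<in> {1..<m} \<Longrightarrow> l \<in> {1..<m} \<Longrightarrow> k \<noteq> l \<Longrightarrow> gcd_one R {Q k, Q l}"
    and c: "c \<in> R" "inverse c \<in> R" "c \<noteq> 0"
    and q: "q = c * (\<Prod>l\<in>{1..<m}. Q l ^ l)"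
    and y: "y ^ m = q"
    and indep: "\<And>a. \<forall>i<m. a i \<in> R \<Longrightarrow> (\<Sum>i<m. a i * y ^ i) = 0 \<Longrightarrow> \<forall>i<m. a i = 0"
begin

sublocale field_subring R using noetherian_normalD(1)[OF R(1)] .

abbreviation K :: "'a set" where "K \<equiv> fractions R"

sublocale K: field_subfield K by (rule field_subfield_fractions)

definition E :: "nat \<Rightarrow> 'a" where "E i = (\<Prod>l\<in>{1..<m}. Q l ^ (i * l div m))"
definition w :: "nat \<Rightarrow> 'a" where "w i = y ^ i / E i"
definition W :: "'a set" where "W = lincomb R {..<m} w"
definition L :: "'a set" where "L = lincomb K {..<m} (\<lambda>i. y ^ i)"

lemma Q_nonzero: "l \<in> {1..<m} \<Longrightarrow> Q l \<noteq> 0"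
  using power_free_nonzero[OF Q(2) field_subring_axioms] by simp

lemma E_mem: "E i \<in> R" and E_nonzero: "E i \<noteq> 0"
  using Q(1) Q_nonzero by (auto simp: E_def intro!: prod)

lemma q_mem: "q \<in> R" and q_nonzero: "q \<noteq> 0"
  using Q(1) Q_nonzero c by (auto simp: q intro!: mult prod)

lemma indep_fractions:
  assumes "\<forall>i<m. a i \<in> K" "(\<Sum>i<m. a i * y ^ i) = 0" "i < m"
  shows "a i = 0"
proof -
  obtain d where d: "d \<in> R" "d \<noteq> 0" "\<And>i. i \<in> {..<m} \<Longrightarrow> d * a i \<in> R"
    using common_denominator[of "{..<m}" a] assms(1) by auto
  have "(\<Sum>i<m. (d * a i) * y ^ i) = d * (\<Sum>i<m. a i * y ^ i)"
    by (simp add: sum_distrib_left mult.assoc)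
  then have "\<forall>i<m. d * a i = 0" using d(3) assms(2) by (intro indep) auto
  then show ?thesis using d(2) assms(3) by auto
qed

lemma indep_w:
  assumes "\<forall>i<m. a i \<in> K" "(\<Sum>i<m. a i * w i) = 0" "i < m"
  shows "a i = 0"
proof -
  have "a i / E i = 0"
    using assms E_mem by (intro indep_fractions[of "\<lambda>i. a i / E i"]) (auto simp: w_def)
  then show ?thesis using E_nonzero by simp
qed

lemma y_power_mem: "y ^ n \<in> L"
proof -
  have "y ^ (m * d + r) = q ^ d * y ^ r" for d r by (simp add: power_add power_mult y)
  from this[of "n div m" "n mod m"] have "y ^ n = q ^ (n div m) * y ^ (n mod m)" by simp
  also have "\<dots> \<in> L"
    unfolding L_def using m(1) q_mem
    by (intro is_submoduleD(3)[OF K.is_submodule_lincomb] K.lincomb_generator) auto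
  finally show ?thesis .
qed

lemma field_subring_L: "field_subring L"
proof (rule field_subringI)
  have sub: "is_submodule K L" unfolding L_def by (rule K.is_submodule_lincomb)
  show "1 \<in> L" using y_power_mem[of 0] by simp
  show "- x \<in> L" if "x \<in> L" for x by (rule K.is_submodule_uminus[OF sub that])
  show "x + z \<in> L" if "x \<in> L" "z \<in> L" for x z using that by (rule is_submoduleD(2)[OF sub])
  show "x * z \<in> L" if xz: "x \<in> L" "z \<in> L" for x z
  proof -
    obtain a b where a: "\<forall>i\<in>{..<m}. a i \<in> K" "x = (\<Sum>i<m. a i * y ^ i)"
      and b: "\<forall>i\<in>{..<m}. b i \<in> K" "z = (\<Sum>i<m. b i * y ^ i)"
      using xz unfolding L_def by (elim lincombE)
    have "x * z = (\<Sum>i<m. \<Sum>k<m. (a i * b k) * y ^ (i + k))"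
      unfolding a(2) b(2) sum_product by (simp add: power_add mult_ac)
    also have "\<dots> \<in> L"
      using a(1) b(1) by (intro is_submodule_sum[OF sub] is_submoduleD(3)[OF sub] y_power_mem) auto
    finally show ?thesis .
  qed
qed

sublocale L: field_subring L by (rule field_subring_L)

lemma K_subset_L: "K \<subseteq> L"
proof
  fix a assume "a \<in> K"
  then have "a * y ^ 0 \<in> L"
    using is_submoduleD(3)[OF K.is_submodule_lincomb] y_power_mem[of 0] unfolding L_def by blast
  then show "a \<in> L" by simp
qed

text \<open>\<open>L\<close> is finite over \<open>K\<close>, so \<open>u\<close> satisfies a
  polynomial relation. Cancelling powers of \<open>u\<close> makes its constant term nonzero, and
  the inverse of \<open>u\<close> can be read off.\<close>

lemma field_subfield_L: "field_subfield L"
proof (rule field_subfieldI[OF field_subring_L])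
  fix u assume u: "u \<in> L" "u \<noteq> 0"
  have "integral_over K u"
  proof (rule K.integral_over_acc)
    show "acc_submodules K L"
      unfolding L_def by (intro K.acc_submodules_lincomb K.acc_submodules_field) auto
    show "is_submodule K L" unfolding L_def by (rule K.is_submodule_lincomb)
    show "1 * u ^ n \<in> L" for n using u(1) by simp
  qed simp
  then obtain p where p: "p \<in> polys_over K" "Polynomial.lead_coeff p = 1" "poly p u = 0"
    by (auto simp: integral_over_def)
  then have "p \<noteq> 0" by auto
  have "\<exists>a r. a \<in> K \<and> a \<noteq> 0 \<and> r \<in> polys_over K \<and> a + u * poly r u = 0"
    using p(1) \<open>p \<noteq> 0\<close> p(3)
  proof (induction p)
    case (pCons a p)
    show ?case
    proof (cases "a = 0")
      case True
      then show ?thesis using pCons u(2) by (cases "p = 0") auto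
    next
      case False
      then show ?thesis using pCons.prems by (intro exI[of _ a] exI[of _ p]) auto
    qed
  qed simp
  then obtain a r where ar: "a \<in> K" "a \<noteq> 0" "r \<in> polys_over K" "a + u * poly r u = 0" by blast
  have "a = u * (- poly r u)" using ar(4) by (simp add: eq_neg_iff_add_eq_0)
  then have "u * (- poly r u * inverse a) = 1"
    using ar(2) by (metis mult.assoc right_inverse)
  then have "inverse u = - poly r u * inverse a" by (rule inverse_unique)
  also have "\<dots> \<in> L"
    using ar u(1) K_subset_L polys_over_mono[OF K_subset_L] by (intro L.mult L.uminus L.poly_closed) auto
  finally show "inverse u \<in> L" .
qed

text \<open>Raising \<open>n\<close> by \<open>m\<close> raises each floor exponent by exactly
  \<open>l\<close>, so \<open>E\<close> gains the factor \<open>q / c\<close> while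
  \<open>y ^ n\<close> gains \<open>q\<close>.\<close>

lemma w_add_m: "w (n + m) = c * w n"
proof -
  have "(n + m) * l div m = n * l div m + l" for l
    using m(1) by (simp add: distrib_right)
  then have "E (n + m) * c = E n * q"
    unfolding E_def q by (simp add: power_add prod.distrib)
  then show ?thesis
    using E_nonzero[of n] E_nonzero[of "n + m"] unfolding w_def power_add y
    by (simp add: field_simps)
qed

lemma is_submodule_W: "is_submodule R W"
  unfolding W_def by (rule is_submodule_lincomb)

lemma w_mem: "w n \<in> W"
proof (induction n rule: less_induct)
  case (less n)
  show ?case
  proof (cases "n < m")
    case True
    then show ?thesis unfolding W_def by (intro lincomb_generator) auto
  next
    case False
    then have "w n = c * w (n - m)" using w_add_m[of "n - m"] by simp
    then show ?thesis
      using is_submoduleD(3)[OF is_submodule_W c(1) less[of "n - m"]] False m(1) by simp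
  qed
qed

text \<open>Floors are superadditive: \<open>?e l\<close> is \<open>0\<close> or \<open>1\<close>,
  and the truncated subtraction is exact. Together with \<open>w_add_m\<close> this closes
  \<open>W\<close> under products.\<close>

lemma w_mult: "\<exists>r\<in>R. w i * w k = r * w (i + k)"
proof
  let ?e = "\<lambda>l. (i + k) * l div m - i * l div m - k * l div m"
  have "(i + k) * l div m = i * l div m + k * l div m + ?e l" for l
    using div_add1_eq[of "i * l" "k * l" m] by (simp add: distrib_right)
  then have "E (i + k) = E i * E k * (\<Prod>l\<in>{1..<m}. Q l ^ ?e l)"
    unfolding E_def prod.distrib[symmetric] power_add[symmetric] by presburger
  then show "w i * w k = (\<Prod>l\<in>{1..<m}. Q l ^ ?e l) * w (i + k)"
    using E_nonzero[of "i + k"] by (simp add: w_def power_add)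
  show "(\<Prod>l\<in>{1..<m}. Q l ^ ?e l) \<in> R" using Q(1) by (auto intro!: prod)
qed

lemma field_subring_W: "field_subring W"
proof (rule field_subringI)
  note sub = is_submodule_W
  show "1 \<in> W" using w_mem[of 0] by (simp add: w_def E_def)
  show "- x \<in> W" if "x \<in> W" for x by (rule is_submodule_uminus[OF sub that])
  show "x + z \<in> W" if "x \<in> W" "z \<in> W" for x z using that by (rule is_submoduleD(2)[OF sub])
  show "x * z \<in> W" if xz: "x \<in> W" "z \<in> W" for x z
  proof -
    obtain a b where a: "\<forall>i\<in>{..<m}. a i \<in> R" "x = (\<Sum>i<m. a i * w i)"
      and b: "\<forall>i\<in>{..<m}. b i \<in> R" "z = (\<Sum>i<m. b i * w i)"
      using xz unfolding W_def by (elim lincombE)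
    have ww: "w i * w k \<in> W" for i k
      using w_mult[of i k] is_submoduleD(3)[OF sub _ w_mem] by auto
    have "x * z = (\<Sum>i<m. \<Sum>k<m. (a i * b k) * (w i * w k))"
      unfolding a(2) b(2) sum_product by (simp add: mult_ac)
    also have "\<dots> \<in> W"
      using a(1) b(1) by (intro is_submodule_sum[OF sub] is_submoduleD(3)[OF sub] ww) auto
    finally show ?thesis .
  qed
qed

sublocale W: field_subring W by (rule field_subring_W)

lemma R_subset_W: "R \<subseteq> W"
proof
  fix a assume "a \<in> R"
  then show "a \<in> W" using is_submoduleD(3)[OF is_submodule_W _ W.one, of a] by simp
qed

lemma W_subset_L: "W \<subseteq> L"
proof -
  have "is_submodule R L"
    using is_submodule_antimono[OF K.is_submodule_lincomb subset_fractions] by (simp add: L_def)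
  moreover have "w i \<in> L" for i
  proof -
    have "y ^ i * inverse (E i) \<in> L"
      using y_power_mem K_subset_L E_mem K.inverse by (intro L.mult) blast+
    then show ?thesis by (simp add: w_def divide_inverse)
  qed
  ultimately show ?thesis unfolding W_def by (rule lincomb_least)
qed

lemma fractions_W: "fractions W = L"
proof
  show "fractions W \<subseteq> L" by (rule W.fractions_least[OF field_subfield_L W_subset_L])
  interpret FW: field_subfield "fractions W" by (rule W.field_subfield_fractions)
  have K: "K \<subseteq> fractions W" by (rule fractions_mono[OF R_subset_W])
  have "y ^ i \<in> fractions W" for i
  proof -
    have "y ^ i = w i * E i" using E_nonzero by (simp add: w_def)
    also have "\<dots> \<in> fractions W" using w_mem E_mem R_subset_W by (intro FW.mult) blast+
    finally show ?thesis .
  qed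
  moreover have "is_submodule K (fractions W)"
    by (rule is_submodule_antimono[OF FW.is_submodule_self K])
  ultimately show "L \<subseteq> fractions W" unfolding L_def by (intro lincomb_least) auto
qed

lemma acc_W: "acc_submodules R W"
  unfolding W_def by (intro acc_submodules_lincomb noetherian_normalD(2)[OF R(1)]) auto

lemma integral_over_W: "z \<in> W \<Longrightarrow> integral_over R z"
  using integral_over_acc[OF acc_W is_submodule_W, of 1 z] by simp

text \<open>
  Every root of \<open>Y\<^sup>m - q\<close> has the form \<open>\<zeta> y\<close>, and the minimal polynomial of \<open>y\<close> divides \<open>p (\<Sum> b\<^sub>k Y\<^sup>k)\<close>.
\<close>

lemma conjugate_integral:
  assumes b: "\<forall>k<m. b k \<in> K" and int: "integral_over R (\<Sum>k<m. b k * y ^ k)"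
    and \<zeta>: "\<zeta> ^ m = (1 :: 'a alg_closure)"
  shows "integral_over (to_ac ` R) (\<Sum>k<m. to_ac (b k) * (\<zeta> * to_ac y) ^ k)"
proof -
  obtain p where p: "p \<in> polys_over R" "Polynomial.lead_coeff p = 1" "poly p (\<Sum>k<m. b k * y ^ k) = 0"
    using int by (auto simp: integral_over_def)
  define G where "G = (\<Sum>k<m. Polynomial.monom (b k) k)"
  define M where "M = Polynomial.monom 1 m - [:q:]"
  have G: "G \<in> polys_over K" unfolding G_def using b by (intro K.polys_over_sum) auto
  have M: "M \<in> polys_over K" unfolding M_def using q_mem by auto
  have coeffM: "Polynomial.coeff M i = (if i = m then 1 else if i = 0 then - q else 0)" for i
    using m(1) by (auto simp: M_def coeff_pCons split: nat.split)
  have degM: "Polynomial.degree M = m"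
    by (intro antisym degree_le le_degree) (auto simp: coeffM)
  have pG: "pcompose p G \<in> polys_over K"
    using G p(1) polys_over_mono[OF subset_fractions] by (intro K.polys_over_pcompose) blast
  obtain h r where hr: "h \<in> polys_over K" "r \<in> polys_over K" "pcompose p G = M * h + r"
      "r = 0 \<or> Polynomial.degree r < Polynomial.degree M"
    using K.polys_over_divmod[OF M _ pG] degM m(1) by (metis degree_0 not_one_le_zero)
  \<comment> \<open>The remainder has degree below \<open>m\<close> and vanishes at
    \<open>y\<close>, so independence kills all its coefficients.\<close>
  have "r = 0"
  proof (rule ccontr)
    assume "r \<noteq> 0"
    then have deg: "Polynomial.degree r < m" using hr(4) degM by simp
    have "poly M y = 0" by (simp add: M_def poly_monom y)
    moreover have "poly (pcompose p G) y = 0" using p(3) by (simp add: poly_pcompose G_def poly_sum poly_monom)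
    ultimately have "poly r y = 0" unfolding hr(3) by simp
    moreover have "poly r y = (\<Sum>i<m. Polynomial.coeff r i * y ^ i)"
      unfolding poly_altdef using deg by (intro sum.mono_neutral_left) (auto simp: coeff_eq_0)
    ultimately have "Polynomial.coeff r i = 0" if "i < m" for i
      using indep_fractions[of "Polynomial.coeff r" i] hr(2) that by auto
    then have "Polynomial.lead_coeff r = 0" using deg by blast
    with \<open>r \<noteq> 0\<close> show False by simp
  qed
  let ?z = "\<zeta> * to_ac y"
  have "?z ^ m = to_ac q" using \<zeta> by (simp add: power_mult_distrib flip: to_ac_power y)
  then have "eval_ac M ?z = 0" by (simp add: M_def)
  then have "eval_ac (pcompose p G) ?z = 0" unfolding hr(3) \<open>r = 0\<close> by simp
  then have "poly (map_poly to_ac p) (\<Sum>k<m. to_ac (b k) * ?z ^ k) = 0"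
    by (simp add: G_def) (simp add: eval_ac_def)
  moreover have "map_poly to_ac p \<in> polys_over (to_ac ` R)"
    using p(1) by (intro polys_overI) (auto simp: coeff_map_poly)
  moreover have "Polynomial.lead_coeff (map_poly to_ac p) = 1"
    using p(2) by (subst lead_coeff_map_poly_nz) auto
  ultimately show ?thesis unfolding integral_over_def by blast
qed

text \<open>Averaging over the conjugates isolates the homogeneous components.\<close>

lemma component_integral:
  assumes b: "\<forall>k<m. b k \<in> K" and int: "integral_over R (\<Sum>k<m. b k * y ^ k)" and i: "i < m"
  shows "integral_over R (b i * y ^ i)"
proof -
  interpret ac: field_subring "to_ac ` R" by (rule field_subring_to_ac) (rule field_subring_axioms)
  have acc: "acc_submodules (to_ac ` R) (to_ac ` R)"
    by (rule acc_submodules_to_ac[OF noetherian_normalD(2)[OF R(1)]])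
  let ?U = "{\<zeta> :: 'a alg_closure. \<zeta> ^ m = 1}"
  let ?g = "\<lambda>\<zeta>. (\<Sum>k<m. to_ac (b k) * (\<zeta> * to_ac y) ^ k)"
  \<comment> \<open>\<open>\<zeta> ^ (m - i)\<close> is \<open>\<zeta>\<close> to the power
    \<open>- i\<close> with a natural exponent, hence integral. In the sum over all roots only the
    exponent \<open>m - i + k\<close> with \<open>k = i\<close> is divisible by \<open>m\<close>,
    since it lies strictly between \<open>0\<close> and \<open>2 * m\<close>.\<close>
  have "integral_over (to_ac ` R) (\<zeta> ^ (m - i) * ?g \<zeta>)" if "\<zeta> \<in> ?U" for \<zeta>
  proof (rule ac.integral_over_add_mult(2)[OF acc])
    have "integral_over (to_ac ` R) \<zeta>" using that m(1) by (intro ac.integral_over_root[of _ m]) auto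
    then show "integral_over (to_ac ` R) (\<zeta> ^ (m - i))" by (rule ac.integral_over_power[OF acc])
    show "integral_over (to_ac ` R) (?g \<zeta>)" using that by (intro conjugate_integral b int) simp
  qed
  then have "integral_over (to_ac ` R) (\<Sum>\<zeta>\<in>?U. \<zeta> ^ (m - i) * ?g \<zeta>)"
    by (intro ac.integral_over_sum[OF acc])
  also have "(\<Sum>\<zeta>\<in>?U. \<zeta> ^ (m - i) * ?g \<zeta>) = (\<Sum>k<m. to_ac (b k * y ^ k) * (\<Sum>\<zeta>\<in>?U. \<zeta> ^ (m - i + k)))"
    unfolding sum_distrib_left by (subst sum.swap) (simp add: power_add power_mult_distrib mult_ac)
  also have "\<dots> = (\<Sum>k<m. if k = i then to_ac (b k * y ^ k) * of_nat m else 0)"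
  proof (intro sum.cong refl)
    fix k assume k: "k \<in> {..<m}"
    have "m dvd m - i + k \<longleftrightarrow> k = i"
    proof
      assume "m dvd m - i + k"
      then obtain d where d: "m - i + k = m * d" by (elim dvdE)
      have "d = 1"
      proof (cases d)
        case (Suc d')
        then show ?thesis using d k i by (cases d') auto
      qed (use d i in simp)
      then show "k = i" using d i by simp
    qed (use i in auto)
    then show "to_ac (b k * y ^ k) * (\<Sum>\<zeta>\<in>?U. \<zeta> ^ (m - i + k)) =
        (if k = i then to_ac (b k * y ^ k) * of_nat m else 0)"
      using m(1) by (subst sum_roots_of_unity_power) auto
  qed
  also have "\<dots> = to_ac (b i * y ^ i * of_nat m)" using i by simp
  finally have "integral_over R (b i * y ^ i * of_nat m)"
    by (rule integral_over_to_acD[OF field_subring_axioms])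
  then have "integral_over R (b i * y ^ i * of_nat m * inverse (of_nat m))"
    by (rule integral_over_add_mult(2)[OF noetherian_normalD(2)[OF R(1)] _ integral_over_self[OF m(2)]])
  then show ?thesis using m(1) by (simp add: mult.assoc)
qed

lemma integral_imp_W:
  assumes "z \<in> L" "integral_over R z"
  shows "z \<in> W"
proof -
  obtain b where b: "\<forall>i\<in>{..<m}. b i \<in> K" "z = (\<Sum>i<m. b i * y ^ i)"
    using assms(1) unfolding L_def by (rule lincombE)
  have mem: "b i * E i \<in> R" if i: "i < m" for i
  proof (rule mem_ring_if_power_mult_prod[OF R(2), of "{1..<m}" Q "\<lambda>l. i * l mod m" m])
    have "integral_over R (b i * y ^ i)"
      using component_integral[of b i] b assms(2) i by auto
    then have "integral_over R ((b i * y ^ i) ^ m)"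
      by (rule integral_over_power[OF noetherian_normalD(2)[OF R(1)]])
    also have "(b i * y ^ i) ^ m = b i ^ m * q ^ i"
      by (simp add: power_mult_distrib y[symmetric] mult.commute flip: power_mult)
    finally have "b i ^ m * q ^ i \<in> R"
      using b(1) i q_mem
      by (intro completely_integrally_closed_integral[OF noetherian_normalD(3)[OF R(1)]]) auto
    then have "b i ^ m * q ^ i * inverse c ^ i \<in> R" using c by auto
    \<comment> \<open>Division with remainder of each exponent \<open>i * l\<close> by
      \<open>m\<close>: the quotients make up \<open>E i ^ m\<close>, and the remainders, all below
      \<open>m\<close>, are the exponents required by
      \<open>mem_ring_if_power_mult_prod\<close>.\<close>
    also have "b i ^ m * q ^ i * inverse c ^ i = (b i * E i) ^ m * (\<Prod>l\<in>{1..<m}. Q l ^ (i * l mod m))"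
    proof -
      have "i * l = i * l div m * m + i * l mod m" for l by simp
      then have "Q l ^ (i * l) = (Q l ^ (i * l div m)) ^ m * Q l ^ (i * l mod m)" for l
        by (metis power_add power_mult)
      moreover have "q ^ i * inverse c ^ i = (\<Prod>l\<in>{1..<m}. Q l ^ (i * l))"
        using c(3) by (simp add: q power_mult_distrib prod_power_distrib power_inverse mult.commute flip: power_mult)
      ultimately have "q ^ i * inverse c ^ i = E i ^ m * (\<Prod>l\<in>{1..<m}. Q l ^ (i * l mod m))"
        by (simp add: E_def prod.distrib prod_power_distrib)
      then show ?thesis by (simp add: power_mult_distrib mult.assoc)
    qed
    finally show "(b i * E i) ^ m * (\<Prod>l\<in>{1..<m}. Q l ^ (i * l mod m)) \<in> R" .
    show "b i * E i \<in> K" using b(1) i E_mem by auto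
  qed (use Q m(1) in auto)
  have "z = (\<Sum>i<m. (b i * E i) * w i)"
    unfolding b(2) using E_nonzero by (intro sum.cong) (auto simp: w_def)
  also have "\<dots> \<in> W" unfolding W_def by (rule lincombI) (use mem in auto)
  finally show ?thesis .
qed

theorem integral_closure_eq_W: "integral_closure R L = W"
  using integral_imp_W integral_over_W W_subset_L by (auto simp: integral_closure_eq)

text \<open>\<open>W\<close> is a Noetherian \<open>R\<close>-module, so an element almost integral
  over \<open>W\<close> is integral over \<open>R\<close> and falls back into
  \<open>W\<close>.\<close>

theorem noetherian_normal_W: "noetherian_normal W"
  unfolding noetherian_normal_def completely_integrally_closed_def
proof (intro conjI ballI impI)
  show "field_subring W" by (rule field_subring_W)
  show "acc_submodules W W" by (rule acc_submodules_extend[OF acc_W R_subset_W])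
  fix z u assume "z \<in> fractions W" "u \<in> W - {0}" "\<forall>n. u * z ^ n \<in> W"
  then show "z \<in> W"
    using integral_over_acc[OF acc_W is_submodule_W, of u z] by (intro integral_imp_W) (auto simp: fractions_W)
qed

end

section \<open>The tower\<close>

lemma transcendental_over_antimono: "transcendental_over L x \<Longrightarrow> K \<subseteq> L \<Longrightarrow> transcendental_over K x"
  unfolding transcendental_over_def using polys_over_mono by blast

lemma (in field_subfield) field_adjoin_eq_fractions: "field_adjoin A S = fractions (ring_adjoin A S)"
proof
  interpret R: field_subring "ring_adjoin A S" by (rule field_subring_generate_ring)
  interpret K: field_subfield "field_adjoin A S" by (rule field_subfield_generate_field)
  interpret Q: field_subfield "fractions (ring_adjoin A S)" by (rule R.field_subfield_fractions)
  show "field_adjoin A S \<subseteq> fractions (ring_adjoin A S)"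
    using generate_ring_incl_subset[of "A \<union> S"] R.subset_fractions by (intro Q.field_adjoin_least) blast
  show "fractions (ring_adjoin A S) \<subseteq> field_adjoin A S"
    by (intro R.fractions_least K.field_subfield_axioms K.ring_adjoin_least generate_field_incl_subset)
qed

lemma map_poly_to_ac_mult: "map_poly to_ac (p * r) = map_poly to_ac p * map_poly to_ac r"
  by (simp add: poly_eq_iff coeff_map_poly coeff_mult to_ac_sum)

text \<open>A relation yields a nonzero polynomial of degree below \<open>m\<close> vanishing at
  \<open>y\<close>. One of least degree divides \<open>M\<close>; it is not constant, so it would be
  a proper factor.\<close>

lemma (in field_subfield) irreducible_imp_indep:
  assumes M: "M \<in> polys_over A" "poly M y = 0" "Polynomial.degree M = m"
    and irred: "\<And>r h. r \<in> polys_over A \<Longrightarrow> h \<in> polys_over A \<Longrightarrow> M = r * h \<Longrightarrow>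
      Polynomial.degree r = 0 \<or> Polynomial.degree h = 0"
    and a: "\<forall>i<m. a i \<in> A" "(\<Sum>i<m. a i * y ^ i) = 0"
  shows "\<forall>i<m. a i = 0"
proof (rule ccontr)
  assume "\<not> ?thesis"
  then obtain i where i: "i < m" "a i \<noteq> 0" by blast
  define g where "g = (\<Sum>i<m. Polynomial.monom (a i) i)"
  have coeff_g: "Polynomial.coeff g i = (if i < m then a i else 0)" for i
    by (simp add: g_def coeff_sum)
  have "Polynomial.coeff g i \<noteq> 0" using i by (simp add: coeff_g)
  then have "g \<noteq> 0" by auto
  let ?P = "\<lambda>p. p \<in> polys_over A \<and> p \<noteq> 0 \<and> poly p y = 0"
  have Pg: "?P g"
    using a \<open>g \<noteq> 0\<close> unfolding g_def by (auto simp: poly_sum poly_monom intro!: polys_over_sum)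
  define r where "r = arg_min Polynomial.degree ?P"
  have r: "?P r" unfolding r_def using Pg by (rule arg_min_natI[of ?P])
  have r_le: "Polynomial.degree r \<le> Polynomial.degree p" if "?P p" for p
    unfolding r_def using that by (rule arg_min_nat_le[of ?P])
  have "Polynomial.degree g < m"
    using i by (intro degree_lessI) (auto simp: coeff_g \<open>g \<noteq> 0\<close>)
  then have deg: "Polynomial.degree r < m" using r_le[OF Pg] by simp
  obtain h s where hs: "h \<in> polys_over A" "s \<in> polys_over A" "M = r * h + s"
      "s = 0 \<or> Polynomial.degree s < Polynomial.degree r"
    using polys_over_divmod[of r M] r M(1) by blast
  have "s = 0"
  proof (rule ccontr)
    assume "s \<noteq> 0"
    have "poly s y = 0" using M(2) r unfolding hs(3) by simp
    then show False using r_le[of s] hs(2,4) \<open>s \<noteq> 0\<close> by auto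
  qed
  then have "M = r * h" using hs(3) by simp
  have "Polynomial.degree r = 0 \<or> Polynomial.degree h = 0"
    using irred[OF _ hs(1) \<open>M = r * h\<close>] r by simp
  then show False
  proof
    assume "Polynomial.degree r = 0"
    then obtain b where "r = [:b:]" by (rule degree_eq_zeroE)
    then show False using r by auto
  next
    assume "Polynomial.degree h = 0"
    then have "Polynomial.degree M = Polynomial.degree r"
      using \<open>M = r * h\<close> M(3) deg by (cases "h = 0") (auto simp: degree_mult_eq r)
    then show False using deg M(3) by simp
  qed
qed

text \<open>Regroup the relation by powers of \<open>x\<close>: its coefficients lie in
  \<open>S\<close>, which contains \<open>y\<close>, so they vanish separately, and each is a
  relation over \<open>A\<close>.\<close>

lemma indep_adjoin:
  assumes "field_subring A" "field_subring S" "A \<subseteq> S" "y \<in> S" "transcendental_over S x"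
    and indep: "\<And>a. \<forall>i<m. a i \<in> A \<Longrightarrow> (\<Sum>i<m. a i * y ^ i) = 0 \<Longrightarrow> \<forall>i<m. a i = 0"
    and a: "\<forall>i<m. a i \<in> ring_adjoin A {x}" "(\<Sum>i<m. a i * y ^ i) = 0"
  shows "\<forall>i<m. a i = (0 :: 'a::field)"
proof -
  interpret A: field_subring A by fact
  interpret S: field_subring S by fact
  have "\<forall>i\<in>{..<m}. \<exists>p. p \<in> polys_over A \<and> a i = poly p x"
    using a(1) unfolding A.ring_adjoin_singleton by blast
  from bchoice[OF this] obtain p where p: "\<And>i. i < m \<Longrightarrow> p i \<in> polys_over A \<and> a i = poly (p i) x"
    by auto
  define f where "f = (\<Sum>i<m. Polynomial.smult (y ^ i) (p i))"
  have "f \<in> polys_over S"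
    unfolding f_def using p assms(4) polys_over_mono[OF assms(3)]
    by (intro S.polys_over_sum S.polys_over_smult) auto
  moreover have "poly f x = (\<Sum>i<m. a i * y ^ i)"
    unfolding f_def poly_sum using p by (intro sum.cong) (auto simp: mult.commute)
  ultimately have "f = 0" using assms(5) a(2) by (auto simp: transcendental_over_def)
  have "\<forall>i<m. Polynomial.coeff (p i) k = 0" for k
  proof (rule indep)
    show "\<forall>i<m. Polynomial.coeff (p i) k \<in> A" using p by auto
    have "Polynomial.coeff f k = 0" using \<open>f = 0\<close> by simp
    then show "(\<Sum>i<m. Polynomial.coeff (p i) k * y ^ i) = 0"
      by (simp add: f_def coeff_sum mult.commute)
  qed
  then have "p i = 0" if "i < m" for i using that by (auto simp: poly_eq_iff)
  then show ?thesis using p by auto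
qed

lemma lincomb_mono: "A \<subseteq> B \<Longrightarrow> lincomb A I f \<subseteq> lincomb B I f"
  unfolding lincomb_def by blast

theorem proposition3p1:
  fixes F K0 K1 R0 R \<O> \<A> :: "'a::field_char_0 set"
    and D :: "'a \<Rightarrow> 'a"
    and t :: "nat \<Rightarrow> 'a" and j n :: nat
    and y q c :: 'a and m :: nat
    and Q E w :: "nat \<Rightarrow> 'a"
  assumes F: "subfield F ring_of_type_algebra"
    and D: "derivation D"
    \<comment> \<open>(T1)\<close>
    and DF: "D ` F \<subseteq> F"
    and t_low: "\<And>i. i \<in> {1..j} \<Longrightarrow> transcendental_over (field_adjoin F (t ` {1..<i})) (t i)"
    and Dt_low: "\<And>i. i \<in> {1..j} \<Longrightarrow> D (t i) \<in> field_adjoin F (t ` {1..i})"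
    and K0: "K0 = field_adjoin F (t ` {1..j})"
    and R0: "R0 = ring_adjoin F (t ` {1..j})"
    \<comment> \<open>(T2)\<close>
    and m: "m \<ge> 1"
    and q: "q \<in> R0"
    and y: "y ^ m = q"
    and q_power_free: "power_free m R0 q"
    and irred: "irreducible_over (field_adjoin (alg_closure_of F) (to_ac ` t ` {1..j}))
                  (Polynomial.monom 1 m - [:to_ac q:])"
    and Q: "\<And>l. l \<in> {1..<m} \<Longrightarrow> Q l \<in> R0"
    and Q_squarefree: "\<And>l. l \<in> {1..<m} \<Longrightarrow> power_free 2 R0 (Q l)"
    and Q_coprime: "\<And>k l. k \<in> {1..<m} \<Longrightarrow> l \<in> {1..<m} \<Longrightarrow> k \<noteq> l \<Longrightarrow> gcd_one R0 {Q k, Q l}"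
    and c: "c \<in> F - {0}"
    and q_decomp: "q = c * (\<Prod>l\<in>{1..<m}. Q l ^ l)"
    and K1: "K1 = field_adjoin K0 {y}"
    \<comment> \<open>(T3)\<close>
    and jn: "j \<le> n"
    and t_high: "\<And>i. i \<in> {j<..n} \<Longrightarrow> transcendental_over (field_adjoin K1 (t ` {j<..<i})) (t i)"
    and Dt_high: "\<And>i. i \<in> {j<..n} \<Longrightarrow> D (t i) \<in> field_adjoin K1 (t ` {j<..i})"
    \<comment> \<open>(T4): the ambient type is the field \<open>L\<close>\<close>
    and L: "(UNIV :: 'a set) = field_adjoin K1 (t ` {j<..n})"
    and constants: "{x. D x = 0} = F"
    \<comment> \<open>notation\<close>
    and R: "R = ring_adjoin F (t ` {1..n})"
    and \<O>: "\<O> = integral_closure R0 K1"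
    and E: "\<And>i. E i = (\<Prod>l\<in>{1..<m}. Q l ^ (i * l div m))"
    and w: "\<And>i. w i = y ^ i / E i"
    and \<A>: "\<A> = ring_adjoin \<O> (t ` {j<..n})"
  shows
    \<comment> \<open>\<open>\<A>\<close> is the free \<open>R\<close>-module on \<open>w 0, \<dots>, w (m - 1)\<close>\<close>
    "(\<A> = {\<Sum>i<m. a i * w i | a. \<forall>i<m. a i \<in> R} \<and>
      (\<forall>a. (\<forall>i<m. a i \<in> R) \<and> (\<Sum>i<m. a i * w i) = 0 \<longrightarrow> (\<forall>i<m. a i = 0)))
     \<and>
     (\<A> = integral_closure R UNIV \<and> krull_domain \<A>)
     \<and>
     (\<forall>g. (\<exists>d a. reduced_rep R m w g d a) \<and>
          (\<forall>d a d' a'. reduced_rep R m w g d a \<and> reduced_rep R m w g d' a' \<longrightarrow>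
             (\<exists>u \<in> F - {0}. d' = u * d \<and> (\<forall>i<m. a' i = u * a i))))
     \<and>
     (krull_domain \<O> \<and>
      (\<exists>\<phi> \<in> iso (class_group \<O>) (class_group \<A>).
         \<forall>I. divisorial \<O> I \<longrightarrow>
             \<phi> (divisor_class \<O> I) = divisor_class \<A> (extend_divisor \<A> I)) \<and>
      Units (induced_ring \<A>) = Units (induced_ring \<O>))"
proof -
  interpret F: field_subfield F by (rule subfield_imp_field_subfield) (rule F)

  \<comment> \<open>The rings \<open>F[t_1, ..., t_k]\<close> and the fields below the
    generators\<close>
  define R' where "R' k = ring_adjoin F (t ` {1..k})" for k
  \<comment> \<open>Strictly below \<open>k\<close>: for \<open>k > j\<close> this is the field over
    which \<open>t k\<close> is assumed transcendental. The generators up to \<open>t j\<close>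
    enter through \<open>K1\<close>.\<close>
  define S' where "S' k = field_adjoin K1 (t ` {j<..<k})" for k
  have R0': "R0 = R' j" and R_n: "R = R' n" by (simp_all only: R'_def R0 R)
  have R'_ring: "field_subring (R' k)" for k unfolding R'_def by (rule field_subring_generate_ring)
  have R'_0: "R' 0 = F" unfolding R'_def using F.ring_adjoin_empty by simp
  have R'_Suc: "R' (Suc k) = ring_adjoin (R' k) {t (Suc k)}" for k
  proof -
    have *: "t ` {1..Suc k} = insert (t (Suc k)) (t ` {1..k})" by (simp add: atLeastAtMostSuc_conv)
    show ?thesis unfolding R'_def * by (rule ring_adjoin_insert)
  qed
  have R'_mono: "R' i \<subseteq> R' k" if "i \<le> k" for i k
  proof -
    have "F \<union> t ` {1..i} \<subseteq> F \<union> t ` {1..k}" using that by auto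
    also have "\<dots> \<subseteq> R' k" unfolding R'_def by (rule generate_ring_incl_subset)
    finally show ?thesis
      unfolding R'_def[of i] by (rule field_subring.ring_adjoin_least[OF R'_ring])
  qed
  have F_sub: "F \<subseteq> R' k" for k using R'_mono[of 0 k] R'_0 by simp

  have S'_field: "field_subfield (S' k)" for k unfolding S'_def by (rule field_subfield_generate_field)
  have K0_eq: "K0 = fractions R0" unfolding K0 R0 by (rule F.field_adjoin_eq_fractions)
  have K0_K1: "K0 \<subseteq> K1" and y_K1: "y \<in> K1" unfolding K1 using generate_field_incl_subset by blast+
  have K1_S': "K1 \<subseteq> S' k" for k unfolding S'_def using generate_field_incl_subset by blast
  have t_S': "t i \<in> S' k" if "i < k" "i \<ge> 1" for i k
  proof (cases "i \<le> j")
    case True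
    then have "t i \<in> K0" unfolding K0 using that generate_field_incl_subset by fastforce
    then show ?thesis using K0_K1 K1_S' by blast
  next
    case False
    then show ?thesis unfolding S'_def using that generate_field_incl_subset by fastforce
  qed
  have R'_S': "R' k \<subseteq> S' (Suc k)" for k
  proof -
    interpret field_subfield "S' (Suc k)" by (rule S'_field)
    have "F \<subseteq> K0" unfolding K0 using generate_field_incl_subset by blast
    then show ?thesis
      unfolding R'_def using K0_K1 K1_S' t_S' by (intro ring_adjoin_least) auto
  qed
  have trans_S': "transcendental_over (S' k) (t k)" if "k \<in> {j<..n}" for k
    using t_high[OF that] by (simp only: S'_def)
  \<comment> \<open>Up to \<open>j\<close> the hypothesis is about exactly this fraction field;
    beyond \<open>j\<close> it is about the larger field \<open>S' (Suc k)\<close> and is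
    restricted.\<close>
  have trans_R': "transcendental_over (fractions (R' k)) (t (Suc k))" if "k < n" for k
  proof (cases "Suc k \<le> j")
    case True
    then have "transcendental_over (field_adjoin F (t ` {1..<Suc k})) (t (Suc k))" by (intro t_low) auto
    then show ?thesis unfolding F.field_adjoin_eq_fractions atLeastLessThanSuc_atLeastAtMost R'_def .
  next
    case False
    interpret field_subfield "S' (Suc k)" by (rule S'_field)
    interpret R': field_subring "R' k" by (rule R'_ring)
    show ?thesis
      using trans_S'[of "Suc k"] False that R'.fractions_least[OF field_subfield_axioms R'_S']
      by (auto intro: transcendental_over_antimono)
  qed

  have R'_normal: "noetherian_normal (R' k)" if "k \<le> n" for k
    using that
  proof (induction k)
    case (Suc k)
    then show ?case unfolding R'_Suc using noetherian_normal_adjoin(1)[OF _ trans_R'[of k]] by simp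
  qed (simp add: R'_0 F.noetherian_normal_field)
  have R'_ext: "divisor_extension (R' k) (R' (Suc k))" "factor_closed (R' k) (R' (Suc k))" if "k < n" for k
    unfolding R'_Suc using noetherian_normal_adjoin(2,3)[OF R'_normal trans_R'] that by auto
  have R'_trivial: "class_trivial (R' k)" if "k \<le> n" for k
    using that
  proof (induction k)
    case (Suc k)
    then show ?case using class_trivial_extension[OF R'_ring R'_ring R'_ext(1)[of k]] by simp
  qed (simp add: R'_0 F.class_trivial_field)
  \<comment> \<open>With \<open>i = j\<close> this lifts the hypotheses on \<open>Q\<close> from
    \<open>R0\<close>; with \<open>i = 0\<close> it confines the units of \<open>R\<close> to
    \<open>F\<close>.\<close>
  have R'_closed: "factor_closed (R' i) (R' k)" if "i \<le> k" "k \<le> n" for i k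
    using that
  proof (induction k rule: dec_induct)
    case (step k)
    then show ?case using factor_closed_trans[OF _ R'_ext(2)[of k]] by simp
  qed (simp add: factor_closed_refl)

  \<comment> \<open>Linear independence of the powers of \<open>y\<close>\<close>
  have Q_nonzero: "Q l \<noteq> 0" if "l \<in> {1..<m}" for l
    using power_free_nonzero[OF Q_squarefree[OF that]] R'_ring[of j] R0' by simp
  have indep_base: "\<forall>i<m. a i = 0" if a: "\<forall>i<m. a i \<in> K0" "(\<Sum>i<m. a i * y ^ i) = 0" for a
  proof -
    interpret K0: field_subfield K0 unfolding K0 by (rule field_subfield_generate_field)
    let ?A = "field_adjoin (alg_closure_of F) (to_ac ` t ` {1..j})"
    interpret A: field_subfield ?A by (rule field_subfield_generate_field)
    \<comment> \<open>The preimage of \<open>?A\<close> is a subfield containing \<open>F\<close>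
      and the \<open>t i\<close>, hence \<open>K0\<close>. So a factorisation over \<open>K0\<close>
      becomes one over \<open>?A\<close> with the same degrees, where irreducibility is
      assumed.\<close>
    have "field_subfield {x. to_ac x \<in> ?A}"
    proof (intro field_subfieldI field_subringI; (elim CollectE)?; (intro CollectI)?)
      show "to_ac 1 \<in> ?A" unfolding to_ac_1 by (rule A.one)
      fix a b assume ab: "to_ac a \<in> ?A" "to_ac b \<in> ?A"
      show "to_ac (- a) \<in> ?A" unfolding to_ac_minus using ab(1) by (rule A.uminus)
      show "to_ac (inverse a) \<in> ?A" unfolding to_ac_inverse using ab(1) by (rule A.inverse)
      show "to_ac (a + b) \<in> ?A" unfolding to_ac_add using ab by (rule A.add)
      show "to_ac (a * b) \<in> ?A" unfolding to_ac_mult using ab by (rule A.mult)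
    qed
    moreover have "to_ac b \<in> alg_closure_of F" if "b \<in> F" for b
    proof -
      \<comment> \<open>The linear polynomial witnesses that elements of \<open>F\<close> are
        algebraic over \<open>F\<close>.\<close>
      have "[:- to_ac b, 1:] \<in> polys_over (to_ac ` F)"
        using imageI[OF F.uminus[OF that], of to_ac] imageI[OF F.one, of to_ac] imageI[OF F.zero, of to_ac]
        by (auto simp: polys_over_def coeff_pCons split: nat.split)
      then show ?thesis unfolding alg_closure_of_def transcendental_over_def
        by (intro CollectI notI) (drule bspec[of _ _ "[:- to_ac b, 1:]"], auto)
    qed
    ultimately have "K0 \<subseteq> {x. to_ac x \<in> ?A}"
      unfolding K0 using generate_field_incl_subset[of "alg_closure_of F \<union> to_ac ` t ` {1..j}"]
      by (intro field_subfield.field_adjoin_least) auto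
    then have map_K0: "map_poly to_ac p \<in> polys_over ?A" if "p \<in> polys_over K0" for p
      using that by (intro polys_overI) (auto simp: coeff_map_poly)
    have deg_map: "Polynomial.degree (map_poly to_ac p) = Polynomial.degree p" for p :: "'a poly"
      by (rule degree_map_poly) auto
    let ?M = "Polynomial.monom 1 m - [:q:]"
    have q_K0: "q \<in> K0" using q field_subring.subset_fractions[OF R'_ring[of j]] by (auto simp: K0_eq R0')
    have coeffM: "Polynomial.coeff ?M i = (if i = m then 1 else if i = 0 then - q else 0)" for i
      using m by (auto simp: coeff_pCons split: nat.split)
    show ?thesis
    proof (rule K0.irreducible_imp_indep[of ?M])
      show "?M \<in> polys_over K0" using q_K0 by auto
      show "poly ?M y = 0" by (simp add: poly_monom y)
      show "Polynomial.degree ?M = m"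
        by (intro antisym degree_le le_degree) (auto simp: coeffM simp del: coeff_diff)
      fix r h assume rh: "r \<in> polys_over K0" "h \<in> polys_over K0" "?M = r * h"
      have "Polynomial.monom 1 m - [:to_ac q:] = map_poly to_ac ?M"
        by (auto simp: poly_eq_iff coeff_map_poly coeff_pCons split: nat.split)
      also have "\<dots> = map_poly to_ac r * map_poly to_ac h" unfolding rh(3) by (rule map_poly_to_ac_mult)
      finally show "Polynomial.degree r = 0 \<or> Polynomial.degree h = 0"
        using irred[unfolded irreducible_over_def, THEN conjunct2, THEN conjunct2, THEN bspec, OF map_K0[OF rh(1)],
            THEN bspec, OF map_K0[OF rh(2)]] by (simp only: deg_map simp_thms)
    qed (use a in auto)
  qed
  \<comment> \<open>Beyond \<open>j\<close> the element \<open>y\<close> lies below the new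
    generator, so independence survives by comparing coefficients in that generator.\<close>
  have indep: "\<forall>i<m. a i = 0" if "j \<le> k" "k \<le> n" "\<forall>i<m. a i \<in> R' k" "(\<Sum>i<m. a i * y ^ i) = 0" for k a
    using that
  proof (induction k arbitrary: a rule: dec_induct)
    case base
    then show ?case
      using field_subring.subset_fractions[OF R'_ring[of j]] by (intro indep_base) (auto simp: K0_eq R0')
  next
    case (step k)
    interpret S: field_subfield "S' (Suc k)" by (rule S'_field)
    show ?case
    proof (rule indep_adjoin[OF R'_ring S.field_subring_axioms R'_S' _ trans_S'])
      show "y \<in> S' (Suc k)" using y_K1 K1_S' by blast
      show "\<forall>i<m. a i = 0" if "\<forall>i<m. a i \<in> R' k" "(\<Sum>i<m. a i * y ^ i) = 0" for a
        using step that by auto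
    qed (use step R'_Suc in auto)
  qed

  \<comment> \<open>Integral closures over the polynomial rings form a tower\<close>
  have radical: "radical_extension (R' k) y q c m Q" if k: "j \<le> k" "k \<le> n" for k
  proof
    interpret field_subring "R' k" by (rule R'_ring)
    note closed = R'_closed[OF k]
    show "noetherian_normal (R' k)" "class_trivial (R' k)" using R'_normal R'_trivial k by auto
    show "inverse (of_nat m) \<in> R' k" "c \<in> R' k" "inverse c \<in> R' k" "c \<noteq> 0"
      using c F_sub[of k] F.inverse[of c] F.inverse[of "of_nat m"] by auto
    show "Q l \<in> R' k" "power_free 2 (R' k) (Q l)" if "l \<in> {1..<m}" for l
      using Q[OF that] R'_mono[OF k(1)] factor_closed_power_free[OF closed R'_ring, of 2 "Q l"]
        Q_squarefree[OF that] Q_nonzero[OF that] by (auto simp: R0')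
    show "gcd_one (R' k) {Q i, Q l}" if "i \<in> {1..<m}" "l \<in> {1..<m}" "i \<noteq> l" for i l
      using that Q Q_nonzero Q_coprime
      by (intro factor_closed_gcd_one[OF closed R'_ring]) (simp_all only: R0', simp_all)
    show "\<forall>i<m. a i = 0" if "\<forall>i<m. a i \<in> R' k" "(\<Sum>i<m. a i * y ^ i) = 0" for a
      using indep k that by blast
  qed (use m y q_decomp in auto)
  \<comment> \<open>The same \<open>w\<close> serves every \<open>k\<close>, because
    \<open>E i\<close> is built from elements of \<open>R0\<close>; only the coefficient ring
    grows.\<close>
  define B where "B k = lincomb (R' k) {..<m} w" for k
  have w_eq: "radical_extension.w y m Q = w" and B_eq: "radical_extension.W (R' k) y m Q = B k"
    if "j \<le> k" "k \<le> n" for k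
  proof -
    interpret radical_extension "R' k" y q c m Q by (rule radical[OF that])
    show w_eq: "radical_extension.w y m Q = w"
      by (rule ext) (simp add: w_def E_def E \<open>\<And>i. w i = y ^ i / E i\<close>)
    show "radical_extension.W (R' k) y m Q = B k" unfolding W_def B_def w_eq ..
  qed
  have B_ring: "field_subring (B k)" and B_normal: "noetherian_normal (B k)"
    and B_least: "is_submodule (R' k) M \<Longrightarrow> (\<And>i. w i \<in> M) \<Longrightarrow> B k \<subseteq> M"
    and w_B: "w i \<in> B k" and R'_B: "R' k \<subseteq> B k"
    if "j \<le> k" "k \<le> n" for k i M
  proof -
    interpret radical_extension "R' k" y q c m Q by (rule radical[OF that])
    show "field_subring (B k)" "noetherian_normal (B k)" "w i \<in> B k" "R' k \<subseteq> B k"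
      using field_subring_W noetherian_normal_W w_mem[of i] R_subset_W B_eq[OF that] w_eq[OF that] by auto
    show "is_submodule (R' k) M \<Longrightarrow> (\<And>i. w i \<in> M) \<Longrightarrow> B k \<subseteq> M"
      unfolding B_def by (rule lincomb_least)
  qed
  \<comment> \<open>Enlarging the coefficients amounts to adjoining \<open>t (Suc k)\<close>. This
    is the link between the integral closures and the polynomial extensions of
    \<open>\<O>\<close>.\<close>
  have B_Suc: "B (Suc k) = ring_adjoin (B k) {t (Suc k)}" if k: "j \<le> k" "k < n" for k
  proof
    interpret B: field_subring "B (Suc k)" using B_ring k by simp
    interpret A: field_subring "ring_adjoin (B k) {t (Suc k)}" by (rule field_subring_generate_ring)
    have R'_sub: "R' (Suc k) \<subseteq> ring_adjoin (B k) {t (Suc k)}"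
      unfolding R'_Suc using R'_B[of k] k generate_ring_incl_subset[of "B k \<union> {t (Suc k)}"]
      by (intro field_subring.ring_adjoin_least[OF field_subring_generate_ring]) auto
    show "B (Suc k) \<subseteq> ring_adjoin (B k) {t (Suc k)}"
    proof (rule B_least)
      show "is_submodule (R' (Suc k)) (ring_adjoin (B k) {t (Suc k)})"
        by (rule is_submodule_antimono[OF A.is_submodule_self R'_sub])
      show "w i \<in> ring_adjoin (B k) {t (Suc k)}" for i
        using w_B[of k i] k generate_ring_incl_subset[of "B k \<union> {t (Suc k)}"] by auto
    qed (use k in auto)
    have "t (Suc k) \<in> R' (Suc k)" unfolding R'_def by (intro generate_ring.incl) auto
    moreover have "B k \<subseteq> B (Suc k)" unfolding B_def by (intro lincomb_mono R'_mono) simp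
    ultimately show "ring_adjoin (B k) {t (Suc k)} \<subseteq> B (Suc k)"
      using R'_B[of "Suc k"] k by (intro B.ring_adjoin_least) auto
  qed

  \<comment> \<open>At level \<open>j\<close> the abstract field \<open>L\<close> of the radical
    extension is \<open>K1\<close>, so the integral closure theorem identifies
    \<open>\<O>\<close>.\<close>
  have K1_frac: "K1 = fractions (B j)" and O_eq: "\<O> = B j"
  proof -
    interpret radical_extension "R' j" y q c m Q by (rule radical) (use jn in auto)
    interpret L: field_subfield L by (rule field_subfield_L)
    interpret K1: field_subfield K1 unfolding K1 by (rule field_subfield_generate_field)
    have "K1 \<subseteq> L"
      unfolding K1 K0_eq R0' using K_subset_L y_power_mem[of 1] by (intro L.field_adjoin_least) auto
    moreover have "L \<subseteq> K1"
      unfolding L_def using K0_K1 y_K1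
      by (intro lincomb_least is_submodule_antimono[OF K1.is_submodule_self]) (auto simp: K0_eq R0')
    ultimately have "K1 = L" by blast
    then show "K1 = fractions (B j)" "\<O> = B j"
      using fractions_W integral_closure_eq_W B_eq[of j] jn unfolding \<O> R0' by auto
  qed
  have B_adjoin: "B k = ring_adjoin \<O> (t ` {j<..k})" if "j \<le> k" "k \<le> n" for k
    using that
  proof (induction k rule: dec_induct)
    case base
    then show ?case using field_subring.ring_adjoin_empty[OF B_ring[of j]] jn by (simp add: O_eq)
  next
    case (step k)
    have *: "t ` {j<..Suc k} = insert (t (Suc k)) (t ` {j<..k})"
      using step.hyps by (auto simp: le_Suc_eq)
    show ?case
      using step B_Suc[of k] unfolding * ring_adjoin_insert[of \<O> "t (Suc k)" "t ` {j<..k}"] by simp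
  qed
  have A_eq: "\<A> = B n" unfolding \<A> using B_adjoin[of n] jn by simp
  \<comment> \<open>\<open>B k\<close> is generated by \<open>\<O>\<close> and earlier generators,
    all inside the field over which \<open>t (Suc k)\<close> is transcendental.\<close>
  have trans_B: "transcendental_over (fractions (B k)) (t (Suc k))" if k: "j \<le> k" "k < n" for k
  proof -
    interpret S: field_subfield "S' (Suc k)" by (rule S'_field)
    interpret B: field_subring "B k" using B_ring k by simp
    have "\<O> \<subseteq> K1" unfolding O_eq K1_frac using field_subring.subset_fractions[OF B_ring[of j]] jn by auto
    then have "\<O> \<union> t ` {j<..k} \<subseteq> S' (Suc k)"
      using K1_S'[of "Suc k"] t_S'[of _ "Suc k"] by auto
    then have "B k \<subseteq> S' (Suc k)"
      using B_adjoin[of k] k S.ring_adjoin_least[of "\<O> \<union> t ` {j<..k}"] by simp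
    from B.fractions_least[OF S'_field this] show ?thesis
      using trans_S'[of "Suc k"] k by (auto intro: transcendental_over_antimono)
  qed
  have B_ext: "divisor_extension \<O> (B k)" "factor_closed \<O> (B k)" if "j \<le> k" "k \<le> n" for k
  proof -
    have "divisor_extension (B j) (B k) \<and> factor_closed (B j) (B k)"
      using that
    proof (induction k rule: dec_induct)
      case base
      then show ?case
        using field_subring.divisor_extension_refl[OF B_ring[of j]] by (simp add: factor_closed_refl)
    next
      case (step k)
      have k: "j \<le> k" "k \<le> n" "k < n" using step by auto
      have "divisor_extension (B k) (B (Suc k))" "factor_closed (B k) (B (Suc k))"
        unfolding B_Suc[OF k(1,3)]
        using noetherian_normal_adjoin(2,3)[OF B_normal[OF k(1,2)] trans_B[OF k(1,3)]] by auto
      then show ?case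
        using step k divisor_extension_trans[OF B_ring[of j] B_ring[of k] B_ring[of "Suc k"]]
          factor_closed_trans[of "B j" "B k" "B (Suc k)"] by auto
    qed
    then show "divisor_extension \<O> (B k)" "factor_closed \<O> (B k)" by (simp_all add: O_eq)
  qed

  \<comment> \<open>The top of the tower\<close>
  interpret rad: radical_extension "R' n" y q c m Q by (rule radical) (use jn in auto)
  have w_n: "rad.w = w" and W_n: "rad.W = B n" using w_eq[of n] B_eq[of n] jn by auto
  have A_ring: "field_subring \<A>" and A_normal: "noetherian_normal \<A>"
    and O_ring: "field_subring \<O>" and O_normal: "noetherian_normal \<O>"
    using B_ring B_normal jn by (auto simp: A_eq O_eq)
  \<comment> \<open>Needed to read the integral closure inside the fraction field as the one inside
    the whole ambient field.\<close>
  have frac_A: "fractions \<A> = UNIV"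
  proof -
    interpret A: field_subring \<A> by (rule A_ring)
    interpret Q: field_subfield "fractions \<A>" by (rule A.field_subfield_fractions)
    have "\<O> \<subseteq> \<A>" using divisor_extensionD(1)[OF B_ext(1)[of n]] jn by (simp add: A_eq)
    then have "K1 \<subseteq> fractions \<A>" unfolding K1_frac O_eq[symmetric] by (rule fractions_mono)
    moreover have "t ` {j<..n} \<subseteq> \<A>" unfolding \<A> by (rule order_trans[OF _ generate_ring_incl_subset]) simp
    ultimately have "field_adjoin K1 (t ` {j<..n}) \<subseteq> fractions \<A>"
      using A.subset_fractions by (intro Q.field_adjoin_least) blast
    then show ?thesis using L by blast
  qed
  have L_n: "rad.L = UNIV" using rad.fractions_W frac_A by (simp add: W_n A_eq)

  have free: "\<A> = {\<Sum>i<m. a i * w i | a. \<forall>i<m. a i \<in> R}"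
    unfolding A_eq B_def lincomb_def R_n Ball_def lessThan_iff ..
  have free': "\<forall>i<m. a i = 0" if "\<forall>i<m. a i \<in> R" "(\<Sum>i<m. a i * w i) = 0" for a
  proof (intro allI impI)
    fix i assume "i < m"
    have "\<forall>i<m. a i \<in> rad.K" using that(1) rad.subset_fractions unfolding R_n by blast
    then show "a i = 0" using that(2) \<open>i < m\<close> unfolding w_n[symmetric] by (rule rad.indep_w)
  qed
  have closure: "\<A> = integral_closure R UNIV"
    using rad.integral_closure_eq_W by (simp add: L_n W_n A_eq R_n)
  have krull: "krull_domain \<A>" "krull_domain \<O>"
    using noetherian_normalD(4)[OF A_normal] noetherian_normalD(4)[OF O_normal] by auto

  \<comment> \<open>Reduced representations\<close>
  have rep_exists: "\<exists>d a. reduced_rep R m w g d a" for g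
  proof -
    have "g \<in> rad.L" by (simp add: L_n)
    then obtain b where b: "\<forall>i\<in>{..<m}. b i \<in> rad.K" "g = (\<Sum>i<m. b i * y ^ i)"
      unfolding rad.L_def by (rule lincombE)
    \<comment> \<open>The factor \<open>E i\<close> converts coordinates with respect to
      \<open>y ^ i\<close> into coordinates with respect to \<open>w i\<close>.\<close>
    have "b i * rad.E i \<in> rad.K" if "i \<in> {..<m}" for i using b(1) that rad.E_mem by auto
    then obtain d a where da: "d \<in> R' n" "d \<noteq> 0" "\<forall>i\<in>{..<m}. a i \<in> R' n"
        "\<forall>i\<in>{..<m}. b i * rad.E i = a i / d" "gcd_one (R' n) (insert d (a ` {..<m}))"
      by (rule rad.reduced_fraction[OF rad.R(2) finite_lessThan])
    have "g = (\<Sum>i<m. (b i * rad.E i) * w i)"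
      unfolding b(2) w_n[symmetric] rad.w_def using rad.E_nonzero by simp
    also have "\<dots> = (\<Sum>i<m. (a i / d) * w i)" using da(4) by (intro sum.cong) auto
    finally show ?thesis
      unfolding reduced_rep_def R_n using da by (intro exI[of _ d] exI[of _ a]) auto
  qed
  have rep_unique: "\<exists>u\<in>F - {0}. d' = u * d \<and> (\<forall>i<m. a' i = u * a i)"
    if "reduced_rep R m w g d a" "reduced_rep R m w g d' a'" for g d a d' a'
  proof -
    have d: "d \<in> R' n" "d \<noteq> 0" "\<forall>i<m. a i \<in> R' n" "g = (\<Sum>i<m. (a i / d) * w i)"
        "gcd_one (R' n) (insert d (a ` {..<m}))"
      and d': "d' \<in> R' n" "d' \<noteq> 0" "\<forall>i<m. a' i \<in> R' n" "g = (\<Sum>i<m. (a' i / d') * w i)"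
        "gcd_one (R' n) (insert d' (a' ` {..<m}))"
      using that unfolding reduced_rep_def R_n by blast+
    have eq: "a i / d = a' i / d'" if "i < m" for i
    proof -
      have "(\<Sum>i<m. (a i / d - a' i / d') * rad.w i) = 0"
        using d(4) d'(4) by (simp add: w_n left_diff_distrib sum_subtractf)
      then have "a i / d - a' i / d' = 0"
        using d d' that by (intro rad.indep_w[of "\<lambda>i. a i / d - a' i / d'"]) auto
      then show ?thesis by simp
    qed
    \<comment> \<open>Multiplication by \<open>v / u\<close> sends \<open>u\<close> to
      \<open>v\<close> and each \<open>b i\<close> to \<open>e i\<close>, so it carries a coprime
      set into \<open>R' n\<close> and \<open>gcd_one_colon\<close> applies.\<close>
    have ratio: "v / u \<in> R' n"
      if "u \<in> R' n" "u \<noteq> 0" "v \<in> R' n" "v \<noteq> 0" "\<forall>i<m. b i \<in> R' n" "\<forall>i<m. e i \<in> R' n"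
        "gcd_one (R' n) (insert u (b ` {..<m}))" "\<And>i. i < m \<Longrightarrow> b i / u = e i / v" for u v b e
    proof (rule rad.gcd_one_colon[OF rad.R(2) that(7), of u])
      fix s assume s: "s \<in> insert u (b ` {..<m})"
      show "v / u * s \<in> R' n"
      proof (cases "s = u")
        case False
        then obtain i where i: "i < m" "s = b i" using s by auto
        have "v / u * s = v * (b i / u)" using i by simp
        also have "\<dots> = e i" unfolding that(8)[OF i(1)] using that(4) by simp
        finally show ?thesis using that(6) i(1) by simp
      qed (use that in simp)
    qed (use that in \<open>auto intro: fractionsI\<close>)
    have "d' / d \<in> R' n" by (rule ratio[OF d(1,2) d'(1,2) d(3) d'(3) d(5) eq])
    moreover have "d / d' \<in> R' n" by (rule ratio[OF d'(1,2) d(1,2) d'(3) d(3) d'(5) eq[symmetric]])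
    \<comment> \<open>Both quotients of the denominators lie in \<open>R' n\<close> and their
      product is \<open>1\<close>, so they are factors of an element of \<open>F\<close>.\<close>
    moreover have "factor_closed F (R' n)" using R'_closed[of 0 n] R'_0 by simp
    ultimately have "d' / d \<in> F"
      using factor_closedD(1)[of F "R' n" "d' / d" "d / d'"] d(2) d'(2) by simp
    then show ?thesis
      using d(2) d'(2) eq by (intro bexI[of _ "d' / d"]) (auto simp: field_simps)
  qed
  have class_iso: "\<exists>\<phi> \<in> iso (class_group \<O>) (class_group \<A>).
      \<forall>I. divisorial \<O> I \<longrightarrow> \<phi> (divisor_class \<O> I) = divisor_class \<A> (extend_divisor \<A> I)"
    using B_ext(1)[of n] jn A_eq O_normal A_normal
    by (intro class_group_iso_if_divisor_extension) (auto simp: noetherian_normal_def)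
  have units: "Units (induced_ring \<A>) = Units (induced_ring \<O>)"
    using B_ext(2)[of n] jn O_ring by (intro factor_closed_Units) (auto simp: A_eq)
  show ?thesis
    using free free' closure krull rep_exists rep_unique class_iso units by (intro conjI) blast+
qed

end
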